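(* Let $G$ be a group and let $\mathcal{B}\subseteq\mathcal{B}^{\mathrm{st}}_G$ be a left-invariant Boolean algebra. Then: \begin{enumerate} \item[(a)] $(S(\mathcal{B}^\sharp),\ast)$ is a $G$-semigroup, and it is isomorphic (as a $G$-semigroup) to the Ellis semigroup $(E(S(\mathcal{B})),\circ)$ of the $G$-flow $S(\mathcal{B})$; \item[(b)] $S(\mathcal{B})$ is a weakly almost periodic $G$-flow; \item[(c)] $S^{g}(\mathcal{B})$ is the unique minimal subflow of $S(\mathcal{B})$; \item[(d)] $(S^{g}(\mathcal{B}^\sharp),\ast)$, with the subspace topology, is a profinite group; \item[(e)] there is a unique left-invariant probability measure on $\mathcal{B}$. \end{enumerate}
   Context: $A\subseteq G$ is stable in $G$ if there do not exist an infinite linear order $I$ and sequences $(a_i),(b_i)$ in $G$ with $a_ib_j\in A$ iff $i\le j$; $\mathcal{B}^{\mathrm{st}}_G$ is the set of stable subsets of $G$. $A\subseteq G$ is generic if $G=FA$ for some finite $F\subseteq G$. A Boolean algebra $\mathcal{B}\subseteq\mathcal{P}(G)$ is left-invariant if $gA\in\mathcal{B}$ for $g\in G,A\in\mathcal{B}$, bi-invariant if also $Ag\in\mathcal{B}$; $\mathcal{B}^\sharp$ is the smallest bi-invariant Boolean algebra containing $\mathcal{B}$. For a Boolean algebra $\mathcal{C}$ of subsets of $G$, a $\mathcal{C}$-type is a set $p\subseteq\mathcal{C}$ with $\emptyset\notin p$, closed under finite intersections, such that for each $A\in\mathcal{C}$ either $A\in p$ or $G\setminus A\in p$; $S(\mathcal{C})$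 is the set of $\mathcal{C}$-types, with the compact Hausdorff topology generated by $S_A(\mathcal{C})=\{p:A\in p\}$, $A\in\mathcal{C}$; $G$ acts by $gp=\{gA:A\in p\}$ when $\mathcal{C}$ is left-invariant. A type is generic if all its members are generic sets; $S^g(\mathcal{C})$ is the set of generic $\mathcal{C}$-types. For $p\in S(\mathcal{C})$, $A\in\mathcal{C}$: $dp(A)=\{x\in G:x^{-1}A\in p\}$, and $p\ast q=\{A\in\mathcal{C}:dq(A)\in p\}$. A $G$-flow is a nonempty compact Hausdorff space with a $G$-action by homeomorphisms; a subflow is a nonempty closed $G$-invariant subset; minimal means no proper subflow. For a $G$-flow $S$, $\pi_a(x)=ax$, and $E(S)$ is the closure of $\{\pi_a:a\in G\}$ in $S^S$, a semigroup under $\circ$ and a $G$-flow via $(a,f)\mapsto\pi_a\circ f$. A $G$-semigroup is a $G$-flow with a semigroup operation $\cdot$ with $g(p\cdot q)=(gp)\cdot q$. A $G$-flow $S$ is weakly almost periodic if for every continuous $f:S\to\mathbb{C}$ the set $\{f^a:a\in G\}$, where $f^a(x)=f(ax)$, is relatively compact in the weak topology on the Banach space $\mathcal{C}(S)$ of continuous complex functions. A probability measure on $\mathcal{B}$ is a finitely additive $\mu:\mathcal{B}\to[0,1]$ with $\mu(G)=1$, left-invariant if $\mu(gA)=\mu(A)$. *)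

theory Defs
  imports "HOL-Analysis.Analysis" "HOL-Algebra.Group_Action"
begin

subsection \<open>Stable and generic sets, invariant Boolean algebras\<close>

text \<open>
  The index set of the linear order is a set of group elements. This loses no generality: a family
  \<open>a\<close> as below is necessarily injective, so any order that admits such families embeds
  into the group. See \<open>stable_in_no_order\<close>, where the index type is arbitrary.
\<close>
definition stable_in :: "('a, 'm) monoid_scheme \<Rightarrow> 'a set \<Rightarrow> bool" where
  "stable_in G A \<longleftrightarrow> A \<subseteq> carrier G \<and>
     \<not> (\<exists>(I :: 'a set) r a b. infinite I \<and> linear_order_on I r \<and>
          a \<in> I \<rightarrow> carrier G \<and> b \<in> I \<rightarrow> carrier G \<and>
          (\<forall>i\<in>I. \<forall>j\<in>I. a i \<otimes>\<^bsub>G\<^esub> b j \<in> A \<longleftrightarrow> (i, j) \<in> r))"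

lemma stable_in_no_order:
  fixes I :: "'i set" and a b :: "'i \<Rightarrow> 'a"
  assumes st: "stable_in G A" and inf: "infinite I" and lin: "linear_order_on I r"
    and a: "a \<in> I \<rightarrow> carrier G" and b: "b \<in> I \<rightarrow> carrier G"
  shows "\<not> (\<forall>i\<in>I. \<forall>j\<in>I. a i \<otimes>\<^bsub>G\<^esub> b j \<in> A \<longleftrightarrow> (i, j) \<in> r)"
proof
  assume *: "\<forall>i\<in>I. \<forall>j\<in>I. a i \<otimes>\<^bsub>G\<^esub> b j \<in> A \<longleftrightarrow> (i, j) \<in> r"
  have rfl: "\<And>i. i \<in> I \<Longrightarrow> (i, i) \<in> r" and tr: "trans r" and an: "antisym r" and tot: "total_on I r"
    using lin by (auto simp: order_on_defs refl_on_def)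
  have inj: "inj_on a I"
    using * rfl an by (intro inj_onI) (metis antisymD)
  define c where "c = inv_into I a"
  have c: "c (a i) = i" if "i \<in> I" for i
    using inj that by (simp add: c_def)
  let ?r = "{(a i, a j) | i j. i \<in> I \<and> j \<in> I \<and> (i, j) \<in> r}"
  have "trans ?r"
  proof (rule transI)
    fix x y z assume "(x, y) \<in> ?r" "(y, z) \<in> ?r"
    then obtain i j j' k where
      "x = a i" "y = a j" "y = a j'" "z = a k" "i \<in> I" "j \<in> I" "j' \<in> I" "k \<in> I"
      "(i, j) \<in> r" "(j', k) \<in> r" by blast
    moreover have "j = j'" using calculation inj by (metis inj_onD)
    ultimately show "(x, z) \<in> ?r" using tr by (blast dest: transD)
  qed
  moreover have "antisym ?r"
  proof (rule antisymI)
    fix x y assume "(x, y) \<in> ?r" "(y, x) \<in> ?r"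
    then obtain i j i' j' where
      "x = a i" "y = a j" "y = a j'" "x = a i'" "i \<in> I" "j \<in> I" "j' \<in> I" "i' \<in> I"
      "(i, j) \<in> r" "(j', i') \<in> r" by blast
    moreover have "j = j'" "i = i'" using calculation inj by (metis inj_onD)+
    ultimately show "x = y" using an by (metis antisymD)
  qed
  moreover have "total_on (a ` I) ?r"
  proof (rule total_onI)
    fix x y assume "x \<in> a ` I" "y \<in> a ` I" "x \<noteq> y"
    then obtain i j where ij: "x = a i" "y = a j" "i \<in> I" "j \<in> I" by blast
    moreover have "(i, j) \<in> r \<or> (j, i) \<in> r"
      using tot ij \<open>x \<noteq> y\<close> by (metis total_on_def)
    ultimately show "(x, y) \<in> ?r \<or> (y, x) \<in> ?r" by blast
  qed
  moreover have "refl_on (a ` I) ?r" "?r \<subseteq> a ` I \<times> a ` I"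
    using rfl by (auto simp: refl_on_def)
  ultimately have "linear_order_on (a ` I) ?r"
    by (simp add: order_on_defs)
  moreover have "infinite (a ` I)"
    using inf inj by (simp add: finite_image_iff)
  moreover have "(\<lambda>x. x) \<in> a ` I \<rightarrow> carrier G" "b \<circ> c \<in> a ` I \<rightarrow> carrier G"
    using a b c by auto
  moreover have "\<forall>x\<in>a ` I. \<forall>y\<in>a ` I. x \<otimes>\<^bsub>G\<^esub> (b \<circ> c) y \<in> A \<longleftrightarrow> (x, y) \<in> ?r"
  proof (intro ballI)
    fix x y assume "x \<in> a ` I" "y \<in> a ` I"
    then obtain i j where ij: "x = a i" "y = a j" "i \<in> I" "j \<in> I" by blast
    have "(x, y) \<in> ?r \<longleftrightarrow> (i, j) \<in> r"
      using ij inj by (auto dest: inj_onD)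
    then show "x \<otimes>\<^bsub>G\<^esub> (b \<circ> c) y \<in> A \<longleftrightarrow> (x, y) \<in> ?r"
      using * ij c by simp
  qed
  ultimately have "\<exists>(J :: 'a set) s a b. infinite J \<and> linear_order_on J s \<and>
      a \<in> J \<rightarrow> carrier G \<and> b \<in> J \<rightarrow> carrier G \<and>
      (\<forall>i\<in>J. \<forall>j\<in>J. a i \<otimes>\<^bsub>G\<^esub> b j \<in> A \<longleftrightarrow> (i, j) \<in> s)"
    by blast
  with st show False unfolding stable_in_def by (elim conjE) (erule notE)
qed

definition stable_sets :: "('a, 'm) monoid_scheme \<Rightarrow> 'a set set" where
  "stable_sets G = {A. stable_in G A}"

definition generic_in :: "('a, 'm) monoid_scheme \<Rightarrow> 'a set \<Rightarrow> bool" where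
  "generic_in G A \<longleftrightarrow> A \<subseteq> carrier G \<and>
     (\<exists>F. finite F \<and> F \<subseteq> carrier G \<and> carrier G = F <#>\<^bsub>G\<^esub> A)"

definition left_invariant :: "('a, 'm) monoid_scheme \<Rightarrow> 'a set set \<Rightarrow> bool" where
  "left_invariant G \<B> \<longleftrightarrow> (\<forall>g\<in>carrier G. \<forall>A\<in>\<B>. g <#\<^bsub>G\<^esub> A \<in> \<B>)"

definition bi_invariant :: "('a, 'm) monoid_scheme \<Rightarrow> 'a set set \<Rightarrow> bool" where
  "bi_invariant G \<B> \<longleftrightarrow> left_invariant G \<B> \<and> (\<forall>g\<in>carrier G. \<forall>A\<in>\<B>. A #>\<^bsub>G\<^esub> g \<in> \<B>)"

definition sharp :: "('a, 'm) monoid_scheme \<Rightarrow> 'a set set \<Rightarrow> 'a set set" where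
  "sharp G \<B> = \<Inter>{\<C>. Sigma_Algebra.algebra (carrier G) \<C> \<and> bi_invariant G \<C> \<and> \<B> \<subseteq> \<C>}"

subsection \<open>Types\<close>

definition types :: "('a, 'm) monoid_scheme \<Rightarrow> 'a set set \<Rightarrow> 'a set set set" where
  "types G \<C> = {p. p \<subseteq> \<C> \<and> {} \<notin> p \<and> (\<forall>A\<in>p. \<forall>B\<in>p. A \<inter> B \<in> p) \<and>
     (\<forall>A\<in>\<C>. A \<in> p \<or> carrier G - A \<in> p)}"

definition type_space :: "('a, 'm) monoid_scheme \<Rightarrow> 'a set set \<Rightarrow> 'a set set topology" where
  "type_space G \<C> = topology_generated_by {{p \<in> types G \<C>. A \<in> p} | A. A \<in> \<C>}"

lemma topspace_type_space:
  assumes "Sigma_Algebra.algebra (carrier G) \<C>"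
  shows "topspace (type_space G \<C>) = types G \<C>"
proof -
  interpret Sigma_Algebra.algebra "carrier G" \<C> by fact
  have "carrier G \<in> p" if "p \<in> types G \<C>" for p
  proof -
    have "carrier G \<in> p \<or> carrier G - carrier G \<in> p" "{} \<notin> p"
      using that top unfolding types_def by blast+
    then show ?thesis by simp
  qed
  then show ?thesis
    using top by (auto simp: type_space_def)
qed

text \<open>
  As required by \<open>group_action\<close>, each \<open>type_action G \<C> g\<close> is extensional
  on the set of types, so it is literally an element of the product \<open>S\<^sup>S\<close> below.
\<close>
definition type_action :: "('a, 'm) monoid_scheme \<Rightarrow> 'a set set \<Rightarrow> 'a \<Rightarrow> 'a set set \<Rightarrow> 'a set set" where
  "type_action G \<C> g = (\<lambda>p\<in>types G \<C>. (\<lambda>A. g <#\<^bsub>G\<^esub> A) ` p)"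

definition generic_types :: "('a, 'm) monoid_scheme \<Rightarrow> 'a set set \<Rightarrow> 'a set set set" where
  "generic_types G \<C> = {p \<in> types G \<C>. \<forall>A\<in>p. generic_in G A}"

definition type_d :: "('a, 'm) monoid_scheme \<Rightarrow> 'a set set \<Rightarrow> 'a set \<Rightarrow> 'a set" where
  "type_d G p A = {x \<in> carrier G. inv\<^bsub>G\<^esub> x <#\<^bsub>G\<^esub> A \<in> p}"

definition type_mult ::
  "('a, 'm) monoid_scheme \<Rightarrow> 'a set set \<Rightarrow> 'a set set \<Rightarrow> 'a set set \<Rightarrow> 'a set set" where
  "type_mult G \<C> p q = {A \<in> \<C>. type_d G q A \<in> p}"

subsection \<open>Flows\<close>

definition G_flow :: "('a, 'm) monoid_scheme \<Rightarrow> 'b topology \<Rightarrow> ('a \<Rightarrow> 'b \<Rightarrow> 'b) \<Rightarrow> bool" where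
  "G_flow G X \<phi> \<longleftrightarrow> topspace X \<noteq> {} \<and> compact_space X \<and> Hausdorff_space X \<and>
     group_action G (topspace X) \<phi> \<and> (\<forall>g\<in>carrier G. homeomorphic_map X X (\<phi> g))"

definition subflow ::
  "('a, 'm) monoid_scheme \<Rightarrow> 'b topology \<Rightarrow> ('a \<Rightarrow> 'b \<Rightarrow> 'b) \<Rightarrow> 'b set \<Rightarrow> bool" where
  "subflow G X \<phi> Y \<longleftrightarrow> Y \<noteq> {} \<and> closedin X Y \<and> (\<forall>g\<in>carrier G. \<phi> g ` Y \<subseteq> Y)"

definition minimal_subflow ::
  "('a, 'm) monoid_scheme \<Rightarrow> 'b topology \<Rightarrow> ('a \<Rightarrow> 'b \<Rightarrow> 'b) \<Rightarrow> 'b set \<Rightarrow> bool" where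
  "minimal_subflow G X \<phi> Y \<longleftrightarrow> subflow G X \<phi> Y \<and> (\<forall>Z. subflow G X \<phi> Z \<and> Z \<subseteq> Y \<longrightarrow> Z = Y)"

definition ellis_set ::
  "('a, 'm) monoid_scheme \<Rightarrow> 'b topology \<Rightarrow> ('a \<Rightarrow> 'b \<Rightarrow> 'b) \<Rightarrow> ('b \<Rightarrow> 'b) set" where
  "ellis_set G X \<phi> = product_topology (\<lambda>_. X) (topspace X) closure_of (\<phi> ` carrier G)"

definition ellis_space ::
  "('a, 'm) monoid_scheme \<Rightarrow> 'b topology \<Rightarrow> ('a \<Rightarrow> 'b \<Rightarrow> 'b) \<Rightarrow> ('b \<Rightarrow> 'b) topology" where
  "ellis_space G X \<phi> = subtopology (product_topology (\<lambda>_. X) (topspace X)) (ellis_set G X \<phi>)"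

definition ellis_action ::
  "('a, 'm) monoid_scheme \<Rightarrow> 'b topology \<Rightarrow> ('a \<Rightarrow> 'b \<Rightarrow> 'b) \<Rightarrow> 'a \<Rightarrow> ('b \<Rightarrow> 'b) \<Rightarrow> 'b \<Rightarrow> 'b" where
  "ellis_action G X \<phi> g = (\<lambda>f\<in>ellis_set G X \<phi>. compose (topspace X) (\<phi> g) f)"

definition G_semigroup ::
  "('a, 'm) monoid_scheme \<Rightarrow> 'b topology \<Rightarrow> ('a \<Rightarrow> 'b \<Rightarrow> 'b) \<Rightarrow> ('b \<Rightarrow> 'b \<Rightarrow> 'b) \<Rightarrow> bool" where
  "G_semigroup G X \<phi> m \<longleftrightarrow> G_flow G X \<phi> \<and>
     (\<forall>p\<in>topspace X. \<forall>q\<in>topspace X. m p q \<in> topspace X) \<and>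
     (\<forall>p\<in>topspace X. \<forall>q\<in>topspace X. \<forall>r\<in>topspace X. m (m p q) r = m p (m q r)) \<and>
     (\<forall>g\<in>carrier G. \<forall>p\<in>topspace X. \<forall>q\<in>topspace X. \<phi> g (m p q) = m (\<phi> g p) q)"

definition G_semigroup_isomorphic ::
  "('a, 'm) monoid_scheme \<Rightarrow> 'b topology \<Rightarrow> ('a \<Rightarrow> 'b \<Rightarrow> 'b) \<Rightarrow> ('b \<Rightarrow> 'b \<Rightarrow> 'b) \<Rightarrow>
     'c topology \<Rightarrow> ('a \<Rightarrow> 'c \<Rightarrow> 'c) \<Rightarrow> ('c \<Rightarrow> 'c \<Rightarrow> 'c) \<Rightarrow> bool" where
  "G_semigroup_isomorphic G X \<phi> m Y \<psi> n \<longleftrightarrow>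
     G_semigroup G X \<phi> m \<and> G_semigroup G Y \<psi> n \<and>
     (\<exists>h. homeomorphic_map X Y h \<and>
        (\<forall>g\<in>carrier G. \<forall>p\<in>topspace X. h (\<phi> g p) = \<psi> g (h p)) \<and>
        (\<forall>p\<in>topspace X. \<forall>q\<in>topspace X. h (m p q) = n (h p) (h q)))"

subsection \<open>Weak almost periodicity\<close>

text \<open>
  For a compact space \<open>X\<close>, \<open>cont_fun X\<close> is the Banach space \<open>C(X)\<close> of continuous
  complex functions, represented by functions that are extensional on \<open>topspace X\<close>.
\<close>
definition cont_fun :: "'b topology \<Rightarrow> ('b \<Rightarrow> complex) set" where
  "cont_fun X = {f \<in> extensional (topspace X). continuous_map X euclidean f}"

definition sup_norm :: "'b topology \<Rightarrow> ('b \<Rightarrow> complex) \<Rightarrow> real" where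
  "sup_norm X f = (SUP x\<in>topspace X. cmod (f x))"

definition dual_cont_fun :: "'b topology \<Rightarrow> (('b \<Rightarrow> complex) \<Rightarrow> complex) set" where
  "dual_cont_fun X = {L.
     (\<forall>f\<in>cont_fun X. \<forall>h\<in>cont_fun X. L (\<lambda>x\<in>topspace X. f x + h x) = L f + L h) \<and>
     (\<forall>c. \<forall>f\<in>cont_fun X. L (\<lambda>x\<in>topspace X. c * f x) = c * L f) \<and>
     (\<exists>K. \<forall>f\<in>cont_fun X. cmod (L f) \<le> K * sup_norm X f)}"

definition weak_topology :: "'b topology \<Rightarrow> ('b \<Rightarrow> complex) topology" where
  "weak_topology X = topology_generated_by
     {{f \<in> cont_fun X. L f \<in> U} | L U. L \<in> dual_cont_fun X \<and> open U}"

definition weakly_almost_periodic ::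
  "('a, 'm) monoid_scheme \<Rightarrow> 'b topology \<Rightarrow> ('a \<Rightarrow> 'b \<Rightarrow> 'b) \<Rightarrow> bool" where
  "weakly_almost_periodic G X \<phi> \<longleftrightarrow> G_flow G X \<phi> \<and>
     (\<forall>f\<in>cont_fun X. compactin (weak_topology X)
        (weak_topology X closure_of {\<lambda>x\<in>topspace X. f (\<phi> a x) | a. a \<in> carrier G}))"

subsection \<open>Profinite groups and invariant measures\<close>

definition topological_group :: "('b, 'm) monoid_scheme \<Rightarrow> 'b topology \<Rightarrow> bool" where
  "topological_group H X \<longleftrightarrow> group H \<and> topspace X = carrier H \<and>
     continuous_map (prod_topology X X) X (\<lambda>(x, y). x \<otimes>\<^bsub>H\<^esub> y) \<and>
     continuous_map X X (\<lambda>x. inv\<^bsub>H\<^esub> x)"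

definition totally_disconnected_space :: "'b topology \<Rightarrow> bool" where
  "totally_disconnected_space X \<longleftrightarrow> (\<forall>C. connectedin X C \<longrightarrow> (\<exists>x. C \<subseteq> {x}))"

definition profinite_group :: "('b, 'm) monoid_scheme \<Rightarrow> 'b topology \<Rightarrow> bool" where
  "profinite_group H X \<longleftrightarrow> topological_group H X \<and>
     compact_space X \<and> Hausdorff_space X \<and> totally_disconnected_space X"

text \<open>
  Measures are extensional on \<open>\<B>\<close>, so that two of them are equal as soon as they
  agree on \<open>\<B>\<close>.
\<close>
definition probability_measure_on ::
  "('a, 'm) monoid_scheme \<Rightarrow> 'a set set \<Rightarrow> ('a set \<Rightarrow> real) \<Rightarrow> bool" where
  "probability_measure_on G \<B> \<mu> \<longleftrightarrow>
     \<mu> \<in> \<B> \<rightarrow>\<^sub>E {0..1} \<and> Measure_Space.additive \<B> \<mu> \<and> \<mu> (carrier G) = 1"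

definition left_invariant_measure ::
  "('a, 'm) monoid_scheme \<Rightarrow> 'a set set \<Rightarrow> ('a set \<Rightarrow> real) \<Rightarrow> bool" where
  "left_invariant_measure G \<B> \<mu> \<longleftrightarrow>
     (\<forall>g\<in>carrier G. \<forall>A\<in>\<B>. \<mu> (g <#\<^bsub>G\<^esub> A) = \<mu> A)"

end

theory Submission
  imports Defs "HOL-Library.Ramsey"
begin

text \<open>
  For a stable set \<open>A\<close> the relation \<open>xy \<in> A\<close> contains no infinite ladder. Hence iterated limits of
  its truth value along a type in \<open>x\<close> and a type in \<open>y\<close> can be exchanged, and every limit \<open>dp(A)\<close> of
  right translates of \<open>A\<close> is a finite Boolean combination of such translates. Definability makes \<open>\<ast>\<close>
  well defined on \<open>S(\<B>\<^sup>\<sharp>)\<close>, with an action on \<open>S(\<B>)\<close> that identifies it with the Ellis semigroup,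
  and exchange makes the product separately continuous.

  On a minimal subflow only finitely many sets \<open>dp(A)\<close> occur: otherwise none of them is isolated, and
  a binary tree of types gives uncountably many traces on a countable set, whereas definability leaves
  only countably many. So limits of translates along minimal types have finite orbits. If two minimal
  subflows were disjoint, a separating set \<open>A\<close> would have a limit \<open>D\<close> with finite orbit all of whose
  translates lie in a type of one subflow and none in a type of the other, which is absurd. The same
  finiteness produces the identity of the group of generic types, its joint continuity, and an
  invariant measure by counting translates.

  If \<open>\<mu>\<close> is a positive finitely additive measure, then \<open>\<mu>(x\<^sup>-\<^sup>1A)\<close> converges along every ultrafilter
  to the measure of the corresponding limit set, since otherwise a ladder could be built inside sets of
  measure bounded below. This yields uniqueness of the invariant measure, and, applied to the
  variation of a functional on the continuous functions, that translating a function is weakly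
  continuous on the compact space \<open>S(\<B>\<^sup>\<sharp>)\<close>; the weak closure of an orbit lies in the image.
\<close>

section \<open>Ladders in binary relations\<close>

text \<open>Since \<B> is only left-invariant, the two sides behave differently. For a type
  \<open>q\<close> over \<B> the set \<open>type_d G q A\<close> is a combination of right
  translates of \<open>A\<close> and in general lies only in \<open>sharp G \<B>\<close>, whereas
  for a type \<open>r\<close> over the larger algebra \<open>type_e G r A\<close> is a combination
  of left translates and stays in \<B>. Hence the arguments run over a pair of algebras, types over
  the larger one acting on types over the smaller one, and exchange passes between the two
  descriptions of membership in a product. Limits of translates are taken along ultrafilters on the
  group. One ultrafilter serves all stable sets at once: its limit sets have finite left orbits, and
  it is used both for the uniqueness of the minimal subflow and for that of the measure. On a set
  with finite orbits an average over translates is a count that is the same at every point, and left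
  and right averages agree by double counting. The left average is independent of choices, the right
  one is visibly additive and left-invariant.\<close>

definition ladder :: "('x \<Rightarrow> 'y \<Rightarrow> bool) \<Rightarrow> 'x set \<Rightarrow> 'y set \<Rightarrow> bool" where
  "ladder R X Y \<longleftrightarrow> (\<exists>(a :: nat \<Rightarrow> 'x) (b :: nat \<Rightarrow> 'y). (\<forall>i. a i \<in> X \<and> b i \<in> Y) \<and>
     (\<forall>i j. (i < j \<longrightarrow> R (a i) (b j)) \<and> (j < i \<longrightarrow> \<not> R (a i) (b j))))"

text \<open>The diagonal of a ladder is left open because alternate choices fix no relation between
  the two points chosen at the same stage. Excluding the ladder of the negated relation too makes
  the notion invariant under negation and, since transposition turns a ladder of \<open>R\<close>
  into one of its negation, under exchange of the two sides.\<close>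

definition ladder_free :: "('x \<Rightarrow> 'y \<Rightarrow> bool) \<Rightarrow> 'x set \<Rightarrow> 'y set \<Rightarrow> bool" where
  "ladder_free R X Y \<longleftrightarrow> \<not> ladder R X Y \<and> \<not> ladder (\<lambda>x y. \<not> R x y) X Y"

lemma ladderI:
  fixes a :: "nat \<Rightarrow> 'x" and b :: "nat \<Rightarrow> 'y"
  assumes "\<And>i. a i \<in> X" "\<And>i. b i \<in> Y"
    and "\<And>i j. i < j \<Longrightarrow> R (a i) (b j)" "\<And>i j. j < i \<Longrightarrow> \<not> R (a i) (b j)"
  shows "ladder R X Y"
  unfolding ladder_def by (rule exI[of _ a], rule exI[of _ b]) (simp add: assms)

lemma ladderE:
  fixes R :: "'x \<Rightarrow> 'y \<Rightarrow> bool"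
  assumes "ladder R X Y"
  obtains a :: "nat \<Rightarrow> 'x" and b :: "nat \<Rightarrow> 'y" where "\<And>i. a i \<in> X" "\<And>i. b i \<in> Y"
    "\<And>i j. i < j \<Longrightarrow> R (a i) (b j)" "\<And>i j. j < i \<Longrightarrow> \<not> R (a i) (b j)"
  using assms unfolding ladder_def by (elim exE conjE) metis

lemma ladder_mono:
  assumes "ladder R X Y" "X \<subseteq> X'" "Y \<subseteq> Y'" shows "ladder R X' Y'"
  using assms(1)
proof (rule ladderE)
  fix a :: "nat \<Rightarrow> _" and b :: "nat \<Rightarrow> _" assume "\<And>i. a i \<in> X" "\<And>i. b i \<in> Y"
    "\<And>i j. i < j \<Longrightarrow> R (a i) (b j)" "\<And>i j. j < i \<Longrightarrow> \<not> R (a i) (b j)"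
  then show ?thesis using assms(2,3) by (intro ladderI[of a _ b]) auto
qed

lemma ladder_free_mono: "ladder_free R X' Y' \<Longrightarrow> X \<subseteq> X' \<Longrightarrow> Y \<subseteq> Y' \<Longrightarrow> ladder_free R X Y"
  unfolding ladder_free_def using ladder_mono[of R X Y X' Y'] ladder_mono[of "\<lambda>x y. \<not> R x y" X Y X' Y'] by blast

lemma ladder_free_not: "ladder_free R X Y \<Longrightarrow> ladder_free (\<lambda>x y. \<not> R x y) X Y"
  unfolding ladder_free_def by simp

lemma ladder_free_map:
  assumes "ladder_free R X Y" "\<And>x. x \<in> X' \<Longrightarrow> f x \<in> X" "\<And>y. y \<in> Y' \<Longrightarrow> g y \<in> Y"
    and "\<And>x y. x \<in> X' \<Longrightarrow> y \<in> Y' \<Longrightarrow> R' x y \<longleftrightarrow> R (f x) (g y)"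
  shows "ladder_free R' X' Y'"
proof -
  have "ladder S X Y" if S: "ladder S' X' Y'" "\<And>x y. x \<in> X' \<Longrightarrow> y \<in> Y' \<Longrightarrow> S' x y \<longleftrightarrow> S (f x) (g y)" for S S'
  proof -
    obtain a :: "nat \<Rightarrow> _" and b :: "nat \<Rightarrow> _" where ab: "\<And>i. a i \<in> X'" "\<And>i. b i \<in> Y'"
      "\<And>i j. i < j \<Longrightarrow> S' (a i) (b j)" "\<And>i j. j < i \<Longrightarrow> \<not> S' (a i) (b j)"
      using S(1) unfolding ladder_def by blast
    show ?thesis
      by (rule ladderI[of "f \<circ> a" _ "g \<circ> b"]) (use ab S(2) assms(2,3) in \<open>auto simp: image_subset_iff\<close>)
  qed
  from this[of R' R] this[of "\<lambda>x y. \<not> R' x y" "\<lambda>x y. \<not> R x y"] assms(1,4) show ?thesis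
    unfolding ladder_free_def by blast
qed

lemma ladder_converse:
  assumes "ladder R X Y" shows "ladder (\<lambda>y x. \<not> R x y) Y X"
proof -
  obtain a :: "nat \<Rightarrow> _" and b :: "nat \<Rightarrow> _" where ab: "\<And>i. a i \<in> X" "\<And>i. b i \<in> Y"
      "\<And>i j. i < j \<Longrightarrow> R (a i) (b j)" "\<And>i j. j < i \<Longrightarrow> \<not> R (a i) (b j)"
    using assms unfolding ladder_def by blast
  show ?thesis
    by (rule ladderI[of b _ a]) (use ab in auto)
qed

lemma ladder_free_converse: "ladder_free R X Y \<Longrightarrow> ladder_free (\<lambda>y x. R x y) Y X"
  unfolding ladder_free_def
  using ladder_converse[of "\<lambda>y x. R x y" Y X] ladder_converse[of "\<lambda>y x. \<not> R x y" Y X] by auto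

text \<open>Dependent choice in which a step sees only the finite set of earlier values. This
  suffices for ladders, where a new term is related to all earlier ones in the same way whatever
  their order; \<open>Inv\<close> keeps the set extendable.\<close>

lemma sequence_choice:
  assumes "Inv {}" and step: "\<And>F. finite F \<Longrightarrow> Inv F \<Longrightarrow> \<exists>x. P F x \<and> Inv (insert x F)"
  shows "\<exists>f :: nat \<Rightarrow> 'b. \<forall>n. P (f ` {..<n}) (f n)"
proof -
  define ch where "ch F = (SOME x. P F x \<and> Inv (insert x F))" for F
  define S where "S = rec_nat {} (\<lambda>_ F. insert (ch F) F)"
  have S0: "S 0 = {}" and S1: "S (Suc n) = insert (ch (S n)) (S n)" for n
    by (simp_all add: S_def)
  have inv: "finite (S n) \<and> Inv (S n)" for n
  proof (induction n)
    case 0 then show ?case using assms(1) by (simp add: S0)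
  next
    case (Suc n)
    then show ?case using someI_ex[OF step[of "S n"]] by (simp add: S1 ch_def)
  qed
  have "S n = (\<lambda>k. ch (S k)) ` {..<n}" for n
    by (induction n) (auto simp: S0 S1 lessThan_Suc)
  then have "P ((\<lambda>k. ch (S k)) ` {..<n}) (ch (S n))" for n
    using someI_ex[OF step[of "S n"]] inv[of n] unfolding ch_def by metis
  then show ?thesis by (intro exI[of _ "\<lambda>k. ch (S k)"]) simp
qed

lemma Ramsey_pairs:
  fixes Q :: "nat \<Rightarrow> nat \<Rightarrow> bool"
  shows "\<exists>f :: nat \<Rightarrow> nat. \<exists>c. strict_mono f \<and> (\<forall>i j. i < j \<longrightarrow> Q (f i) (f j) = c)"
proof -
  define c where "c S = (if Q (Min S) (Max S) then 1 else 0 :: nat)" for S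
  have "\<forall>x\<in>UNIV. \<forall>y\<in>UNIV. x \<noteq> y \<longrightarrow> c {x, y} < 2" by (simp add: c_def)
  from Ramsey2[OF infinite_UNIV_nat this]
  obtain Y t where Y: "infinite Y" "\<forall>x\<in>Y. \<forall>y\<in>Y. x \<noteq> y \<longrightarrow> c {x, y} = t"
    by (elim exE conjE)
  have "Q (enumerate Y i) (enumerate Y j) \<longleftrightarrow> t = 1" if "i < j" for i j
  proof -
    have "enumerate Y i < enumerate Y j" "enumerate Y i \<in> Y" "enumerate Y j \<in> Y"
      using Y(1) that by (auto simp: enumerate_mono enumerate_in_set)
    moreover from this have "c {enumerate Y i, enumerate Y j} = t"
      using Y(2)[rule_format, of "enumerate Y i" "enumerate Y j"] by simp
    ultimately show ?thesis by (auto simp: c_def split: if_splits)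
  qed
  moreover have "strict_mono (enumerate Y)" using Y(1) by (simp add: strict_mono_enumerate)
  ultimately show ?thesis by (intro exI[of _ "enumerate Y"] exI[of _ "t = 1"]) simp
qed

lemma infinite_bool_sequence:
  fixes Q :: "nat \<Rightarrow> bool"
  shows "\<exists>f :: nat \<Rightarrow> nat. \<exists>c. strict_mono f \<and> (\<forall>i. Q (f i) = c)"
proof -
  have "infinite {n. Q n} \<or> infinite {n. \<not> Q n}"
    using finite_UnI[of "{n. Q n}" "{n. \<not> Q n}"] infinite_UNIV_nat by (auto simp: Collect_disj_eq[symmetric])
  then have "infinite {n. Q n \<longleftrightarrow> True} \<or> infinite {n. Q n \<longleftrightarrow> False}" by simp
  then obtain c where c: "infinite {n. Q n \<longleftrightarrow> c}" by (elim disjE)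
  show ?thesis
    using enumerate_in_set[OF c] strict_mono_enumerate[OF c]
    by (intro exI[of _ "enumerate {n. Q n \<longleftrightarrow> c}"] exI[of _ c]) simp
qed

text \<open>The hypotheses express two opposite iterated limits. At each stage one takes an
  \<open>x\<close> that fails at all earlier \<open>y\<close>, and a \<open>y\<close> related to all
  earlier \<open>x\<close>.\<close>

lemma exchange_ladder:
  fixes R :: "'a \<Rightarrow> 'b \<Rightarrow> bool"
  assumes a: "\<And>F. finite F \<Longrightarrow> F \<subseteq> Y \<Longrightarrow> \<exists>x\<in>X. \<forall>y\<in>F. \<not> R x y"
    and b: "\<And>F. finite F \<Longrightarrow> F \<subseteq> X \<Longrightarrow> \<exists>y\<in>Y. \<forall>x\<in>F. R x y"
  shows "ladder R X Y"
proof -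
  have "\<exists>f :: nat \<Rightarrow> 'a \<times> 'b. \<forall>n. f n \<in> X \<times> Y \<and>
      (\<forall>z\<in>f ` {..<n}. \<not> R (fst (f n)) (snd z) \<and> R (fst z) (snd (f n)))"
  proof (rule sequence_choice[where Inv = "\<lambda>F. F \<subseteq> X \<times> Y"])
    fix F :: "('a \<times> 'b) set" assume F: "finite F" "F \<subseteq> X \<times> Y"
    have "finite (snd ` F)" "snd ` F \<subseteq> Y" "finite (fst ` F)" "fst ` F \<subseteq> X" using F by auto
    then obtain x y where x: "x \<in> X" "\<forall>y\<in>snd ` F. \<not> R x y" and y: "y \<in> Y" "\<forall>x'\<in>fst ` F. R x' y"
      using a[of "snd ` F"] b[of "fst ` F"] by blast
    show "\<exists>u. (u \<in> X \<times> Y \<and> (\<forall>z\<in>F. \<not> R (fst u) (snd z) \<and> R (fst z) (snd u))) \<and> insert u F \<subseteq> X \<times> Y"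
      by (rule exI[of _ "(x, y)"]) (use x y F in auto)
  qed simp
  then obtain f :: "nat \<Rightarrow> 'a \<times> 'b" where f0: "\<forall>n. f n \<in> X \<times> Y \<and>
      (\<forall>z\<in>f ` {..<n}. \<not> R (fst (f n)) (snd z) \<and> R (fst z) (snd (f n)))" ..
  then have f: "\<And>n. f n \<in> X \<times> Y"
    "\<And>m n. m < n \<Longrightarrow> \<not> R (fst (f n)) (snd (f m)) \<and> R (fst (f m)) (snd (f n))"
    by auto
  show ?thesis
    by (rule ladderI[of "fst \<circ> f" _ "snd \<circ> f"]) (use f in \<open>auto simp: mem_Times_iff\<close>)
qed

text \<open>
  If no finite set works, then repeatedly choosing a pair that \<open>D\<close> separates but the previous
  rows do not, and then a row that agrees with \<open>D\<close> on the points so far, gives two sequences of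
  points, one of which contains a ladder by Ramsey's theorem.
\<close>
lemma ladder_free_definable:
  fixes R :: "'a \<Rightarrow> 'b \<Rightarrow> bool"
  assumes st: "ladder_free R X Y"
    and cl: "\<And>F. finite F \<Longrightarrow> F \<subseteq> Y \<Longrightarrow> \<exists>x\<in>X. \<forall>y\<in>F. R x y \<longleftrightarrow> y \<in> D"
  shows "\<exists>F. finite F \<and> F \<subseteq> X \<and>
    (\<forall>y\<in>Y. \<forall>z\<in>Y. (\<forall>x\<in>F. R x y \<longleftrightarrow> R x z) \<longrightarrow> (y \<in> D \<longleftrightarrow> z \<in> D))"
proof (rule ccontr)
  assume neg: "\<not> ?thesis"
  have sep: "\<exists>y\<in>Y \<inter> D. \<exists>z\<in>Y - D. \<forall>x\<in>F. R x y \<longleftrightarrow> R x z" if F: "finite F" "F \<subseteq> X" for F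
  proof -
    obtain u v where uv: "u \<in> Y" "v \<in> Y" "\<forall>x\<in>F. R x u \<longleftrightarrow> R x v" "(u \<in> D) \<noteq> (v \<in> D)"
      using neg F by blast
    show ?thesis
    proof (cases "u \<in> D")
      case True
      then show ?thesis using uv by (intro bexI[of _ u] bexI[of _ v]) auto
    next
      case False
      then show ?thesis using uv by (intro bexI[of _ v] bexI[of _ u]) auto
    qed
  qed
  let ?W = "X \<times> (Y \<inter> D) \<times> (Y - D)"
  let ?x = "fst :: 'a \<times> 'b \<times> 'b \<Rightarrow> 'a" and ?y = "\<lambda>u :: 'a \<times> 'b \<times> 'b. fst (snd u)" and ?z = "\<lambda>u :: 'a \<times> 'b \<times> 'b. snd (snd u)"
  have "\<exists>f :: nat \<Rightarrow> 'a \<times> 'b \<times> 'b. \<forall>n. f n \<in> ?W \<and> R (?x (f n)) (?y (f n)) \<and> \<not> R (?x (f n)) (?z (f n)) \<and>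
      (\<forall>u\<in>f ` {..<n}. (R (?x u) (?y (f n)) \<longleftrightarrow> R (?x u) (?z (f n))) \<and> R (?x (f n)) (?y u) \<and> \<not> R (?x (f n)) (?z u))"
  proof (rule sequence_choice[where Inv = "\<lambda>F. F \<subseteq> ?W"])
    fix F :: "('a \<times> 'b \<times> 'b) set" assume F: "finite F" "F \<subseteq> ?W"
    have "\<exists>y\<in>Y \<inter> D. \<exists>z\<in>Y - D. \<forall>x\<in>?x ` F. R x y \<longleftrightarrow> R x z"
      by (rule sep) (use F in auto)
    then obtain y z where yz: "y \<in> Y \<inter> D" "z \<in> Y - D" "\<forall>x\<in>?x ` F. R x y \<longleftrightarrow> R x z" by blast
    \<comment> \<open>The new row follows \<open>D\<close> at the new pair as well, so it separates
      this pair although no earlier row does.\<close>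
    have "\<exists>x\<in>X. \<forall>w\<in>insert y (?y ` F) \<union> insert z (?z ` F). R x w \<longleftrightarrow> w \<in> D"
      by (rule cl) (use F yz in auto)
    then obtain x where x: "x \<in> X" "\<forall>w\<in>insert y (?y ` F) \<union> insert z (?z ` F). R x w \<longleftrightarrow> w \<in> D" by blast
    have "R x (?y u) \<and> \<not> R x (?z u)" if "u \<in> F" for u
    proof -
      have "u \<in> ?W" "?y u \<in> ?y ` F" "?z u \<in> ?z ` F" using F that by auto
      then show ?thesis using x(2) by auto
    qed
    then show "\<exists>v. (v \<in> ?W \<and> R (?x v) (?y v) \<and> \<not> R (?x v) (?z v) \<and>
      (\<forall>u\<in>F. (R (?x u) (?y v) \<longleftrightarrow> R (?x u) (?z v)) \<and> R (?x v) (?y u) \<and> \<not> R (?x v) (?z u))) \<and> insert v F \<subseteq> ?W"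
      by (intro exI[of _ "(x, y, z)"]) (use x yz F in auto)
  qed simp
  then obtain f :: "nat \<Rightarrow> 'a \<times> 'b \<times> 'b" where f0: "\<forall>n. f n \<in> ?W \<and> R (?x (f n)) (?y (f n)) \<and> \<not> R (?x (f n)) (?z (f n)) \<and>
      (\<forall>u\<in>f ` {..<n}. (R (?x u) (?y (f n)) \<longleftrightarrow> R (?x u) (?z (f n))) \<and> R (?x (f n)) (?y u) \<and> \<not> R (?x (f n)) (?z u))" ..
  then have f: "\<And>n. f n \<in> ?W" "\<And>n. R (?x (f n)) (?y (f n))" "\<And>n. \<not> R (?x (f n)) (?z (f n))"
    "\<And>m n. m < n \<Longrightarrow> (R (?x (f m)) (?y (f n)) \<longleftrightarrow> R (?x (f m)) (?z (f n))) \<and> R (?x (f n)) (?y (f m)) \<and> \<not> R (?x (f n)) (?z (f m))"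
    by auto
  from Ramsey_pairs[of "\<lambda>i j. R (?x (f i)) (?y (f j))"] obtain g :: "nat \<Rightarrow> nat" and c
    where g: "strict_mono g" "\<forall>i j. i < j \<longrightarrow> R (?x (f (g i))) (?y (f (g j))) = c"
    by (elim exE conjE)
  have W: "?x (f n) \<in> X" "?y (f n) \<in> Y" "?z (f n) \<in> Y" for n using f(1)[of n] by (auto simp: mem_Times_iff)
  have gm: "g i < g j" if "i < j" for i j using g(1) that by (simp add: strict_mono_less)
  \<comment> \<open>For \<open>i < j\<close> the row of index \<open>g i\<close> does not separate
    the pair of index \<open>g j\<close>, so the colour \<open>c\<close> is also its value at the
    \<open>z\<close> of that pair, while a later row follows \<open>D\<close> at earlier pairs. If
    \<open>c\<close> holds, the \<open>z\<close> therefore give a ladder; otherwise the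
    \<open>y\<close> give one for the negation.\<close>
  show False
  proof (cases c)
    case True
    have "ladder R X Y"
      by (rule ladderI[of "\<lambda>i. ?x (f (g i))" _ "\<lambda>i. ?z (f (g i))"]) (use W g(2) gm f(4) True in blast)+
    then show False using st by (simp add: ladder_free_def)
  next
    case False
    have "ladder (\<lambda>x y. \<not> R x y) X Y"
      by (rule ladderI[of "\<lambda>i. ?x (f (g i))" _ "\<lambda>i. ?y (f (g i))"]) (use W g(2) gm f(4) False in blast)+
    then show False using st by (simp add: ladder_free_def)
  qed
qed

text \<open>Below the diagonal at least one conjunct fails at each pair. Ramsey's theorem makes the
  value of \<open>R\<close> constant there: if it is true, \<open>S\<close> always fails and the
  subsequence is a ladder of \<open>S\<close>, otherwise one of \<open>R\<close>.\<close>

lemma ladder_conjD: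
  assumes "ladder (\<lambda>x y. R x y \<and> S x y) X Y" shows "ladder R X Y \<or> ladder S X Y"
proof -
  obtain a :: "nat \<Rightarrow> _" and b :: "nat \<Rightarrow> _" where ab: "\<And>i. a i \<in> X" "\<And>i. b i \<in> Y"
      "\<And>i j. i < j \<Longrightarrow> R (a i) (b j) \<and> S (a i) (b j)" "\<And>i j. j < i \<Longrightarrow> \<not> (R (a i) (b j) \<and> S (a i) (b j))"
    using assms unfolding ladder_def by blast
  from Ramsey_pairs[of "\<lambda>i j. R (a j) (b i)"] obtain g :: "nat \<Rightarrow> nat" and c
    where g: "strict_mono g" "\<forall>i j. i < j \<longrightarrow> R (a (g j)) (b (g i)) = c"
    by (elim exE conjE)
  have gm: "g i < g j" if "i < j" for i j using g(1) that by (simp add: strict_mono_less)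
  have "ladder (if c then S else R) X Y"
    by (rule ladderI[of "\<lambda>i. a (g i)" _ "\<lambda>i. b (g i)"]) (use ab g(2) gm in \<open>auto split: if_splits\<close>)
  then show ?thesis by (auto split: if_splits)
qed

text \<open>Transposition exchanges a ladder of the negated conjunction with one of the
  conjunction.\<close>

lemma ladder_not_conjD:
  assumes "ladder (\<lambda>x y. \<not> (R x y \<and> S x y)) X Y" shows "ladder (\<lambda>x y. \<not> R x y) X Y \<or> ladder (\<lambda>x y. \<not> S x y) X Y"
proof -
  have "ladder (\<lambda>y x. R x y \<and> S x y) Y X" using ladder_converse[OF assms] by simp
  then have "ladder (\<lambda>y x. R x y) Y X \<or> ladder (\<lambda>y x. S x y) Y X" by (rule ladder_conjD)
  then show ?thesis using ladder_converse by blast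
qed

lemma ladder_free_conj: "ladder_free R X Y \<Longrightarrow> ladder_free S X Y \<Longrightarrow> ladder_free (\<lambda>x y. R x y \<and> S x y) X Y"
  unfolding ladder_free_def using ladder_conjD[of R S] ladder_not_conjD[of R S] by blast

section \<open>Stable sets\<close>

text \<open>
  A ladder for the multiplication table of a set yields an order of type \<open>\<omega>\<close> or its reverse as in
  \<^const>\<open>stable_in\<close>, so every stable set has the property below; unlike \<^const>\<open>stable_in\<close>
  it passes to Boolean combinations by a direct application of Ramsey's theorem.
\<close>
definition wstable :: "('a, 'm) monoid_scheme \<Rightarrow> 'a set \<Rightarrow> bool" where
  "wstable G A \<longleftrightarrow> A \<subseteq> carrier G \<and> ladder_free (\<lambda>x y. x \<otimes>\<^bsub>G\<^esub> y \<in> A) (carrier G) (carrier G)"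

lemma stable_in_imp_wstable:
  assumes "stable_in G A" shows "wstable G A"
proof -
  have A: "A \<subseteq> carrier G" using assms by (simp add: stable_in_def)
  have "\<not> ladder (\<lambda>x y. x \<otimes>\<^bsub>G\<^esub> y \<in> A) (carrier G) (carrier G)"
  proof
    assume "ladder (\<lambda>x y. x \<otimes>\<^bsub>G\<^esub> y \<in> A) (carrier G) (carrier G)"
    then obtain a :: "nat \<Rightarrow> _" and b :: "nat \<Rightarrow> _" where ab: "\<And>i. a i \<in> carrier G" "\<And>i. b i \<in> carrier G"
      "\<And>i j. i < j \<Longrightarrow> a i \<otimes>\<^bsub>G\<^esub> b j \<in> A" "\<And>i j. j < i \<Longrightarrow> a i \<otimes>\<^bsub>G\<^esub> b j \<notin> A"
      unfolding ladder_def by blast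
    let ?r = "{(i, j :: nat). i \<le> j}"
    \<comment> \<open>Even indices for \<open>a\<close> and odd ones for \<open>b\<close> avoid the
      diagonal of the ladder, and \<open>2 * i < 2 * j + 1\<close> says exactly
      \<open>i \<le> j\<close>. In the second half the parities are exchanged, which gives the
      reverse order.\<close>
    have "\<not> (\<forall>i\<in>UNIV. \<forall>j\<in>UNIV. a (2 * i) \<otimes>\<^bsub>G\<^esub> b (2 * j + 1) \<in> A \<longleftrightarrow> (i, j) \<in> ?r)"
      by (rule stable_in_no_order[OF assms, of UNIV ?r "\<lambda>i. a (2 * i)" "\<lambda>i. b (2 * i + 1)"])
        (use ab in \<open>auto simp: order_on_defs refl_on_def trans_def antisym_def total_on_def\<close>)
    then obtain i j where ij: "(a (2 * i) \<otimes>\<^bsub>G\<^esub> b (2 * j + 1) \<in> A) \<noteq> (i \<le> j)" by auto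
    show False
    proof (cases "i \<le> j")
      case True then show False using ij ab(3)[of "2 * i" "2 * j + 1"] by simp
    next
      case False then show False using ij ab(4)[of "2 * j + 1" "2 * i"] by simp
    qed
  qed
  moreover have "\<not> ladder (\<lambda>x y. x \<otimes>\<^bsub>G\<^esub> y \<notin> A) (carrier G) (carrier G)"
  proof
    assume "ladder (\<lambda>x y. x \<otimes>\<^bsub>G\<^esub> y \<notin> A) (carrier G) (carrier G)"
    then obtain a :: "nat \<Rightarrow> _" and b :: "nat \<Rightarrow> _" where ab: "\<And>i. a i \<in> carrier G" "\<And>i. b i \<in> carrier G"
      "\<And>i j. i < j \<Longrightarrow> a i \<otimes>\<^bsub>G\<^esub> b j \<notin> A" "\<And>i j. j < i \<Longrightarrow> a i \<otimes>\<^bsub>G\<^esub> b j \<in> A"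
      unfolding ladder_def by blast
    let ?r = "{(i, j :: nat). j \<le> i}"
    have "\<not> (\<forall>i\<in>UNIV. \<forall>j\<in>UNIV. a (2 * i + 1) \<otimes>\<^bsub>G\<^esub> b (2 * j) \<in> A \<longleftrightarrow> (i, j) \<in> ?r)"
      by (rule stable_in_no_order[OF assms, of UNIV ?r "\<lambda>i. a (2 * i + 1)" "\<lambda>i. b (2 * i)"])
        (use ab in \<open>auto simp: order_on_defs refl_on_def trans_def antisym_def total_on_def\<close>)
    then obtain i j where ij: "(a (2 * i + 1) \<otimes>\<^bsub>G\<^esub> b (2 * j) \<in> A) \<noteq> (j \<le> i)" by auto
    show False
    proof (cases "j \<le> i")
      case True then show False using ij ab(4)[of "2 * j" "2 * i + 1"] by simp
    next
      case False then show False using ij ab(3)[of "2 * i + 1" "2 * j"] by simp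
    qed
  qed
  ultimately show ?thesis using A by (simp add: wstable_def ladder_free_def)
qed

context group
begin

lemma mem_l_coset_iff:
  assumes "g \<in> carrier G" "A \<subseteq> carrier G"
  shows "x \<in> g <# A \<longleftrightarrow> x \<in> carrier G \<and> inv g \<otimes> x \<in> A"
  using assms unfolding l_coset_def
  by (auto simp: m_assoc[symmetric] subset_iff) (metis inv_closed inv_solve_left m_closed)

lemma mem_r_coset_iff:
  assumes "g \<in> carrier G" "A \<subseteq> carrier G"
  shows "x \<in> A #> g \<longleftrightarrow> x \<in> carrier G \<and> x \<otimes> inv g \<in> A"
  using assms unfolding r_coset_def
  by (auto simp: m_assoc subset_iff) (metis inv_closed inv_solve_right m_closed)

lemma wstable_subset: "wstable G A \<Longrightarrow> A \<subseteq> carrier G"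
  by (simp add: wstable_def)

lemma wstable_compl: "wstable G A \<Longrightarrow> wstable G (carrier G - A)"
  unfolding wstable_def
  using ladder_free_map[OF ladder_free_not, of "\<lambda>x y. x \<otimes> y \<in> A" "carrier G" "carrier G" "carrier G" "\<lambda>x. x"
    "carrier G" "\<lambda>x. x" "\<lambda>x y. x \<otimes> y \<in> carrier G - A"] by simp

lemma wstable_inter: "wstable G A \<Longrightarrow> wstable G B \<Longrightarrow> wstable G (A \<inter> B)"
  unfolding wstable_def
  using ladder_free_conj[of "\<lambda>x y. x \<otimes> y \<in> A" "carrier G" "carrier G" "\<lambda>x y. x \<otimes> y \<in> B"] by auto

lemma wstable_l_coset:
  assumes "wstable G A" "g \<in> carrier G" shows "wstable G (g <# A)"
  unfolding wstable_def
proof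
  show "g <# A \<subseteq> carrier G" using assms by (simp add: l_coset_subset_G wstable_def)
  show "ladder_free (\<lambda>x y. x \<otimes> y \<in> g <# A) (carrier G) (carrier G)"
    by (rule ladder_free_map[of "\<lambda>x y. x \<otimes> y \<in> A" "carrier G" "carrier G" _ "\<lambda>x. inv g \<otimes> x" _ "\<lambda>y. y"])
      (use assms in \<open>auto simp: wstable_def mem_l_coset_iff m_assoc\<close>)
qed

lemma wstable_r_coset:
  assumes "wstable G A" "g \<in> carrier G" shows "wstable G (A #> g)"
  unfolding wstable_def
proof
  show "A #> g \<subseteq> carrier G" using assms by (simp add: r_coset_subset_G wstable_def)
  show "ladder_free (\<lambda>x y. x \<otimes> y \<in> A #> g) (carrier G) (carrier G)"
    by (rule ladder_free_map[of "\<lambda>x y. x \<otimes> y \<in> A" "carrier G" "carrier G" _ "\<lambda>x. x" _ "\<lambda>y. y \<otimes> inv g"])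
      (use assms in \<open>auto simp: wstable_def mem_r_coset_iff m_assoc\<close>)
qed

text \<open>Inversion reverses products, so the multiplication table of the image is the transposed
  table of \<open>A\<close>.\<close>

lemma wstable_m_inv_image:
  assumes "wstable G A" shows "wstable G (m_inv G ` A)"
  unfolding wstable_def
proof
  show "m_inv G ` A \<subseteq> carrier G" using assms by (auto simp: wstable_def)
  have iff: "x \<in> m_inv G ` A \<longleftrightarrow> inv x \<in> A" if "x \<in> carrier G" for x
    using that assms by (auto simp: wstable_def image_iff) (metis inv_inv)
  have "ladder_free (\<lambda>y x. x \<otimes> y \<in> A) (carrier G) (carrier G)"
    using assms ladder_free_converse[of "\<lambda>x y. x \<otimes> y \<in> A" "carrier G" "carrier G"] by (simp add: wstable_def)
  then show "ladder_free (\<lambda>x y. x \<otimes> y \<in> m_inv G ` A) (carrier G) (carrier G)"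
    by (rule ladder_free_map[of _ _ _ _ "m_inv G" _ "m_inv G"]) (use iff inv_mult_group in \<open>auto simp: inv_mult_group\<close>)
qed

lemma wstable_carrier: "wstable G (carrier G)"
proof -
  have "\<not> ladder (\<lambda>x y. x \<otimes> y \<in> carrier G) (carrier G) (carrier G)"
  proof
    assume "ladder (\<lambda>x y. x \<otimes> y \<in> carrier G) (carrier G) (carrier G)"
    then obtain a :: "nat \<Rightarrow> _" and b :: "nat \<Rightarrow> _" where ab: "\<And>i. a i \<in> carrier G" "\<And>i. b i \<in> carrier G"
      "\<And>i j. i < j \<Longrightarrow> a i \<otimes> b j \<in> carrier G" "\<And>i j. j < i \<Longrightarrow> a i \<otimes> b j \<notin> carrier G"
      unfolding ladder_def by blast
    show False using ab(4)[of 0 1] ab(1,2) by simp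
  qed
  moreover have "\<not> ladder (\<lambda>x y. x \<otimes> y \<notin> carrier G) (carrier G) (carrier G)"
  proof
    assume "ladder (\<lambda>x y. x \<otimes> y \<notin> carrier G) (carrier G) (carrier G)"
    then obtain a :: "nat \<Rightarrow> _" and b :: "nat \<Rightarrow> _" where ab: "\<And>i. a i \<in> carrier G" "\<And>i. b i \<in> carrier G"
      "\<And>i j. i < j \<Longrightarrow> a i \<otimes> b j \<notin> carrier G" "\<And>i j. j < i \<Longrightarrow> a i \<otimes> b j \<in> carrier G"
      unfolding ladder_def by blast
    show False using ab(3)[of 0 1] ab(1,2) by simp
  qed
  ultimately show ?thesis by (simp add: wstable_def ladder_free_def)
qed

end

section \<open>Types over an invariant Boolean algebra\<close>

context group
begin

lemma l_coset_Int:
  "g \<in> carrier G \<Longrightarrow> A \<subseteq> carrier G \<Longrightarrow> B \<subseteq> carrier G \<Longrightarrow> g <# (A \<inter> B) = (g <# A) \<inter> (g <# B)"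
  by (auto simp: mem_l_coset_iff subset_iff)

lemma l_coset_compl:
  "g \<in> carrier G \<Longrightarrow> A \<subseteq> carrier G \<Longrightarrow> g <# (carrier G - A) = carrier G - (g <# A)"
  by (auto simp: mem_l_coset_iff subset_iff)

lemma r_coset_Int:
  "g \<in> carrier G \<Longrightarrow> A \<subseteq> carrier G \<Longrightarrow> B \<subseteq> carrier G \<Longrightarrow> (A \<inter> B) #> g = (A #> g) \<inter> (B #> g)"
  by (auto simp: mem_r_coset_iff subset_iff)

lemma r_coset_compl:
  "g \<in> carrier G \<Longrightarrow> A \<subseteq> carrier G \<Longrightarrow> (carrier G - A) #> g = carrier G - (A #> g)"
  by (auto simp: mem_r_coset_iff subset_iff)

lemma l_coset_inv: "g \<in> carrier G \<Longrightarrow> A \<subseteq> carrier G \<Longrightarrow> g <# (inv g <# A) = A"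
  by (simp add: lcos_m_assoc lcos_mult_one)

lemma l_coset_inv': "g \<in> carrier G \<Longrightarrow> A \<subseteq> carrier G \<Longrightarrow> inv g <# (g <# A) = A"
  by (simp add: lcos_m_assoc lcos_mult_one)

end

locale invariant_algebra = group G + Sigma_Algebra.algebra "carrier G" \<B>
  for G (structure) and \<B> +
  assumes left_inv: "left_invariant G \<B>"
begin

lemma l_coset_in: "g \<in> carrier G \<Longrightarrow> A \<in> \<B> \<Longrightarrow> g <# A \<in> \<B>"
  using left_inv by (simp add: left_invariant_def)

lemma in_carrier: "A \<in> \<B> \<Longrightarrow> A \<subseteq> carrier G"
  using sets_into_space .

lemma carrier_in: "carrier G \<in> \<B>"
  using top .

lemma types_subset: "p \<in> types G \<B> \<Longrightarrow> A \<in> p \<Longrightarrow> A \<in> \<B>"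
  by (auto simp: types_def)

lemma types_not_empty: "p \<in> types G \<B> \<Longrightarrow> {} \<notin> p"
  by (simp add: types_def)

lemma types_compl: "p \<in> types G \<B> \<Longrightarrow> A \<in> \<B> \<Longrightarrow> carrier G - A \<in> p \<longleftrightarrow> A \<notin> p"
proof
  assume p: "p \<in> types G \<B>" "A \<in> \<B>" "carrier G - A \<in> p"
  show "A \<notin> p"
  proof
    assume "A \<in> p"
    then have "A \<inter> (carrier G - A) \<in> p" using p unfolding types_def by blast
    then show False using types_not_empty[OF p(1)] by (simp add: Int_Diff)
  qed
qed (auto simp: types_def)

lemma types_mono:
  assumes "p \<in> types G \<B>" "A \<in> p" "B \<in> \<B>" "A \<subseteq> B" shows "B \<in> p"
proof (rule ccontr)
  assume "B \<notin> p"
  then have "carrier G - B \<in> p" using assms by (simp add: types_compl)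
  then have "A \<inter> (carrier G - B) \<in> p" using assms unfolding types_def by blast
  then show False using types_not_empty[OF assms(1)] assms(4) by (metis Diff_disjoint disjoint_iff subsetD)
qed

lemma types_Int:
  assumes "p \<in> types G \<B>" "A \<in> \<B>" "B \<in> \<B>" shows "A \<inter> B \<in> p \<longleftrightarrow> A \<in> p \<and> B \<in> p"
proof
  assume "A \<inter> B \<in> p" then show "A \<in> p \<and> B \<in> p"
    using types_mono[OF assms(1)] assms by blast
next
  assume "A \<in> p \<and> B \<in> p" then show "A \<inter> B \<in> p" using assms(1) unfolding types_def by blast
qed

lemma types_carrier: "p \<in> types G \<B> \<Longrightarrow> carrier G \<in> p"
  using types_compl[of p "{}"] types_not_empty by simp

lemma types_Inter:
  "finite F \<Longrightarrow> p \<in> types G \<B> \<Longrightarrow> F \<subseteq> p \<Longrightarrow> carrier G \<inter> \<Inter>F \<in> p"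
proof (induction F rule: finite_induct)
  case empty then show ?case by (simp add: types_carrier)
next
  case (insert A F)
  then have "A \<inter> (carrier G \<inter> \<Inter>F) \<in> p" by (auto simp: types_def)
  moreover have "A \<inter> (carrier G \<inter> \<Inter>F) = carrier G \<inter> \<Inter>(insert A F)" by auto
  ultimately show ?case by simp
qed

text \<open>A finite part of a type amounts to a finite intersection of sets and complements that
  belongs to the type and so is nonempty. Finite statements about types are checked at such a group
  element, and this is how rows and columns of the multiplication table approximate
  \<open>type_e\<close> and \<open>type_d\<close>.\<close>

lemma types_realize:
  assumes "p \<in> types G \<B>" "finite F" "F \<subseteq> \<B>"
  shows "\<exists>g\<in>carrier G. \<forall>A\<in>F. g \<in> A \<longleftrightarrow> A \<in> p"
proof -
  define F' where "F' = (\<lambda>A. if A \<in> p then A else carrier G - A) ` F"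
  have "F' \<subseteq> p" using assms by (auto simp: F'_def types_compl subset_iff)
  then have "carrier G \<inter> \<Inter>F' \<in> p" using types_Inter[of F' p] assms by (simp add: F'_def)
  then have "carrier G \<inter> \<Inter>F' \<noteq> {}" using types_not_empty[OF assms(1)] by metis
  then obtain g where g0: "g \<in> carrier G" "\<forall>A\<in>F'. g \<in> A" by blast
  then have g: "g \<in> carrier G" "\<And>A. A \<in> F \<Longrightarrow> g \<in> (if A \<in> p then A else carrier G - A)"
    unfolding F'_def by blast+
  show ?thesis
  proof (intro bexI[of _ g] ballI)
    show "g \<in> A \<longleftrightarrow> A \<in> p" if "A \<in> F" for A using g(2)[OF that] by (auto split: if_splits)
  qed (rule g(1))
qed

lemma types_eqI:
  assumes "p \<in> types G \<B>" "q \<in> types G \<B>" "\<And>A. A \<in> p \<Longrightarrow> A \<in> q" shows "p = q"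
proof -
  have "A \<in> p" if "A \<in> q" for A
  proof (rule ccontr)
    assume "A \<notin> p"
    then have "carrier G - A \<in> q" using assms that types_compl[OF assms(1)] types_subset by blast
    then show False using types_compl[OF assms(2)] types_subset[OF assms(2)] that by blast
  qed
  then show ?thesis using assms(3) by blast
qed

lemma types_point: "g \<in> carrier G \<Longrightarrow> {A \<in> \<B>. g \<in> A} \<in> types G \<B>"
  by (auto simp: types_def)

lemma typesI:
  assumes "p \<subseteq> \<B>" "\<And>A. A \<in> \<B> \<Longrightarrow> carrier G - A \<in> p \<longleftrightarrow> A \<notin> p" "carrier G \<in> p"
    and "\<And>A B. A \<in> p \<Longrightarrow> B \<in> p \<Longrightarrow> A \<inter> B \<in> p"
  shows "p \<in> types G \<B>"
proof -
  have "{} \<notin> p" using assms(2)[of "{}"] assms(3) by simp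
  then show ?thesis unfolding types_def using assms(1,2,4) by blast
qed

text \<open>The ultrafilter lemma: Zorn's lemma gives a maximal family whose finite parts have a
  common point, and such a family decides every set.\<close>

lemma types_extend:
  assumes sub: "\<F> \<subseteq> \<B>"
    and fip: "\<And>F. finite F \<Longrightarrow> F \<subseteq> \<F> \<Longrightarrow> \<exists>g\<in>carrier G. \<forall>A\<in>F. g \<in> A"
  shows "\<exists>p\<in>types G \<B>. \<F> \<subseteq> p"
proof -
  define \<A> where "\<A> = {H. \<F> \<subseteq> H \<and> H \<subseteq> \<B> \<and> (\<forall>F. finite F \<longrightarrow> F \<subseteq> H \<longrightarrow> (\<exists>g\<in>carrier G. \<forall>A\<in>F. g \<in> A))}"
  have "\<exists>M\<in>\<A>. \<forall>X\<in>\<A>. M \<subseteq> X \<longrightarrow> X = M"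
  proof (rule subset_Zorn_nonempty)
    show "\<A> \<noteq> {}" using sub fip by (auto simp: \<A>_def)
    fix \<C> assume C: "\<C> \<noteq> {}" "subset.chain \<A> \<C>"
    have "\<exists>g\<in>carrier G. \<forall>A\<in>F. g \<in> A" if F: "finite F" "F \<subseteq> \<Union>\<C>" for F
    proof -
      obtain H where "H \<in> \<C>" "F \<subseteq> H" using finite_subset_Union_chain[OF F C] by blast
      then show ?thesis using F C by (auto simp: \<A>_def subset.chain_def)
    qed
    moreover have "\<F> \<subseteq> H" "H \<subseteq> \<B>" if "H \<in> \<C>" for H using C that by (auto simp: \<A>_def subset.chain_def)
    then have "\<F> \<subseteq> \<Union>\<C>" "\<Union>\<C> \<subseteq> \<B>" using C(1) by blast+
    ultimately show "\<Union>\<C> \<in> \<A>" by (simp add: \<A>_def)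
  qed
  then obtain p where p: "p \<in> \<A>" "\<And>X. X \<in> \<A> \<Longrightarrow> p \<subseteq> X \<Longrightarrow> X = p" by blast
  have pB: "\<F> \<subseteq> p" "p \<subseteq> \<B>" using p by (auto simp: \<A>_def)
  have pf: "\<exists>g\<in>carrier G. \<forall>A\<in>F. g \<in> A" if "finite F" "F \<subseteq> p" for F using p that by (auto simp: \<A>_def)
  have ext: "A \<in> p" if A: "A \<in> \<B>" "\<And>F. finite F \<Longrightarrow> F \<subseteq> p \<Longrightarrow> \<exists>g\<in>carrier G. g \<in> A \<and> (\<forall>A\<in>F. g \<in> A)" for A
  proof -
    have "\<exists>g\<in>carrier G. \<forall>B\<in>F. g \<in> B" if "finite F" "F \<subseteq> insert A p" for F
    proof -
      have "finite (F - {A})" "F - {A} \<subseteq> p" using that by auto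
      then obtain g where "g \<in> carrier G" "g \<in> A" "\<forall>B\<in>F - {A}. g \<in> B" using A(2) by blast
      then show ?thesis by blast
    qed
    then have "insert A p \<in> \<A>" using pB A(1) unfolding \<A>_def by (intro CollectI conjI allI impI) auto
    then have "insert A p = p" using p(2) by (meson subset_insertI)
    then show ?thesis by blast
  qed
  \<comment> \<open>If neither \<open>A\<close> nor its complement could be adjoined, a finite part
    \<open>F\<close> would have no common point in \<open>A\<close> and a finite part
    \<open>F'\<close> none outside \<open>A\<close>, so \<open>F \<union> F'\<close> would have none
    at all.\<close>
  have dich: "A \<in> p \<or> carrier G - A \<in> p" if A: "A \<in> \<B>" for A
  proof (rule ccontr)
    assume neg: "\<not> ?thesis"
    have "\<not> (\<forall>F. finite F \<longrightarrow> F \<subseteq> p \<longrightarrow> (\<exists>g\<in>carrier G. g \<in> A \<and> (\<forall>A\<in>F. g \<in> A)))"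
      using ext[OF A] neg by meson
    then obtain F where F: "finite F" "F \<subseteq> p" "\<And>g. g \<in> carrier G \<Longrightarrow> g \<in> A \<Longrightarrow> \<not> (\<forall>A\<in>F. g \<in> A)"
      by meson
    have "carrier G - A \<in> \<B>" using A by (rule compl_sets)
    then have "\<not> (\<forall>F. finite F \<longrightarrow> F \<subseteq> p \<longrightarrow> (\<exists>g\<in>carrier G. g \<in> carrier G - A \<and> (\<forall>A\<in>F. g \<in> A)))"
      using ext[of "carrier G - A"] neg by meson
    then obtain F' where F': "finite F'" "F' \<subseteq> p" "\<And>g. g \<in> carrier G \<Longrightarrow> g \<notin> A \<Longrightarrow> \<not> (\<forall>A\<in>F'. g \<in> A)"
      by (meson DiffI)
    obtain g where "g \<in> carrier G" "\<forall>A\<in>F \<union> F'. g \<in> A" using pf[of "F \<union> F'"] F F' by auto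
    then show False using F(3)[of g] F'(3)[of g] by blast
  qed
  have "p \<in> types G \<B>"
    unfolding types_def
  proof (intro CollectI conjI ballI)
    show "{} \<notin> p" using pf[of "{{}}"] by auto
    fix A B assume AB: "A \<in> p" "B \<in> p"
    show "A \<inter> B \<in> p"
    proof (rule ext)
      fix F assume "finite F" "F \<subseteq> p"
      then show "\<exists>g\<in>carrier G. g \<in> A \<inter> B \<and> (\<forall>A\<in>F. g \<in> A)"
        using pf[of "insert A (insert B F)"] AB by auto
    qed (use AB pB in auto)
  qed (use dich pB in auto)
  then show ?thesis using pB by blast
qed

subsection \<open>The space of types\<close>

lemma topspace_types [simp]: "topspace (type_space G \<B>) = types G \<B>"
  by (rule topspace_type_space) unfold_locales

lemma openin_basic: "A \<in> \<B> \<Longrightarrow> openin (type_space G \<B>) {p \<in> types G \<B>. A \<in> p}"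
  unfolding type_space_def by (rule topology_generated_by_Basis) auto

lemma closedin_basic:
  assumes "A \<in> \<B>" shows "closedin (type_space G \<B>) {p \<in> types G \<B>. A \<in> p}"
proof -
  have "types G \<B> - {p \<in> types G \<B>. A \<in> p} = {p \<in> types G \<B>. carrier G - A \<in> p}"
    using assms by (auto simp: types_compl)
  then show ?thesis using openin_basic[of "carrier G - A"] assms by (auto simp: closedin_def)
qed

text \<open>The generating sets form a base, because the types containing \<open>A\<close> and
  \<open>B\<close> are those containing \<open>A \<inter> B\<close>.\<close>

lemma openin_types_iff:
  "openin (type_space G \<B>) V \<longleftrightarrow>
    V \<subseteq> types G \<B> \<and> (\<forall>p\<in>V. \<exists>A\<in>p. {q \<in> types G \<B>. A \<in> q} \<subseteq> V)"
proof
  assume V: "openin (type_space G \<B>) V"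
  then have "generate_topology_on {{p \<in> types G \<B>. A \<in> p} | A. A \<in> \<B>} V"
    unfolding type_space_def by (rule openin_topology_generated_by)
  then have "\<forall>p\<in>V. \<exists>A\<in>p. {q \<in> types G \<B>. A \<in> q} \<subseteq> V"
  proof induction
    case (Int a b)
    show ?case
    proof
      fix p assume p: "p \<in> a \<inter> b"
      have "openin (type_space G \<B>) a"
        unfolding type_space_def openin_topology_generated_by_iff by (rule Int.hyps)
      then have "a \<subseteq> types G \<B>" using openin_subset by force
      then have pt: "p \<in> types G \<B>" using p by blast
      obtain A B where AB: "A \<in> p" "B \<in> p" "{q \<in> types G \<B>. A \<in> q} \<subseteq> a" "{q \<in> types G \<B>. B \<in> q} \<subseteq> b"
        using Int.IH p by blast
      then have "A \<in> \<B>" "B \<in> \<B>" using pt types_subset by blast+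
      then show "\<exists>A\<in>p. {q \<in> types G \<B>. A \<in> q} \<subseteq> a \<inter> b"
        using AB pt by (intro bexI[of _ "A \<inter> B"]) (auto simp: types_Int)
    qed
  next
    case (UN K)
    show ?case
    proof
      fix p assume "p \<in> \<Union>K"
      then obtain k where k: "k \<in> K" "p \<in> k" by (elim UnionE)
      then obtain A where "A \<in> p" "{q \<in> types G \<B>. A \<in> q} \<subseteq> k" using UN.IH by meson
      then show "\<exists>A\<in>p. {q \<in> types G \<B>. A \<in> q} \<subseteq> \<Union>K" using k(1) by (intro bexI[of _ A]) auto
    qed
  next
    case (Basis s)
    then obtain A where "s = {p \<in> types G \<B>. A \<in> p}" by (elim CollectE exE conjE)
    then show ?case by (intro ballI bexI[of _ A]) auto
  qed simp
  then show "V \<subseteq> types G \<B> \<and> (\<forall>p\<in>V. \<exists>A\<in>p. {q \<in> types G \<B>. A \<in> q} \<subseteq> V)"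
    using openin_subset[OF V] by simp
next
  assume V: "V \<subseteq> types G \<B> \<and> (\<forall>p\<in>V. \<exists>A\<in>p. {q \<in> types G \<B>. A \<in> q} \<subseteq> V)"
  show "openin (type_space G \<B>) V"
  proof (subst openin_subopen, intro ballI)
    fix p assume p: "p \<in> V"
    then obtain A where A: "A \<in> p" "{q \<in> types G \<B>. A \<in> q} \<subseteq> V" using V by blast
    then have "A \<in> \<B>" using V p types_subset by blast
    then show "\<exists>T. openin (type_space G \<B>) T \<and> p \<in> T \<and> T \<subseteq> V"
      using openin_basic[of A] A V p by (intro exI[of _ "{q \<in> types G \<B>. A \<in> q}"]) auto
  qed
qed

lemma closedin_types_separate:
  assumes "closedin (type_space G \<B>) C" "p \<in> types G \<B>" "p \<notin> C"
  obtains A where "A \<in> p" "A \<in> \<B>" "\<And>q. q \<in> C \<Longrightarrow> A \<notin> q"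
proof -
  have "openin (type_space G \<B>) (types G \<B> - C)" using assms by (auto simp: closedin_def)
  then obtain A where "A \<in> p" "{q \<in> types G \<B>. A \<in> q} \<subseteq> types G \<B> - C"
    using assms by (auto simp: openin_types_iff)
  moreover have "C \<subseteq> types G \<B>" using closedin_subset[OF assms(1)] by simp
  ultimately show ?thesis using that[of A] types_subset[OF assms(2)] by blast
qed

lemma compact_types: "compact_space (type_space G \<B>)"
  unfolding compact_space_fip
proof (intro allI impI, elim conjE)
  fix \<U> assume cl: "\<forall>C\<in>\<U>. closedin (type_space G \<B>) C"
    and fip: "\<forall>\<F>. finite \<F> \<and> \<F> \<subseteq> \<U> \<longrightarrow> \<Inter>\<F> \<noteq> {}"
  have sub: "C \<subseteq> types G \<B>" if "C \<in> \<U>" for C using cl that closedin_subset by force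
  \<comment> \<open>The sets that hold throughout some member of the family. A type containing all
    of them lies in every \<open>C\<close>: otherwise some \<open>A\<close> in it would be avoided
    by \<open>C\<close>, and the complement of \<open>A\<close> would be one of these sets.\<close>
  define \<F> where "\<F> = {A \<in> \<B>. \<exists>C\<in>\<U>. \<forall>p\<in>C. A \<in> p}"
  have "\<exists>p\<in>types G \<B>. \<F> \<subseteq> p"
  proof (rule types_extend)
    fix F assume F: "finite F" "F \<subseteq> \<F>"
    then have "\<forall>A\<in>F. \<exists>C. C \<in> \<U> \<and> (\<forall>p\<in>C. A \<in> p)" unfolding \<F>_def by blast
    from bchoice[OF this] obtain c where c: "\<forall>A\<in>F. c A \<in> \<U> \<and> (\<forall>p\<in>c A. A \<in> p)" by (elim exE)
    show "\<exists>g\<in>carrier G. \<forall>A\<in>F. g \<in> A"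
    proof (cases "F = {}")
      case True then show ?thesis using one_closed by auto
    next
      case False
      have "finite (c ` F)" "c ` F \<subseteq> \<U>" using F c by auto
      then have "\<Inter>(c ` F) \<noteq> {}" using fip by simp
      then obtain p where p: "p \<in> \<Inter>(c ` F)" by blast
      then have "p \<in> types G \<B>" using False c sub by blast
      moreover have "F \<subseteq> \<B>" using F by (auto simp: \<F>_def)
      ultimately have "\<exists>g\<in>carrier G. \<forall>A\<in>F. g \<in> A \<longleftrightarrow> A \<in> p"
        using F(1) by (intro types_realize)
      then obtain g where "g \<in> carrier G" "\<forall>A\<in>F. g \<in> A \<longleftrightarrow> A \<in> p" by (elim bexE)
      then show ?thesis using p c by blast
    qed
  qed (auto simp: \<F>_def)
  then obtain p where p: "p \<in> types G \<B>" "\<F> \<subseteq> p" by blast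
  have "p \<in> C" if C: "C \<in> \<U>" for C
  proof (rule ccontr)
    assume "p \<notin> C"
    then obtain A where A: "A \<in> p" "A \<in> \<B>" "\<And>q. q \<in> C \<Longrightarrow> A \<notin> q"
      using closedin_types_separate[of C p] cl C p by blast
    have "carrier G - A \<in> q" if "q \<in> C" for q using that A sub[OF C] types_compl by blast
    then have "carrier G - A \<in> \<F>" using A C by (auto simp: \<F>_def)
    then show False using p A types_compl by blast
  qed
  then show "\<Inter>\<U> \<noteq> {}" by blast
qed

lemma Hausdorff_types: "Hausdorff_space (type_space G \<B>)"
  unfolding Hausdorff_space_def
proof (intro allI impI)
  fix p q assume "p \<in> topspace (type_space G \<B>) \<and> q \<in> topspace (type_space G \<B>) \<and> p \<noteq> q"
  then have pq: "p \<in> types G \<B>" "q \<in> types G \<B>" "p \<noteq> q" by auto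
  then obtain A where A: "A \<in> p" "A \<notin> q" using types_eqI by blast
  then have AB: "A \<in> \<B>" using pq types_subset by blast
  have "disjnt {r \<in> types G \<B>. A \<in> r} {r \<in> types G \<B>. carrier G - A \<in> r}"
    using AB by (auto simp: disjnt_def types_compl)
  then show "\<exists>U V. openin (type_space G \<B>) U \<and> openin (type_space G \<B>) V \<and> p \<in> U \<and> q \<in> V \<and> disjnt U V"
    using AB A pq openin_basic[of A] openin_basic[of "carrier G - A"]
    by (intro exI[of _ "{r \<in> types G \<B>. A \<in> r}"] exI[of _ "{r \<in> types G \<B>. carrier G - A \<in> r}"])
      (auto simp: types_compl)
qed

lemma continuous_map_types:
  assumes "f \<in> topspace X \<rightarrow> types G \<B>" "\<And>A. A \<in> \<B> \<Longrightarrow> openin X {x \<in> topspace X. A \<in> f x}"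
  shows "continuous_map X (type_space G \<B>) f"
proof -
  have "f ` topspace X \<subseteq> \<Union>{{p \<in> types G \<B>. A \<in> p} | A. A \<in> \<B>}"
    using assms(1) topspace_types unfolding type_space_def topology_generated_by_topspace by auto
  moreover have "f -` {p \<in> types G \<B>. A \<in> p} \<inter> topspace X = {x \<in> topspace X. A \<in> f x}" for A
    using assms(1) by auto
  ultimately show ?thesis unfolding type_space_def
    by (intro continuous_on_generated_topo) (use assms(2) in auto)
qed

subsection \<open>The flow of types\<close>

lemma mem_image_l_coset:
  assumes "p \<subseteq> Pow (carrier G)" "g \<in> carrier G" "A \<subseteq> carrier G"
  shows "A \<in> (\<lambda>A. g <# A) ` p \<longleftrightarrow> inv g <# A \<in> p"
proof
  assume "A \<in> (\<lambda>A. g <# A) ` p"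
  then show "inv g <# A \<in> p" using assms by (auto simp: l_coset_inv' subset_iff)
next
  assume "inv g <# A \<in> p"
  then show "A \<in> (\<lambda>A. g <# A) ` p" using assms l_coset_inv by (metis image_eqI)
qed

lemma mem_type_action:
  assumes "p \<in> types G \<B>" "g \<in> carrier G"
  shows "A \<in> type_action G \<B> g p \<longleftrightarrow> A \<in> \<B> \<and> inv g <# A \<in> p"
proof -
  have "p \<subseteq> Pow (carrier G)" using types_subset[OF assms(1)] in_carrier by blast
  moreover have "A \<in> \<B>" if "A \<in> (\<lambda>A. g <# A) ` p"
    using that types_subset[OF assms(1)] l_coset_in assms by blast
  ultimately show ?thesis
    using assms mem_image_l_coset[of p g A] in_carrier by (auto simp: type_action_def)
qed

lemma type_action_closed:
  assumes p: "p \<in> types G \<B>" and g: "g \<in> carrier G"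
  shows "type_action G \<B> g p \<in> types G \<B>"
proof (rule typesI)
  show "type_action G \<B> g p \<subseteq> \<B>" using mem_type_action[OF assms] by blast
  have inv: "inv g \<in> carrier G" using g by simp
  show "carrier G - A \<in> type_action G \<B> g p \<longleftrightarrow> A \<notin> type_action G \<B> g p" if A: "A \<in> \<B>" for A
    using that p g l_coset_in[of "inv g" A] in_carrier[OF A]
    by (simp add: mem_type_action l_coset_compl types_compl compl_sets)
  show "carrier G \<in> type_action G \<B> g p"
    using p g types_carrier l_coset_compl[OF inv, of "{}"]
    by (auto simp: mem_type_action carrier_in l_coset_def)
  show "A \<inter> B \<in> type_action G \<B> g p" if "A \<in> type_action G \<B> g p" "B \<in> type_action G \<B> g p" for A B
    using that p g inv l_coset_in[OF inv] in_carrier by (auto simp: mem_type_action l_coset_Int types_Int)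
qed

lemma type_action_mult:
  assumes p: "p \<in> types G \<B>" and g: "g \<in> carrier G" and h: "h \<in> carrier G"
  shows "type_action G \<B> g (type_action G \<B> h p) = type_action G \<B> (g \<otimes> h) p"
proof -
  have "A \<in> type_action G \<B> g (type_action G \<B> h p) \<longleftrightarrow> A \<in> type_action G \<B> (g \<otimes> h) p" for A
  proof (cases "A \<in> \<B>")
    case True
    then show ?thesis using assms in_carrier[of A] l_coset_in[of "inv g" A]
      by (simp add: mem_type_action type_action_closed lcos_m_assoc inv_mult_group)
  next
    case False then show ?thesis using assms by (simp add: mem_type_action type_action_closed)
  qed
  then show ?thesis by blast
qed

lemma type_action_one:
  assumes p: "p \<in> types G \<B>" shows "type_action G \<B> \<one> p = p"
  using assms mem_type_action[OF p one_closed] types_subset[OF p] in_carrier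
  by (auto simp: lcos_mult_one)

lemma type_action_inv:
  assumes "p \<in> types G \<B>" "g \<in> carrier G"
  shows "type_action G \<B> g (type_action G \<B> (inv g) p) = p" "type_action G \<B> (inv g) (type_action G \<B> g p) = p"
  using assms by (simp_all add: type_action_mult type_action_one)

lemma type_action_bij: "g \<in> carrier G \<Longrightarrow> bij_betw (type_action G \<B> g) (types G \<B>) (types G \<B>)"
  by (rule bij_betwI[where g = "type_action G \<B> (inv g)"]) (auto simp: type_action_closed type_action_inv)

lemma type_action_continuous:
  assumes "g \<in> carrier G"
  shows "continuous_map (type_space G \<B>) (type_space G \<B>) (type_action G \<B> g)"
proof (rule continuous_map_types)
  fix A assume A: "A \<in> \<B>"
  have "{p \<in> topspace (type_space G \<B>). A \<in> type_action G \<B> g p} = {p \<in> types G \<B>. inv g <# A \<in> p}"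
    using A assms by (auto simp: mem_type_action)
  then show "openin (type_space G \<B>) {p \<in> topspace (type_space G \<B>). A \<in> type_action G \<B> g p}"
    using openin_basic l_coset_in A assms by simp
qed (use assms type_action_closed in auto)

lemma type_flow: "G_flow G (type_space G \<B>) (type_action G \<B>)"
  unfolding G_flow_def
proof (intro conjI ballI)
  show "topspace (type_space G \<B>) \<noteq> {}" using types_point[OF one_closed] by auto
  show "group_action G (topspace (type_space G \<B>)) (type_action G \<B>)"
  proof (intro group_action.intro group_hom.intro group_hom_axioms.intro)
    show "group (BijGroup (topspace (type_space G \<B>)))" by (rule group_BijGroup)
    show "type_action G \<B> \<in> hom G (BijGroup (topspace (type_space G \<B>)))"
    proof (rule homI)
      fix g assume g: "g \<in> carrier G"
      then show "type_action G \<B> g \<in> carrier (BijGroup (topspace (type_space G \<B>)))"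
        using type_action_bij[OF g] by (auto simp: BijGroup_def Bij_def type_action_def)
      fix h assume h: "h \<in> carrier G"
      show "type_action G \<B> (g \<otimes> h) = type_action G \<B> g \<otimes>\<^bsub>BijGroup (topspace (type_space G \<B>))\<^esub> type_action G \<B> h"
        using g h type_action_bij[OF g] type_action_bij[OF h]
        by (auto simp: BijGroup_def Bij_def type_action_mult compose_def fun_eq_iff) (auto simp: type_action_def)
    qed
  qed (rule is_group)
  fix g assume g: "g \<in> carrier G"
  show "homeomorphic_map (type_space G \<B>) (type_space G \<B>) (type_action G \<B> g)"
    by (rule continuous_imp_homeomorphic_map)
      (use g type_action_bij[OF g] in \<open>auto simp: type_action_continuous compact_types Hausdorff_types bij_betw_def\<close>)
qed (auto simp: compact_types Hausdorff_types)

lemma subflow_types_iff: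
  "subflow G (type_space G \<B>) (type_action G \<B>) Y \<longleftrightarrow>
    Y \<noteq> {} \<and> closedin (type_space G \<B>) Y \<and> (\<forall>g\<in>carrier G. \<forall>p\<in>Y. type_action G \<B> g p \<in> Y)"
  by (auto simp: subflow_def)

lemma subflow_types_subset:
  "subflow G (type_space G \<B>) (type_action G \<B>) Y \<Longrightarrow> Y \<subseteq> types G \<B>"
  using closedin_subset by (force simp: subflow_def)

end

section \<open>Existence of minimal subflows\<close>

lemma minimal_subflow_exists:
  assumes flow: "compact_space X" and Y: "subflow G X \<phi> Y"
  shows "\<exists>M. minimal_subflow G X \<phi> M \<and> M \<subseteq> Y"
proof -
  \<comment> \<open>Complements turn a minimal subflow into a maximal set, the form in which Zorn's
    lemma is applied.\<close>
  define \<A> where "\<A> = {topspace X - Z | Z. subflow G X \<phi> Z \<and> Z \<subseteq> Y}"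
  have cl: "closedin X Z" "Z \<subseteq> topspace X" "Z \<noteq> {}" if "subflow G X \<phi> Z" for Z
    using that closedin_subset by (auto simp: subflow_def)
  have "\<exists>M\<in>\<A>. \<forall>W\<in>\<A>. M \<subseteq> W \<longrightarrow> W = M"
  proof (rule subset_Zorn_nonempty)
    show "\<A> \<noteq> {}" using Y by (auto simp: \<A>_def)
    fix \<C> assume C: "\<C> \<noteq> {}" "subset.chain \<A> \<C>"
    define \<Z> where "\<Z> = (\<lambda>W. topspace X - W) ` \<C>"
    have Z: "subflow G X \<phi> Z" "Z \<subseteq> Y" if ZZ: "Z \<in> \<Z>" for Z
    proof -
      obtain W where W: "W \<in> \<C>" "Z = topspace X - W" using ZZ unfolding \<Z>_def by blast
      have "W \<in> \<A>" using C(2) W(1) by (auto simp: subset.chain_def)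
      then obtain Z' where "W = topspace X - Z'" "subflow G X \<phi> Z'" "Z' \<subseteq> Y"
        unfolding \<A>_def by (elim CollectE exE conjE)
      moreover from this have "Z = Z'" using cl(2)[of Z'] W(2) by blast
      ultimately show "subflow G X \<phi> Z" "Z \<subseteq> Y" by auto
    qed
    have ne: "\<Z> \<noteq> {}" using C by (auto simp: \<Z>_def)
    have chain: "A \<subseteq> B \<or> B \<subseteq> A" if AB: "A \<in> \<Z>" "B \<in> \<Z>" for A B
    proof -
      obtain V W where "V \<in> \<C>" "A = topspace X - V" "W \<in> \<C>" "B = topspace X - W"
        using AB unfolding \<Z>_def by blast
      moreover from this have "V \<subseteq> W \<or> W \<subseteq> V" using C(2) by (auto simp: subset.chain_def)
      ultimately show ?thesis by blast
    qed
    \<comment> \<open>A finite part of a chain has a least member, which is nonempty; by compactness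
      the intersection of the whole chain is then nonempty.\<close>
    have fin: "\<exists>B\<in>\<F>. \<forall>A\<in>\<F>. B \<subseteq> A" if "finite \<F>" "\<F> \<noteq> {}" "\<F> \<subseteq> \<Z>" for \<F>
      using that
    proof (induction \<F> rule: finite_ne_induct)
      case (insert A \<F>)
      then obtain B where B: "B \<in> \<F>" "\<forall>A\<in>\<F>. B \<subseteq> A" by blast
      show ?case
      proof (cases "A \<subseteq> B")
        case True then show ?thesis using B by (intro bexI[of _ A]) auto
      next
        case False
        have "A \<in> \<Z>" "B \<in> \<Z>" using insert.prems B(1) by auto
        then have "B \<subseteq> A" using chain False by blast
        then show ?thesis using B by (intro bexI[of _ B]) auto
      qed
    qed auto
    have "\<Inter>\<F> \<noteq> {}" if F: "finite \<F>" "\<F> \<subseteq> \<Z>" for \<F>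
    proof (cases "\<F> = {}")
      case False
      from fin[OF F(1) this F(2)] obtain B where B: "B \<in> \<F>" "\<forall>A\<in>\<F>. B \<subseteq> A" by (elim bexE)
      then have "B \<subseteq> \<Inter>\<F>" by blast
      moreover have "B \<noteq> {}" using cl(3)[OF Z(1)[of B]] B(1) F(2) by blast
      ultimately show ?thesis by blast
    qed simp
    then have I: "\<Inter>\<Z> \<noteq> {}"
      using flow[unfolded compact_space_fip, rule_format, of \<Z>] cl(1)[OF Z(1)] by simp
    have "subflow G X \<phi> (\<Inter>\<Z>)"
      unfolding subflow_def
    proof (intro conjI ballI)
      show "closedin X (\<Inter>\<Z>)" using ne cl(1)[OF Z(1)] by (rule closedin_Inter)
      fix g assume g: "g \<in> carrier G"
      have "\<phi> g ` Z \<subseteq> Z" if "Z \<in> \<Z>" for Z using Z(1)[OF that] g by (simp add: subflow_def)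
      then show "\<phi> g ` \<Inter>\<Z> \<subseteq> \<Inter>\<Z>" by blast
    qed (rule I)
    moreover have "\<Inter>\<Z> \<subseteq> Y" using Z(2) ne by blast
    moreover have "\<Union>\<C> = topspace X - \<Inter>\<Z>"
    proof -
      have "W \<subseteq> topspace X" if "W \<in> \<C>" for W
      proof -
        have "W \<in> \<A>" using C(2) that by (auto simp: subset.chain_def)
        then show ?thesis unfolding \<A>_def by (elim CollectE exE conjE) simp
      qed
      then show ?thesis unfolding \<Z>_def by auto
    qed
    ultimately show "\<Union>\<C> \<in> \<A>" unfolding \<A>_def by blast
  qed
  then obtain V where V: "V \<in> \<A>" "\<And>W. W \<in> \<A> \<Longrightarrow> V \<subseteq> W \<Longrightarrow> W = V" by (elim bexE) simp
  then obtain M where VM: "V = topspace X - M" and M: "subflow G X \<phi> M" "M \<subseteq> Y"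
    unfolding \<A>_def by (elim CollectE exE conjE) simp
  have max: "topspace X - Z = topspace X - M"
    if "subflow G X \<phi> Z" "Z \<subseteq> Y" "topspace X - M \<subseteq> topspace X - Z" for Z
    using V(2)[of "topspace X - Z"] that unfolding VM \<A>_def by blast
  have "minimal_subflow G X \<phi> M"
    unfolding minimal_subflow_def
  proof (intro conjI allI impI)
    fix Z assume Z: "subflow G X \<phi> Z \<and> Z \<subseteq> M"
    then have "topspace X - Z = topspace X - M" using M by (intro max) auto
    moreover have "Z \<subseteq> topspace X" "M \<subseteq> topspace X" using cl(2) Z M(1) by auto
    ultimately show "Z = M" by blast
  qed (rule M)
  then show ?thesis using M by blast
qed

section \<open>Counting the traces of a ladder-free relation\<close>

lemma uncountable_nat_bool: "uncountable (UNIV :: (nat \<Rightarrow> bool) set)"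
proof
  assume c: "countable (UNIV :: (nat \<Rightarrow> bool) set)"
  define e where "e = from_nat_into (UNIV :: (nat \<Rightarrow> bool) set)"
  have "range e = UNIV" unfolding e_def by (rule range_from_nat_into) (use c in auto)
  then obtain n where "e n = (\<lambda>k. \<not> e k k)" by (metis UNIV_I imageE)
  then have "e n n = (\<not> e n n)" by (rule fun_cong)
  then show False by simp
qed

text \<open>Countably many rows \<open>X0\<close> suffice to realise every finite pattern on
  \<open>Y\<close> that is realised at all. They still approximate each \<open>D\<close>, so
  \<open>D\<close> is determined by finitely many of them, and a finite set of rows determines only
  finitely many \<open>D\<close>.\<close>

lemma ladder_free_countable_closure:
  fixes R :: "'a \<Rightarrow> 'b \<Rightarrow> bool"
  assumes st: "ladder_free R X Y" and Y: "countable Y"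
  shows "countable {D. D \<subseteq> Y \<and> (\<forall>F. finite F \<longrightarrow> F \<subseteq> Y \<longrightarrow> (\<exists>x\<in>X. \<forall>y\<in>F. R x y \<longleftrightarrow> y \<in> D))}"
    (is "countable ?\<D>")
proof -
  define fin where "fin = {F. finite F \<and> F \<subseteq> Y}"
  define real where "real F S x \<longleftrightarrow> x \<in> X \<and> (\<forall>y\<in>F. R x y \<longleftrightarrow> y \<in> S)" for F S x
  define I where "I = {z \<in> fin \<times> fin. \<exists>x. real (fst z) (snd z) x}"
  define X0 where "X0 = (\<lambda>z. SOME x. real (fst z) (snd z) x) ` I"
  have "countable fin" unfolding fin_def using Y by (rule countable_Collect_finite_subset)
  then have "countable (fin \<times> fin)" by blast
  then have "countable I" by (rule countable_subset[rotated]) (auto simp: I_def)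
  then have cX0: "countable X0" unfolding X0_def by (rule countable_image)
  have some: "real (fst z) (snd z) (SOME x. real (fst z) (snd z) x)" if "z \<in> I" for z
    using that someI_ex[of "real (fst z) (snd z)"] by (simp add: I_def)
  have X0: "X0 \<subseteq> X"
  proof
    fix x assume "x \<in> X0"
    then obtain z where "z \<in> I" "x = (SOME x. real (fst z) (snd z) x)" unfolding X0_def by (elim imageE)
    then show "x \<in> X" using some[of z] by (simp add: real_def)
  qed
  define det where "det F = {D. D \<subseteq> Y \<and> (\<forall>y\<in>Y. \<forall>z\<in>Y. (\<forall>x\<in>F. R x y \<longleftrightarrow> R x z) \<longrightarrow> (y \<in> D \<longleftrightarrow> z \<in> D))}" for F
  \<comment> \<open>A set determined by \<open>F\<close> is recovered from the patterns in
    \<open>Pow F\<close> that its points realise.\<close>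
  have fdet: "finite (det F)" if F: "finite F" for F
  proof (rule inj_on_finite)
    let ?f = "\<lambda>D. (\<lambda>y. {x \<in> F. R x y}) ` D"
    show "?f ` det F \<subseteq> Pow (Pow F)" by auto
    show "finite (Pow (Pow F))" using F by simp
    show "inj_on ?f (det F)"
    proof (rule inj_onI)
      have *: "D \<subseteq> D'" if D: "D \<in> det F" "D' \<in> det F" "?f D = ?f D'" for D D'
      proof
        fix y assume y: "y \<in> D"
        then have "{x \<in> F. R x y} \<in> ?f D'" using D(3) by blast
        then obtain z where z: "z \<in> D'" "{x \<in> F. R x y} = {x \<in> F. R x z}" by blast
        then have "\<forall>x\<in>F. R x y \<longleftrightarrow> R x z" by blast
        moreover have "y \<in> Y" "z \<in> Y" using y z D by (auto simp: det_def)
        ultimately have "y \<in> D' \<longleftrightarrow> z \<in> D'" using D(2) unfolding det_def by blast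
        then show "y \<in> D'" using z by simp
      qed
      fix D D' assume "D \<in> det F" "D' \<in> det F" "?f D = ?f D'"
      then show "D = D'" using *[of D D'] *[of D' D] by auto
    qed
  qed
  have "?\<D> \<subseteq> (\<Union>F\<in>{F. finite F \<and> F \<subseteq> X0}. det F)"
  proof
    fix D assume D: "D \<in> ?\<D>"
    have "\<exists>F. finite F \<and> F \<subseteq> X0 \<and> (\<forall>y\<in>Y. \<forall>z\<in>Y. (\<forall>x\<in>F. R x y \<longleftrightarrow> R x z) \<longrightarrow> (y \<in> D \<longleftrightarrow> z \<in> D))"
    proof (rule ladder_free_definable)
      show "ladder_free R X0 Y" using st X0 by (rule ladder_free_mono) simp
      fix F assume F: "finite F" "F \<subseteq> Y"
      then obtain x where "x \<in> X" "\<forall>y\<in>F. R x y \<longleftrightarrow> y \<in> D" using D by blast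
      then have "real F (F \<inter> D) x" by (simp add: real_def)
      then have I: "(F, F \<inter> D) \<in> I" using F by (auto simp: I_def fin_def)
      define x0 where "x0 = (SOME x. real F (F \<inter> D) x)"
      have "real F (F \<inter> D) x0" using some[OF I] by (simp add: x0_def)
      moreover have "x0 \<in> X0" using imageI[OF I, of "\<lambda>z. SOME x. real (fst z) (snd z) x"] by (simp add: X0_def x0_def)
      ultimately show "\<exists>x\<in>X0. \<forall>y\<in>F. R x y \<longleftrightarrow> y \<in> D" by (auto simp: real_def)
    qed
    then obtain F where "finite F" "F \<subseteq> X0" "\<forall>y\<in>Y. \<forall>z\<in>Y. (\<forall>x\<in>F. R x y \<longleftrightarrow> R x z) \<longrightarrow> (y \<in> D \<longleftrightarrow> z \<in> D)"
      by (elim exE conjE)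
    moreover have "D \<subseteq> Y" using D by simp
    ultimately show "D \<in> (\<Union>F\<in>{F. finite F \<and> F \<subseteq> X0}. det F)" unfolding det_def by blast
  qed
  moreover have "countable (\<Union>F\<in>{F. finite F \<and> F \<subseteq> X0}. det F)"
    by (rule countable_UN) (use cX0 fdet in \<open>auto intro: countable_Collect_finite_subset countable_finite\<close>)
  ultimately show ?thesis by (rule countable_subset)
qed

section \<open>Definability of types over stable sets\<close>

lemma (in Sigma_Algebra.algebra) atom_in:
  assumes "finite F" "\<And>x. x \<in> F \<Longrightarrow> S x \<in> M"
  shows "{z \<in> \<Omega>. \<forall>x\<in>F. z \<in> S x \<longleftrightarrow> b x} \<in> M"
  using assms
proof (induction F rule: finite_induct)
  case empty then show ?case using top by simp
next
  case (insert x F)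
  let ?N = "{z \<in> \<Omega>. \<forall>x\<in>F. z \<in> S x \<longleftrightarrow> b x}"
  have N: "?N \<in> M" "S x \<in> M" using insert by auto
  have "{z \<in> \<Omega>. \<forall>y\<in>insert x F. z \<in> S y \<longleftrightarrow> b y} = (if b x then ?N \<inter> S x else ?N - S x)" by auto
  then show ?case using N by (auto intro: Int Diff)
qed

text \<open>Such a \<open>D\<close> is a union of atoms of the finitely many sets
  \<open>S x\<close>. This turns definability by finitely many rows into membership in an
  algebra.\<close>

lemma (in Sigma_Algebra.algebra) finitely_determined_in:
  assumes F: "finite F" "\<And>x. x \<in> F \<Longrightarrow> S x \<in> M" and D: "D \<subseteq> \<Omega>"
    and det: "\<And>y z. y \<in> \<Omega> \<Longrightarrow> z \<in> \<Omega> \<Longrightarrow> (\<And>x. x \<in> F \<Longrightarrow> y \<in> S x \<longleftrightarrow> z \<in> S x) \<Longrightarrow> y \<in> D \<Longrightarrow> z \<in> D"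
  shows "D \<in> M"
proof -
  define atom where "atom T = {z \<in> \<Omega>. \<forall>x\<in>F. z \<in> S x \<longleftrightarrow> x \<in> T}" for T
  define \<T> where "\<T> = (\<lambda>y. {x \<in> F. y \<in> S x}) ` D"
  have "\<T> \<subseteq> Pow F" by (auto simp: \<T>_def)
  then have "finite \<T>" using F(1) finite_subset by blast
  then have "(\<Union>T\<in>\<T>. atom T) \<in> M" unfolding atom_def by (intro finite_UN) (use atom_in[OF F] in auto)
  moreover have "(\<Union>T\<in>\<T>. atom T) = D"
  proof
    show "(\<Union>T\<in>\<T>. atom T) \<subseteq> D"
    proof
      fix z assume "z \<in> (\<Union>T\<in>\<T>. atom T)"
      then obtain y where y: "y \<in> D" "z \<in> atom {x \<in> F. y \<in> S x}" by (auto simp: \<T>_def)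
      show "z \<in> D" by (rule det[of y]) (use y D in \<open>auto simp: atom_def\<close>)
    qed
    show "D \<subseteq> (\<Union>T\<in>\<T>. atom T)" using D by (auto simp: \<T>_def atom_def)
  qed
  ultimately show ?thesis by simp
qed

text \<open>The mirror image of \<open>type_d\<close>: as \<open>x\<close> lies in
  \<open>A #> inv y\<close> iff \<open>x \<otimes> y\<close> lies in \<open>A\<close>, it collects
  the right factors \<open>y\<close> that put the product in \<open>A\<close> for
  \<open>p\<close>-almost all \<open>x\<close>, whereas \<open>type_d\<close> collects left
  factors.\<close>

definition type_e :: "('a, 'm) monoid_scheme \<Rightarrow> 'a set set \<Rightarrow> 'a set \<Rightarrow> 'a set" where
  "type_e G p A = {y \<in> carrier G. A #>\<^bsub>G\<^esub> inv\<^bsub>G\<^esub> y \<in> p}"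

context invariant_algebra
begin

lemma type_d_subset: "type_d G p A \<subseteq> carrier G"
  by (auto simp: type_d_def)

lemma type_e_subset: "type_e G p A \<subseteq> carrier G"
  by (auto simp: type_e_def)

lemma type_d_closure:
  assumes p: "p \<in> types G \<B>" and A: "A \<in> \<B>" and F: "finite F" "F \<subseteq> carrier G"
  shows "\<exists>g\<in>carrier G. \<forall>x\<in>F. x \<otimes> g \<in> A \<longleftrightarrow> x \<in> type_d G p A"
proof -
  have H: "finite ((\<lambda>x. inv x <# A) ` F)" "(\<lambda>x. inv x <# A) ` F \<subseteq> \<B>" using l_coset_in A F by auto
  from types_realize[OF p H] obtain g where g: "g \<in> carrier G" "\<forall>E\<in>(\<lambda>x. inv x <# A) ` F. g \<in> E \<longleftrightarrow> E \<in> p"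
    by (elim bexE)
  have "x \<otimes> g \<in> A \<longleftrightarrow> x \<in> type_d G p A" if "x \<in> F" for x
  proof -
    have x: "x \<in> carrier G" using that F by blast
    have "x \<otimes> g \<in> A \<longleftrightarrow> g \<in> inv x <# A" using x g(1) in_carrier[OF A] by (simp add: mem_l_coset_iff)
    also have "\<dots> \<longleftrightarrow> inv x <# A \<in> p" using g(2) that by blast
    finally show ?thesis using x by (simp add: type_d_def)
  qed
  then show ?thesis using g(1) by blast
qed

lemma type_e_closure:
  assumes p: "p \<in> types G \<B>" and A: "A \<subseteq> carrier G" "\<And>g. g \<in> carrier G \<Longrightarrow> A #> g \<in> \<B>"
    and F: "finite F" "F \<subseteq> carrier G"
  shows "\<exists>g\<in>carrier G. \<forall>y\<in>F. g \<otimes> y \<in> A \<longleftrightarrow> y \<in> type_e G p A"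
proof -
  have H: "finite ((\<lambda>y. A #> inv y) ` F)" "(\<lambda>y. A #> inv y) ` F \<subseteq> \<B>" using A F by auto
  from types_realize[OF p H] obtain g where g: "g \<in> carrier G" "\<forall>E\<in>(\<lambda>y. A #> inv y) ` F. g \<in> E \<longleftrightarrow> E \<in> p"
    by (elim bexE)
  have "g \<otimes> y \<in> A \<longleftrightarrow> y \<in> type_e G p A" if "y \<in> F" for y
  proof -
    have y: "y \<in> carrier G" using that F by blast
    have "g \<otimes> y \<in> A \<longleftrightarrow> g \<in> A #> inv y" using y g(1) A by (simp add: mem_r_coset_iff)
    also have "\<dots> \<longleftrightarrow> A #> inv y \<in> p" using g(2) that by blast
    finally show ?thesis using y by (simp add: type_e_def)
  qed
  then show ?thesis using g(1) by blast
qed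

text \<open>Group elements approximate \<open>p\<close>, so \<open>type_d G p A\<close> is a limit
  of the sets \<open>A #> inv g\<close>, and definability makes it a Boolean combination of finitely
  many of them. The algebra \<C> is a separate parameter since these right translates may lie
  outside \<B>.\<close>

lemma type_d_in:
  assumes p: "p \<in> types G \<B>" and A: "A \<in> \<B>" "wstable G A"
    and C: "Sigma_Algebra.algebra (carrier G) \<C>" "\<And>g. g \<in> carrier G \<Longrightarrow> A #> g \<in> \<C>"
  shows "type_d G p A \<in> \<C>"
proof -
  interpret C: Sigma_Algebra.algebra "carrier G" \<C> by (rule C)
  have st: "ladder_free (\<lambda>g x. x \<otimes> g \<in> A) (carrier G) (carrier G)"
    using A(2) ladder_free_converse[of "\<lambda>x y. x \<otimes> y \<in> A" "carrier G" "carrier G"] by (simp add: wstable_def)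
  have "\<exists>F. finite F \<and> F \<subseteq> carrier G \<and> (\<forall>x\<in>carrier G. \<forall>y\<in>carrier G.
      (\<forall>g\<in>F. x \<otimes> g \<in> A \<longleftrightarrow> y \<otimes> g \<in> A) \<longrightarrow> (x \<in> type_d G p A \<longleftrightarrow> y \<in> type_d G p A))"
    by (rule ladder_free_definable[OF st]) (rule type_d_closure[OF p A(1)])
  then obtain F where F: "finite F" "F \<subseteq> carrier G"
    "\<forall>x\<in>carrier G. \<forall>y\<in>carrier G. (\<forall>g\<in>F. x \<otimes> g \<in> A \<longleftrightarrow> y \<otimes> g \<in> A) \<longrightarrow> (x \<in> type_d G p A \<longleftrightarrow> y \<in> type_d G p A)"
    by (elim exE conjE)
  have iff: "x \<in> A #> inv g \<longleftrightarrow> x \<otimes> g \<in> A" if "x \<in> carrier G" "g \<in> F" for x g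
  proof -
    have "g \<in> carrier G" using that F by blast
    then show ?thesis using that in_carrier[OF A(1)] by (simp add: mem_r_coset_iff)
  qed
  show ?thesis
  proof (rule C.finitely_determined_in[OF F(1), of "\<lambda>g. A #> inv g"])
    show "A #> inv g \<in> \<C>" if "g \<in> F" for g using that F C by auto
    fix x y assume xy: "x \<in> carrier G" "y \<in> carrier G" "\<And>g. g \<in> F \<Longrightarrow> x \<in> A #> inv g \<longleftrightarrow> y \<in> A #> inv g" "x \<in> type_d G p A"
    then have "\<forall>g\<in>F. x \<otimes> g \<in> A \<longleftrightarrow> y \<otimes> g \<in> A" using iff by blast
    then show "y \<in> type_d G p A" using F(3) xy(1,2,4) by blast
  qed (rule type_d_subset)
qed

text \<open>Here the approximating sets are left translates \<open>inv g <# A\<close>, so any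
  left-invariant algebra \<C> that contains \<open>A\<close> will do.\<close>

lemma type_e_in:
  assumes p: "p \<in> types G \<B>" and A: "wstable G A" "\<And>g. g \<in> carrier G \<Longrightarrow> A #> g \<in> \<B>"
    and C: "Sigma_Algebra.algebra (carrier G) \<C>" "\<And>g. g \<in> carrier G \<Longrightarrow> g <# A \<in> \<C>"
  shows "type_e G p A \<in> \<C>"
proof -
  interpret C: Sigma_Algebra.algebra "carrier G" \<C> by (rule C)
  have Ac: "A \<subseteq> carrier G" using A(1) by (rule wstable_subset)
  have st: "ladder_free (\<lambda>g x. g \<otimes> x \<in> A) (carrier G) (carrier G)"
    using A(1) by (simp add: wstable_def)
  have "\<exists>F. finite F \<and> F \<subseteq> carrier G \<and> (\<forall>x\<in>carrier G. \<forall>y\<in>carrier G.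
      (\<forall>g\<in>F. g \<otimes> x \<in> A \<longleftrightarrow> g \<otimes> y \<in> A) \<longrightarrow> (x \<in> type_e G p A \<longleftrightarrow> y \<in> type_e G p A))"
    by (rule ladder_free_definable[OF st]) (rule type_e_closure[OF p Ac A(2)])
  then obtain F where F: "finite F" "F \<subseteq> carrier G"
    "\<forall>x\<in>carrier G. \<forall>y\<in>carrier G. (\<forall>g\<in>F. g \<otimes> x \<in> A \<longleftrightarrow> g \<otimes> y \<in> A) \<longrightarrow> (x \<in> type_e G p A \<longleftrightarrow> y \<in> type_e G p A)"
    by (elim exE conjE)
  have iff: "x \<in> inv g <# A \<longleftrightarrow> g \<otimes> x \<in> A" if "x \<in> carrier G" "g \<in> F" for x g
  proof -
    have "g \<in> carrier G" using that F by blast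
    then show ?thesis using that Ac by (simp add: mem_l_coset_iff)
  qed
  show ?thesis
  proof (rule C.finitely_determined_in[OF F(1), of "\<lambda>g. inv g <# A"])
    show "inv g <# A \<in> \<C>" if "g \<in> F" for g using that F C by auto
    fix x y assume xy: "x \<in> carrier G" "y \<in> carrier G" "\<And>g. g \<in> F \<Longrightarrow> x \<in> inv g <# A \<longleftrightarrow> y \<in> inv g <# A" "x \<in> type_e G p A"
    then have "\<forall>g\<in>F. g \<otimes> x \<in> A \<longleftrightarrow> g \<otimes> y \<in> A" using iff by blast
    then show "y \<in> type_e G p A" using F(3) xy(1,2,4) by blast
  qed (rule type_e_subset)
qed

lemma type_d_compl:
  assumes "p \<in> types G \<B>" "A \<in> \<B>"
  shows "type_d G p (carrier G - A) = carrier G - type_d G p A"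
  using assms l_coset_in in_carrier by (auto simp: type_d_def l_coset_compl types_compl)

lemma type_e_compl:
  assumes "p \<in> types G \<B>" "A \<subseteq> carrier G" "\<And>g. g \<in> carrier G \<Longrightarrow> A #> g \<in> \<B>"
  shows "type_e G p (carrier G - A) = carrier G - type_e G p A"
  using assms by (auto simp: type_e_def r_coset_compl types_compl)

lemma type_d_Int:
  assumes "p \<in> types G \<B>" "A \<in> \<B>" "B \<in> \<B>"
  shows "type_d G p (A \<inter> B) = type_d G p A \<inter> type_d G p B"
  using assms l_coset_in in_carrier by (auto simp: type_d_def l_coset_Int types_Int)

lemma type_d_carrier:
  assumes "p \<in> types G \<B>" shows "type_d G p (carrier G) = carrier G"
  using type_d_compl[OF assms, of "{}"] types_not_empty[OF assms] by (auto simp: type_d_def l_coset_def)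

lemma type_d_l_coset:
  assumes "p \<in> types G \<B>" "A \<in> \<B>" "g \<in> carrier G"
  shows "type_d G p (g <# A) = g <# type_d G p A"
  using assms in_carrier[OF assms(2)] type_d_subset[of p A]
  by (auto simp: type_d_def mem_l_coset_iff lcos_m_assoc inv_mult_group)

lemma type_d_type_action:
  assumes "p \<in> types G \<B>" "A \<in> \<B>" "g \<in> carrier G"
  shows "type_d G (type_action G \<B> g p) A = type_d G p A #> inv g"
  using assms in_carrier[OF assms(2)] type_d_subset[of p A] l_coset_in
  by (auto simp: type_d_def mem_type_action mem_r_coset_iff lcos_m_assoc inv_mult_group)

lemma mem_type_iff_type_d:
  assumes "p \<in> types G \<B>" "A \<in> \<B>" shows "A \<in> p \<longleftrightarrow> \<one> \<in> type_d G p A"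
  using assms in_carrier by (simp add: type_d_def lcos_mult_one)

end

section \<open>Exchange of iterated limits, and translates on the two sides\<close>

context group
begin

text \<open>Grothendieck's double limit criterion: if the two iterated limits differed, alternate choices would produce a ladder.\<close>
lemma exchange:
  assumes B: "invariant_algebra G \<B>" and C: "invariant_algebra G \<C>"
    and A: "wstable G A" "A \<in> \<B>" "\<And>g. g \<in> carrier G \<Longrightarrow> A #> g \<in> \<C>"
    and r: "r \<in> types G \<C>" and q: "q \<in> types G \<B>"
  shows "type_d G q A \<in> r \<longleftrightarrow> type_e G r A \<in> q"
proof -
  interpret B: invariant_algebra G \<B> by (rule B)
  interpret C: invariant_algebra G \<C> by (rule C)
  have half: "type_e G r A \<in> q" if A: "wstable G A" "A \<in> \<B>" "\<And>g. g \<in> carrier G \<Longrightarrow> A #> g \<in> \<C>"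
    and d: "type_d G q A \<in> r" for A
  proof (rule ccontr)
    assume e: "type_e G r A \<notin> q"
    have Ac: "A \<subseteq> carrier G" using A(1) by (rule wstable_subset)
    have eB: "type_e G r A \<in> \<B>"
      by (rule C.type_e_in[OF r A(1,3) B.algebra_axioms]) (use A(2) B.l_coset_in in auto)
    let ?Y = "carrier G - type_e G r A"
    have Yq: "?Y \<in> q" using e eB q B.types_compl by blast
    \<comment> \<open>Choose \<open>x\<close> along \<open>r\<close> inside
      \<open>type_d G q A\<close> and \<open>y\<close> along \<open>q\<close> outside
      \<open>type_e G r A\<close>: such an \<open>x\<close> succeeds with \<open>q\<close>-almost
      all \<open>y\<close>, and such a \<open>y\<close> fails with \<open>r\<close>-almost all
      \<open>x\<close>.\<close>
    have "ladder (\<lambda>x y. x \<otimes> y \<in> A) (type_d G q A) ?Y"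
    proof (rule exchange_ladder)
      fix F assume F: "finite F" "F \<subseteq> ?Y"
      let ?H = "insert (type_d G q A) ((\<lambda>y. A #> inv y) ` F)"
      have H: "finite ?H" "?H \<subseteq> \<C>" using F A(3) d C.types_subset[OF r] by auto
      from C.types_realize[OF r H] obtain x where x: "x \<in> carrier G" "\<forall>E\<in>?H. x \<in> E \<longleftrightarrow> E \<in> r"
        by (elim bexE)
      have "x \<otimes> y \<notin> A" if y: "y \<in> F" for y
      proof -
        have yc: "y \<in> carrier G" "A #> inv y \<notin> r" using F y by (auto simp: type_e_def)
        then have "x \<notin> A #> inv y" using x(2) y by blast
        then show ?thesis using x(1) yc Ac by (simp add: mem_r_coset_iff)
      qed
      then show "\<exists>x\<in>type_d G q A. \<forall>y\<in>F. x \<otimes> y \<notin> A" using bspec[OF x(2), of "type_d G q A"] d by blast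
    next
      fix F assume F: "finite F" "F \<subseteq> type_d G q A"
      let ?H = "insert ?Y ((\<lambda>x. inv x <# A) ` F)"
      have Fc: "F \<subseteq> carrier G" using F by (auto simp: type_d_def)
      have "?Y \<in> \<B>" using eB by (rule B.compl_sets)
      then have H: "finite ?H" "?H \<subseteq> \<B>" using F A(2) Fc B.l_coset_in by auto
      from B.types_realize[OF q H] obtain y where y: "y \<in> carrier G" "\<forall>E\<in>?H. y \<in> E \<longleftrightarrow> E \<in> q"
        by (elim bexE)
      have "x \<otimes> y \<in> A" if x: "x \<in> F" for x
      proof -
        have xc: "x \<in> carrier G" "inv x <# A \<in> q" using F x by (auto simp: type_d_def)
        then have "y \<in> inv x <# A" using y(2) x by blast
        then show ?thesis using y(1) xc Ac by (simp add: mem_l_coset_iff)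
      qed
      then show "\<exists>y\<in>?Y. \<forall>x\<in>F. x \<otimes> y \<in> A" using bspec[OF y(2), of ?Y] Yq by blast
    qed
    then have "ladder (\<lambda>x y. x \<otimes> y \<in> A) (carrier G) (carrier G)"
      by (rule ladder_mono) (auto simp: type_d_def)
    then show False using A(1) by (simp add: wstable_def ladder_free_def)
  qed
  have Ac: "A \<subseteq> carrier G" using A(1) by (rule wstable_subset)
  show ?thesis
  proof
    show "type_e G r A \<in> q" if "type_d G q A \<in> r" using half A that by blast
    assume e: "type_e G r A \<in> q"
    show "type_d G q A \<in> r"
    proof (rule ccontr)
      assume nd: "type_d G q A \<notin> r"
      have dC: "type_d G q A \<in> \<C>" by (rule B.type_d_in[OF q A(2,1) C.algebra_axioms A(3)])
      \<comment> \<open>The remaining implication is \<open>half\<close> for the complement of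
        \<open>A\<close>.\<close>
      have "type_d G q (carrier G - A) \<in> r"
        using nd dC C.types_compl[OF r] B.type_d_compl[OF q A(2)] by simp
      then have "type_e G r (carrier G - A) \<in> q"
        by (rule half[rotated 3]) (use A Ac wstable_compl in \<open>auto simp: r_coset_compl\<close>)
      then have "carrier G - type_e G r A \<in> q" using C.type_e_compl[OF r Ac A(3)] by simp
      moreover have "type_e G r A \<in> \<B>" using e q B.types_subset by blast
      ultimately show False using e B.types_compl[OF q] by blast
    qed
  qed
qed

text \<open>\<open>y\<close> lies in \<open>g <# D\<close> iff \<open>inv g\<close> lies in
  \<open>D #> inv y\<close>, so a left translate is determined by which of the finitely many right
  translates contain \<open>inv g\<close>.\<close>

lemma finite_r_cosets_imp_l_cosets:
  assumes D: "D \<subseteq> carrier G" and fin: "finite ((\<lambda>g. D #> g) ` carrier G)"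
  shows "finite ((\<lambda>g. g <# D) ` carrier G)"
proof -
  let ?T = "(\<lambda>g. D #> g) ` carrier G"
  have "(\<lambda>g. g <# D) ` carrier G \<subseteq> (\<lambda>\<U>. {y \<in> carrier G. D #> inv y \<in> \<U>}) ` Pow ?T"
  proof (rule image_subsetI)
    fix g assume g: "g \<in> carrier G"
    have "g <# D = {y \<in> carrier G. D #> inv y \<in> {E \<in> ?T. (inv g) \<in> E}}"
      using g D by (auto simp: mem_l_coset_iff mem_r_coset_iff)
    then show "g <# D \<in> (\<lambda>\<U>. {y \<in> carrier G. D #> inv y \<in> \<U>}) ` Pow ?T" by blast
  qed
  moreover have "finite ((\<lambda>\<U>. {y \<in> carrier G. D #> inv y \<in> \<U>}) ` Pow ?T)" using fin by simp
  ultimately show ?thesis by (rule finite_subset)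
qed

end

section \<open>Minimal subflows and finite orbits\<close>

context invariant_algebra
begin

lemma minimal_subflow_subset:
  "minimal_subflow G (type_space G \<B>) (type_action G \<B>) M \<Longrightarrow> M \<subseteq> types G \<B>"
  using subflow_types_subset by (auto simp: minimal_subflow_def)

lemma minimal_subflowD:
  assumes "minimal_subflow G (type_space G \<B>) (type_action G \<B>) M"
  shows "M \<noteq> {}" "closedin (type_space G \<B>) M" "\<And>g p. g \<in> carrier G \<Longrightarrow> p \<in> M \<Longrightarrow> type_action G \<B> g p \<in> M"
    "\<And>Z. subflow G (type_space G \<B>) (type_action G \<B>) Z \<Longrightarrow> Z \<subseteq> M \<Longrightarrow> Z = M"
  using assms by (auto simp: minimal_subflow_def subflow_types_iff)

text \<open>The types of \<open>M\<close> that contain no translate of \<open>N\<close> form a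
  closed invariant set without \<open>p\<close>, which is empty by minimality; compactness of
  \<open>M\<close> then yields the finite \<open>K\<close>.\<close>

lemma minimal_subflow_cover:
  assumes M: "minimal_subflow G (type_space G \<B>) (type_action G \<B>) M"
    and N: "N \<in> \<B>" and p: "p \<in> M" "N \<in> p"
  shows "\<exists>K. finite K \<and> K \<subseteq> carrier G \<and> (\<forall>q\<in>M. \<exists>g\<in>K. g <# N \<in> q)"
proof -
  let ?X = "type_space G \<B>"
  have MT: "M \<subseteq> types G \<B>" using M by (rule minimal_subflow_subset)
  have cov: "\<exists>g\<in>carrier G. g <# N \<in> q" if q: "q \<in> M" for q
  proof (rule ccontr)
    assume neg: "\<not> ?thesis"
    define Z where "Z = {r \<in> M. \<forall>g\<in>carrier G. g <# N \<notin> r}"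
    have "Z = M - (\<Union>g\<in>carrier G. {r \<in> types G \<B>. g <# N \<in> r})" using MT by (auto simp: Z_def)
    moreover have "openin ?X (\<Union>g\<in>carrier G. {r \<in> types G \<B>. g <# N \<in> r})"
      using openin_basic l_coset_in[OF _ N] by (intro openin_Union) auto
    ultimately have "closedin ?X Z" using minimal_subflowD(2)[OF M] by (simp add: closedin_diff)
    moreover have "type_action G \<B> g r \<in> Z" if "g \<in> carrier G" "r \<in> Z" for g r
    proof -
      have r: "r \<in> M" "r \<in> types G \<B>" using that MT by (auto simp: Z_def)
      have "h <# N \<notin> type_action G \<B> g r" if h: "h \<in> carrier G" for h
      proof -
        have "inv g <# (h <# N) = (inv g \<otimes> h) <# N"
          using h \<open>g \<in> carrier G\<close> in_carrier[OF N] by (simp add: lcos_m_assoc)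
        then show ?thesis using \<open>r \<in> Z\<close> h \<open>g \<in> carrier G\<close> r by (auto simp: mem_type_action Z_def)
      qed
      then show ?thesis using minimal_subflowD(3)[OF M that(1) r(1)] by (simp add: Z_def)
    qed
    moreover have "q \<in> Z" using neg q by (auto simp: Z_def)
    ultimately have "subflow G ?X (type_action G \<B>) Z" by (auto simp: subflow_types_iff)
    then have "Z = M" by (rule minimal_subflowD(4)[OF M]) (auto simp: Z_def)
    then have "\<one> <# N \<notin> p" using p(1) by (auto simp: Z_def)
    then show False using p in_carrier[OF N] by (simp add: lcos_mult_one)
  qed
  have "compactin ?X M" using compact_types minimal_subflowD(2)[OF M] by (rule closedin_compact_space)
  moreover have "\<forall>U\<in>(\<lambda>g. {q \<in> types G \<B>. g <# N \<in> q}) ` carrier G. openin ?X U"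
    using openin_basic l_coset_in[OF _ N] by auto
  moreover have "M \<subseteq> \<Union>((\<lambda>g. {q \<in> types G \<B>. g <# N \<in> q}) ` carrier G)" using cov MT by blast
  ultimately obtain \<F> where F: "finite \<F>" "\<F> \<subseteq> (\<lambda>g. {q \<in> types G \<B>. g <# N \<in> q}) ` carrier G" "M \<subseteq> \<Union>\<F>"
    unfolding compactin_def by meson
  from finite_subset_image[OF F(1,2)]
  obtain K where K: "K \<subseteq> carrier G" "finite K" "\<F> = (\<lambda>g. {q \<in> types G \<B>. g <# N \<in> q}) ` K"
    by (elim exE conjE)
  have "\<forall>q\<in>M. \<exists>g\<in>K. g <# N \<in> q" using F(3) unfolding K(3) by blast
  then show ?thesis using K(1,2) by (intro exI[of _ K] conjI)
qed

text \<open>\<open>x \<in> type_d G q A\<close> means \<open>inv x <# A \<in> q\<close>, so the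
  condition says that \<open>q\<close> contains an atom of finitely many translates.\<close>

lemma agree_clopen:
  assumes A: "A \<in> \<B>" and F: "finite F" "F \<subseteq> carrier G"
  shows "\<exists>N\<in>\<B>. \<forall>q\<in>types G \<B>. N \<in> q \<longleftrightarrow> (\<forall>x\<in>F. x \<in> type_d G q A \<longleftrightarrow> x \<in> E)"
proof
  let ?N = "{z \<in> carrier G. \<forall>x\<in>F. z \<in> inv x <# A \<longleftrightarrow> x \<in> E}"
  show NB: "?N \<in> \<B>" by (rule atom_in) (use F A l_coset_in in auto)
  show "\<forall>q\<in>types G \<B>. ?N \<in> q \<longleftrightarrow> (\<forall>x\<in>F. x \<in> type_d G q A \<longleftrightarrow> x \<in> E)"
  proof
    fix q assume q: "q \<in> types G \<B>"
    let ?H = "insert ?N ((\<lambda>x. inv x <# A) ` F)"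
    have H: "finite ?H" "?H \<subseteq> \<B>" using NB F A l_coset_in by auto
    from types_realize[OF q H] obtain z where z: "z \<in> carrier G" "\<forall>E\<in>?H. z \<in> E \<longleftrightarrow> E \<in> q"
      by (elim bexE)
    have "z \<in> inv x <# A \<longleftrightarrow> x \<in> type_d G q A" if "x \<in> F" for x
    proof -
      have "x \<in> carrier G" using F that by blast
      then show ?thesis using bspec[OF z(2), of "inv x <# A"] that by (simp add: type_d_def)
    qed
    then have "z \<in> ?N \<longleftrightarrow> (\<forall>x\<in>F. x \<in> type_d G q A \<longleftrightarrow> x \<in> E)" using z(1) by auto
    then show "?N \<in> q \<longleftrightarrow> (\<forall>x\<in>F. x \<in> type_d G q A \<longleftrightarrow> x \<in> E)" using bspec[OF z(2), of ?N] by simp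
  qed
qed

text \<open>
  If no trace \<open>d p\<close> is isolated in a closed set of types, then a binary tree of types splits
  at countably many points \<open>Y\<close>, so that the traces of the branches on \<open>Y\<close> are uncountably many,
  whereas stability leaves only countably many.
\<close>
lemma isolated_type_d:
  assumes cl: "closedin (type_space G \<B>) M" and ne: "M \<noteq> {}"
    and A: "A \<in> \<B>" "wstable G A"
  shows "\<exists>p\<in>M. \<exists>F. finite F \<and> F \<subseteq> carrier G \<and>
    (\<forall>q\<in>M. (\<forall>x\<in>F. x \<in> type_d G q A \<longleftrightarrow> x \<in> type_d G p A) \<longrightarrow> type_d G q A = type_d G p A)"
proof (rule ccontr)
  assume neg: "\<not> ?thesis"
  define d where "d q = type_d G q A" for q
  have MT: "M \<subseteq> types G \<B>" using closedin_subset[OF cl] by simp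
  define agree where "agree F p q \<longleftrightarrow> (\<forall>x\<in>F. x \<in> d q \<longleftrightarrow> x \<in> d p)" for F p q
  have split: "\<exists>qx. fst qx \<in> M \<and> agree F p (fst qx) \<and> snd qx \<in> carrier G \<and> (snd qx \<in> d (fst qx) \<longleftrightarrow> snd qx \<notin> d p)"
    if pF: "p \<in> M" "finite F" "F \<subseteq> carrier G" for p F
  proof -
    have "\<not> (\<forall>q\<in>M. (\<forall>x\<in>F. x \<in> type_d G q A \<longleftrightarrow> x \<in> type_d G p A) \<longrightarrow> type_d G q A = type_d G p A)"
    proof
      assume *: "\<forall>q\<in>M. (\<forall>x\<in>F. x \<in> type_d G q A \<longleftrightarrow> x \<in> type_d G p A) \<longrightarrow> type_d G q A = type_d G p A"
      show False by (rule notE[OF neg], rule bexI[OF exI[of _ F] pF(1)], intro conjI) (fact pF(2) pF(3) *)+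
    qed
    then have "\<exists>q\<in>M. agree F p q \<and> d q \<noteq> d p" by (simp add: agree_def d_def)
    then obtain q where q: "q \<in> M" "agree F p q" "d q \<noteq> d p" by (elim bexE conjE)
    then obtain x where x: "x \<in> d q \<longleftrightarrow> x \<notin> d p" by blast
    then have "x \<in> carrier G" using type_d_subset unfolding d_def by blast
    then show ?thesis using q x by (intro exI[of _ "(q, x)"]) simp
  qed
  \<comment> \<open>A node \<open>u\<close> is a type together with the finite set of points at
    which its trace is already fixed; \<open>ch u\<close> is a second type agreeing there, with a
    new point that tells the two apart.\<close>
  define ch where "ch u = (SOME qx. fst qx \<in> M \<and> agree (snd u) (fst u) (fst qx) \<and> snd qx \<in> carrier G \<and>
      (snd qx \<in> d (fst qx) \<longleftrightarrow> snd qx \<notin> d (fst u)))" for u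
  define good where "good u \<longleftrightarrow> fst u \<in> M \<and> finite (snd u) \<and> snd u \<subseteq> carrier G" for u
  have ch: "fst (ch u) \<in> M" "agree (snd u) (fst u) (fst (ch u))" "snd (ch u) \<in> carrier G"
    "snd (ch u) \<in> d (fst (ch u)) \<longleftrightarrow> snd (ch u) \<notin> d (fst u)" if "good u" for u
    using someI_ex[OF split[of "fst u" "snd u"]] that unfolding good_def ch_def by auto
  \<comment> \<open>Each child keeps the type of its parent or takes the second one, whichever has
    trace value \<open>b\<close> at the new point.\<close>
  define child where "child b u = (if (snd (ch u) \<in> d (fst u)) = b then fst u else fst (ch u), insert (snd (ch u)) (snd u))" for b u
  have child: "good (child b u)" "agree (snd u) (fst u) (fst (child b u))"
    "snd (ch u) \<in> d (fst (child b u)) \<longleftrightarrow> b" "snd (child b u) = insert (snd (ch u)) (snd u)" if "good u" for b u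
    using ch[OF that] that by (auto simp: good_def child_def agree_def)
  obtain p0 where p0: "p0 \<in> M" using ne by blast
  define node where "node = rec_list (p0, {}) (\<lambda>b _ u. child b u)"
  have node: "node [] = (p0, {})" "node (b # s) = child b (node s)" for b s
    by (simp_all add: node_def)
  have gn: "good (node s)" for s
    by (induction s) (use p0 child(1) in \<open>auto simp: node good_def\<close>)
  define Y where "Y = range (\<lambda>s. snd (ch (node s)))"
  have cY: "countable Y" unfolding Y_def by simp
  have Yc: "Y \<subseteq> carrier G" using ch(3)[OF gn] by (auto simp: Y_def)
  \<comment> \<open>The list is reversed because \<open>node\<close> grows at the head: the newest
    bit comes first.\<close>
  define path where "path \<beta> n = rev (map \<beta> [0..<n])" for \<beta> :: "nat \<Rightarrow> bool" and n
  have path: "path \<beta> (Suc n) = \<beta> n # path \<beta> n" for \<beta> n by (simp add: path_def)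
  define C where "C \<beta> n = {q \<in> M. agree (snd (node (path \<beta> n))) (fst (node (path \<beta> n))) q}" for \<beta> n
  have lim: "\<exists>p\<in>M. \<forall>n. agree (snd (node (path \<beta> n))) (fst (node (path \<beta> n))) p" for \<beta>
  proof -
    have "(\<Inter>n. C \<beta> n) \<noteq> {}"
    proof (rule compact_space_imp_nest[OF compact_types])
      fix n
      let ?u = "node (path \<beta> n)"
      have fin: "finite (snd ?u)" "snd ?u \<subseteq> carrier G" using gn[of "path \<beta> n"] by (simp_all add: good_def)
      from agree_clopen[OF A(1) fin, of "d (fst ?u)"] obtain N
        where N: "N \<in> \<B>" "\<forall>q\<in>types G \<B>. N \<in> q \<longleftrightarrow> (\<forall>x\<in>snd ?u. x \<in> type_d G q A \<longleftrightarrow> x \<in> d (fst ?u))"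
        by (elim bexE)
      have "C \<beta> n = M \<inter> {q \<in> types G \<B>. N \<in> q}"
        using MT N(2) by (auto simp: C_def agree_def d_def)
      then show "closedin (type_space G \<B>) (C \<beta> n)" using cl closedin_basic[OF N(1)] by (simp add: closedin_Int)
      have "fst ?u \<in> C \<beta> n" using gn[of "path \<beta> n"] by (simp add: C_def good_def agree_def)
      then show "C \<beta> n \<noteq> {}" by blast
    next
      show "decseq (C \<beta>)"
      proof (rule decseq_SucI)
        fix n
        show "C \<beta> (Suc n) \<subseteq> C \<beta> n"
          using child(2,4)[OF gn[of "path \<beta> n"]] by (auto simp: C_def path node agree_def)
      qed
    qed
    then obtain p where "\<forall>n. p \<in> C \<beta> n" by blast
    then show ?thesis by (auto simp: C_def)
  qed
  define br where "br \<beta> = (SOME p. p \<in> M \<and> (\<forall>n. agree (snd (node (path \<beta> n))) (fst (node (path \<beta> n))) p))" for \<beta>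
  have br: "br \<beta> \<in> M" "agree (snd (node (path \<beta> n))) (fst (node (path \<beta> n))) (br \<beta>)" for \<beta> n
    using someI_ex[of "\<lambda>p. p \<in> M \<and> (\<forall>n. agree (snd (node (path \<beta> n))) (fst (node (path \<beta> n))) p)"] lim[of \<beta>]
    unfolding br_def by (simp_all add: Bex_def)
  have val: "snd (ch (node (path \<beta> n))) \<in> d (br \<beta>) \<longleftrightarrow> \<beta> n" for \<beta> n
  proof -
    have "snd (ch (node (path \<beta> n))) \<in> snd (node (path \<beta> (Suc n)))"
      using child(4)[OF gn[of "path \<beta> n"]] by (simp add: path node)
    then have "snd (ch (node (path \<beta> n))) \<in> d (br \<beta>) \<longleftrightarrow> snd (ch (node (path \<beta> n))) \<in> d (fst (node (path \<beta> (Suc n))))"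
      using br(2)[of \<beta> "Suc n"] by (simp add: agree_def)
    also have "\<dots> \<longleftrightarrow> \<beta> n" using child(3)[OF gn[of "path \<beta> n"]] by (simp add: path node)
    finally show ?thesis .
  qed
  \<comment> \<open>The first bit at which two branches differ can be read off at the splitting
    point of their last common node, a point of \<open>Y\<close>.\<close>
  have "inj (\<lambda>\<beta>. d (br \<beta>) \<inter> Y)"
  proof (rule injI)
    fix \<beta> \<gamma> assume eq: "d (br \<beta>) \<inter> Y = d (br \<gamma>) \<inter> Y"
    have "path \<beta> n = path \<gamma> n" for n
    proof (induction n)
      case (Suc n)
      have "snd (ch (node (path \<beta> n))) \<in> Y" by (auto simp: Y_def)
      then have "\<beta> n = \<gamma> n" using val[of \<beta> n] val[of \<gamma> n] Suc.IH eq by auto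
      then show ?case using Suc.IH by (simp add: path)
    qed (simp add: path_def)
    then have "\<beta> n = \<gamma> n" for n using path[of \<beta> n] path[of \<gamma> n] by simp
    then show "\<beta> = \<gamma>" by blast
  qed
  moreover have "countable (range (\<lambda>\<beta>. d (br \<beta>) \<inter> Y))"
  proof (rule countable_subset)
    have "ladder_free (\<lambda>g x. x \<otimes> g \<in> A) (carrier G) (carrier G)"
      using A(2) ladder_free_converse[of "\<lambda>x y. x \<otimes> y \<in> A" "carrier G" "carrier G"] by (simp add: wstable_def)
    then have "ladder_free (\<lambda>g x. x \<otimes> g \<in> A) (carrier G) Y"
      by (rule ladder_free_mono) (use Yc in auto)
    then show "countable {D. D \<subseteq> Y \<and> (\<forall>F. finite F \<longrightarrow> F \<subseteq> Y \<longrightarrow> (\<exists>g\<in>carrier G. \<forall>x\<in>F. x \<otimes> g \<in> A \<longleftrightarrow> x \<in> D))}"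
      using cY by (rule ladder_free_countable_closure)
    show "range (\<lambda>\<beta>. d (br \<beta>) \<inter> Y) \<subseteq>
      {D. D \<subseteq> Y \<and> (\<forall>F. finite F \<longrightarrow> F \<subseteq> Y \<longrightarrow> (\<exists>g\<in>carrier G. \<forall>x\<in>F. x \<otimes> g \<in> A \<longleftrightarrow> x \<in> D))}"
    proof (intro image_subsetI CollectI conjI allI impI)
      fix \<beta> F assume F: "finite F" "F \<subseteq> Y"
      have "br \<beta> \<in> types G \<B>" using br(1) MT by blast
      from type_d_closure[OF this A(1) F(1)] F(2) Yc
      obtain g where "g \<in> carrier G" "\<forall>x\<in>F. x \<otimes> g \<in> A \<longleftrightarrow> x \<in> d (br \<beta>)" unfolding d_def by blast
      then show "\<exists>g\<in>carrier G. \<forall>x\<in>F. x \<otimes> g \<in> A \<longleftrightarrow> x \<in> d (br \<beta>) \<inter> Y" using F(2) by blast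
    qed simp
  qed
  ultimately have "countable (UNIV :: (nat \<Rightarrow> bool) set)" using countable_image_inj_on by blast
  then show False using uncountable_nat_bool by blast
qed

text \<open>One isolated trace suffices: agreement with it on \<open>F\<close> is a clopen condition
  \<open>N\<close>, and finitely many translates of \<open>N\<close> cover \<open>M\<close>. So
  every \<open>q\<close> in \<open>M\<close> has a translate with the trace of \<open>p\<close>, and
  moving back only right-translates that trace by one of finitely many elements.\<close>

lemma finite_type_d:
  assumes M: "minimal_subflow G (type_space G \<B>) (type_action G \<B>) M"
    and A: "A \<in> \<B>" "wstable G A"
  shows "finite ((\<lambda>p. type_d G p A) ` M)"
proof -
  have MT: "M \<subseteq> types G \<B>" using M by (rule minimal_subflow_subset)
  from isolated_type_d[OF minimal_subflowD(2)[OF M] minimal_subflowD(1)[OF M] A]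
  obtain p F where p: "p \<in> M" and F: "finite F" "F \<subseteq> carrier G"
    and iso: "\<forall>q\<in>M. (\<forall>x\<in>F. x \<in> type_d G q A \<longleftrightarrow> x \<in> type_d G p A) \<longrightarrow> type_d G q A = type_d G p A"
    by (elim bexE exE conjE)
  from agree_clopen[OF A(1) F, of "type_d G p A"] obtain N where N: "N \<in> \<B>"
    "\<forall>q\<in>types G \<B>. N \<in> q \<longleftrightarrow> (\<forall>x\<in>F. x \<in> type_d G q A \<longleftrightarrow> x \<in> type_d G p A)" by (elim bexE)
  have "N \<in> p" using N(2) p MT by blast
  from minimal_subflow_cover[OF M N(1) p this]
  obtain K where K: "finite K" "K \<subseteq> carrier G" "\<forall>q\<in>M. \<exists>g\<in>K. g <# N \<in> q" by (elim exE conjE)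
  have "(\<lambda>q. type_d G q A) ` M \<subseteq> (\<lambda>g. type_d G p A #> inv g) ` K"
  proof (rule image_subsetI)
    fix q assume q: "q \<in> M"
    then obtain g where g: "g \<in> K" "g <# N \<in> q" using K by blast
    have gc: "g \<in> carrier G" "inv g \<in> carrier G" using g K by auto
    have qt: "q \<in> types G \<B>" using q MT by blast
    let ?q = "type_action G \<B> (inv g) q"
    have "?q \<in> M" "?q \<in> types G \<B>" using minimal_subflowD(3)[OF M gc(2) q] MT by auto
    moreover have "N \<in> ?q" using g N(1) qt gc by (simp add: mem_type_action)
    ultimately have "type_d G ?q A = type_d G p A" using iso N(2) by blast
    then have "type_d G q A #> g = type_d G p A" using type_d_type_action[OF qt A(1) gc(2)] gc by simp
    then have "type_d G q A = type_d G p A #> inv g"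
      using gc type_d_subset[of q A] by (metis coset_mult_assoc coset_mult_one r_inv)
    then show "type_d G q A \<in> (\<lambda>g. type_d G p A #> inv g) ` K" using g(1) by blast
  qed
  moreover have "finite ((\<lambda>g. type_d G p A #> inv g) ` K)" using K(1) by simp
  ultimately show ?thesis by (rule finite_subset)
qed

lemma finite_type_d_r_cosets:
  assumes M: "minimal_subflow G (type_space G \<B>) (type_action G \<B>) M" "p \<in> M"
    and A: "A \<in> \<B>" "wstable G A"
  shows "finite ((\<lambda>g. type_d G p A #> g) ` carrier G)"
proof -
  have "(\<lambda>g. type_d G p A #> g) ` carrier G \<subseteq> (\<lambda>p. type_d G p A) ` M"
  proof (rule image_subsetI)
    fix g assume g: "g \<in> carrier G"
    have "p \<in> types G \<B>" using M minimal_subflow_subset by blast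
    then have "type_d G p A #> g = type_d G (type_action G \<B> (inv g) p) A"
      using type_d_type_action[of p A "inv g"] A g by simp
    then show "type_d G p A #> g \<in> (\<lambda>p. type_d G p A) ` M"
      using minimal_subflowD(3)[OF M(1) _ M(2), of "inv g"] g by simp
  qed
  then show ?thesis using finite_type_d[OF M(1) A] by (rule finite_subset)
qed

end

section \<open>An ultrafilter whose limit sets have finite left orbits\<close>

context group
begin

lemma invariant_algebra_Pow: "invariant_algebra G (Pow (carrier G))"
proof -
  interpret Sigma_Algebra.algebra "carrier G" "Pow (carrier G)" by (rule algebra_Pow)
  show ?thesis by unfold_locales (auto simp: left_invariant_def l_coset_def)
qed

lemma mem_m_inv_image: "A \<subseteq> carrier G \<Longrightarrow> x \<in> carrier G \<Longrightarrow> x \<in> m_inv G ` A \<longleftrightarrow> inv x \<in> A"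
proof
  assume A: "A \<subseteq> carrier G" "x \<in> m_inv G ` A"
  then obtain a where "a \<in> A" "x = inv a" by blast
  then show "inv x \<in> A" using A(1) by (auto simp: subset_iff)
next
  assume "x \<in> carrier G" "inv x \<in> A"
  then show "x \<in> m_inv G ` A" using imageI[of "inv x" A "m_inv G"] by simp
qed

text \<open>Obtained from a minimal subflow of the space of ultrafilters by inversion, which exchanges left and right.\<close>
lemma almost_periodic_type:
  "\<exists>U\<in>types G (Pow (carrier G)). \<forall>A. wstable G A \<longrightarrow> finite ((\<lambda>g. g <# type_e G U A) ` carrier G)"
proof -
  let ?P = "Pow (carrier G)"
  interpret P: invariant_algebra G ?P by (rule invariant_algebra_Pow)
  have "subflow G (type_space G ?P) (type_action G ?P) (types G ?P)"
    using P.types_point[OF one_closed] closedin_topspace[of "type_space G ?P"] P.type_action_closed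
    by (auto simp: P.subflow_types_iff)
  from minimal_subflow_exists[OF P.compact_types this]
  obtain M where M: "minimal_subflow G (type_space G ?P) (type_action G ?P) M" by (elim exE conjE)
  then obtain p where p: "p \<in> M" using P.minimal_subflowD(1) by blast
  then have pt: "p \<in> types G ?P" using M P.minimal_subflow_subset by blast
  define U where "U = {Z \<in> ?P. m_inv G ` Z \<in> p}"
  have invP: "m_inv G ` Z \<in> ?P" if "Z \<in> ?P" for Z using that by auto
  have U: "U \<in> types G ?P"
  proof (rule P.typesI)
    show "carrier G - Z \<in> U \<longleftrightarrow> Z \<notin> U" if Z: "Z \<in> ?P" for Z
    proof -
      have "m_inv G ` (carrier G - Z) = carrier G - m_inv G ` Z"
      proof -
        have "x \<in> m_inv G ` (carrier G - Z) \<longleftrightarrow> x \<in> carrier G - m_inv G ` Z" for x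
          using Z mem_m_inv_image[of Z x] mem_m_inv_image[of "carrier G - Z" x] by (cases "x \<in> carrier G") auto
        then show ?thesis by blast
      qed
      then show ?thesis using Z invP[OF Z] P.types_compl[OF pt] by (auto simp: U_def)
    qed
    have "m_inv G ` carrier G = carrier G" using mem_m_inv_image[of "carrier G"] by auto
    then show "carrier G \<in> U" using P.types_carrier[OF pt] by (simp add: U_def)
    show "Z \<inter> W \<in> U" if "Z \<in> U" "W \<in> U" for Z W
    proof -
      have ZW: "Z \<in> ?P" "W \<in> ?P" "m_inv G ` Z \<in> p" "m_inv G ` W \<in> p" using that by (auto simp: U_def)
      have "m_inv G ` (Z \<inter> W) = m_inv G ` Z \<inter> m_inv G ` W"
        using ZW by (intro inj_on_image_Int[where C = "carrier G"] inj_on_inverseI[of _ "m_inv G"]) auto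
      then show ?thesis using ZW P.types_Int[OF pt invP invP] by (auto simp: U_def)
    qed
  qed (auto simp: U_def)
  have "finite ((\<lambda>g. g <# type_e G U A) ` carrier G)" if A: "wstable G A" for A
  proof -
    let ?A = "m_inv G ` A"
    have Ac: "A \<subseteq> carrier G" using A by (rule wstable_subset)
    have A': "wstable G ?A" "?A \<in> ?P" using wstable_m_inv_image[OF A] Ac by auto
    have coset: "m_inv G ` (A #> g) = inv g <# ?A" if g: "g \<in> carrier G" for g
    proof -
      have "x \<in> m_inv G ` (A #> g) \<longleftrightarrow> x \<in> inv g <# ?A" for x
      proof (cases "x \<in> carrier G")
        case True
        have "A #> g \<subseteq> carrier G" "?A \<subseteq> carrier G" using Ac g r_coset_subset_G by auto
        then show ?thesis using True g Ac mem_m_inv_image[of "A #> g" x] mem_m_inv_image[of A "g \<otimes> x"]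
          by (simp add: mem_r_coset_iff mem_l_coset_iff inv_mult_group)
      next
        case False
        moreover have "A #> g \<subseteq> carrier G" "?A \<subseteq> carrier G" using Ac g r_coset_subset_G by auto
        ultimately show ?thesis using g by (auto simp: mem_l_coset_iff)
      qed
      then show ?thesis by blast
    qed
    \<comment> \<open>Inversion turns \<open>type_e\<close> of \<open>A\<close> into
      \<open>type_d\<close> of the set of inverses, so the finite right orbit that minimality gives
      for the latter becomes a finite left orbit.\<close>
    have e: "y \<in> type_e G U A \<longleftrightarrow> inv y \<in> type_d G p ?A" if y: "y \<in> carrier G" for y
    proof -
      have "A #> inv y \<in> ?P" using Ac y r_coset_subset_G by simp
      then show ?thesis using y coset[of "inv y"] by (simp add: type_e_def type_d_def U_def)
    qed
    have "(\<lambda>g. g <# type_e G U A) ` carrier G \<subseteq> (\<lambda>E. {y \<in> carrier G. inv y \<in> E}) ` ((\<lambda>g. type_d G p ?A #> g) ` carrier G)"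
    proof (rule image_subsetI)
      fix g assume g: "g \<in> carrier G"
      have "y \<in> g <# type_e G U A \<longleftrightarrow> y \<in> {y \<in> carrier G. inv y \<in> type_d G p ?A #> inv g}" for y
      proof (cases "y \<in> carrier G")
        case True
        then show ?thesis using g e[of "inv g \<otimes> y"] P.type_d_subset[of p ?A] P.type_e_subset[of U A]
          by (simp add: mem_l_coset_iff mem_r_coset_iff inv_mult_group)
      next
        case False
        then show ?thesis using g P.type_e_subset[of U A] by (simp add: mem_l_coset_iff)
      qed
      then have "g <# type_e G U A = {y \<in> carrier G. inv y \<in> type_d G p ?A #> inv g}" by blast
      then show "g <# type_e G U A \<in> (\<lambda>E. {y \<in> carrier G. inv y \<in> E}) ` ((\<lambda>g. type_d G p ?A #> g) ` carrier G)"
        using g by blast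
    qed
    moreover have "finite ((\<lambda>g. type_d G p ?A #> g) ` carrier G)"
      by (rule P.finite_type_d_r_cosets[OF M p A'(2,1)])
    ultimately show ?thesis by (rule finite_subset[OF _ finite_imageI])
  qed
  then show ?thesis using U by blast
qed

end

section \<open>Uniqueness of the minimal subflow\<close>

locale stable_algebra = invariant_algebra +
  assumes stable: "A \<in> \<B> \<Longrightarrow> wstable G A"
begin

lemma minimal_subflow_unique:
  assumes M: "minimal_subflow G (type_space G \<B>) (type_action G \<B>) M"
    and M': "minimal_subflow G (type_space G \<B>) (type_action G \<B>) M'"
  shows "M = M'"
proof (rule ccontr)
  assume neq: "M \<noteq> M'"
  let ?X = "type_space G \<B>" and ?P = "Pow (carrier G)"
  interpret P: invariant_algebra G ?P by (rule invariant_algebra_Pow)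
  have MT: "M \<subseteq> types G \<B>" "M' \<subseteq> types G \<B>" using M M' minimal_subflow_subset by auto
  have "M \<inter> M' = {}"
  proof (rule ccontr)
    assume "M \<inter> M' \<noteq> {}"
    then have "subflow G ?X (type_action G \<B>) (M \<inter> M')"
      using minimal_subflowD(2,3)[OF M] minimal_subflowD(2,3)[OF M'] by (auto simp: subflow_types_iff closedin_Int)
    then have "M \<inter> M' = M" "M \<inter> M' = M'" using minimal_subflowD(4)[OF M] minimal_subflowD(4)[OF M'] by auto
    then show False using neq by simp
  qed
  obtain p q where p: "p \<in> M" and q: "q \<in> M'" using minimal_subflowD(1) M M' by blast
  have pq: "p \<in> types G \<B>" "q \<in> types G \<B>" using p q MT by auto
  txt \<open>By compactness some \<open>A\<close> contains every translate of \<open>q\<close> but none of \<open>p\<close>.\<close>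
  have "\<exists>A\<in>\<B>. (\<forall>r\<in>M. A \<notin> r) \<and> (\<forall>r\<in>M'. A \<in> r)"
  proof -
    define \<U> where "\<U> = {{r \<in> types G \<B>. A \<in> r} |A. A \<in> \<B> \<and> (\<forall>r\<in>M. A \<notin> r)}"
    have "M' \<subseteq> \<Union>\<U>"
    proof
      fix r assume r: "r \<in> M'"
      then have "r \<in> types G \<B>" "r \<notin> M" using MT \<open>M \<inter> M' = {}\<close> by auto
      then obtain A where "A \<in> r" "A \<in> \<B>" "\<And>s. s \<in> M \<Longrightarrow> A \<notin> s"
        using closedin_types_separate[OF minimal_subflowD(2)[OF M]] by metis
      then show "r \<in> \<Union>\<U>" using \<open>r \<in> types G \<B>\<close> unfolding \<U>_def by blast
    qed
    moreover have "compactin ?X M'" using compact_types minimal_subflowD(2)[OF M'] by (rule closedin_compact_space)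
    moreover have "\<forall>V\<in>\<U>. openin ?X V" using openin_basic by (auto simp: \<U>_def)
    ultimately obtain \<F> where F: "finite \<F>" "\<F> \<subseteq> \<U>" "M' \<subseteq> \<Union>\<F>" unfolding compactin_def by meson
    from F(2) have F2: "\<F> \<subseteq> (\<lambda>A. {r \<in> types G \<B>. A \<in> r}) ` {A \<in> \<B>. \<forall>r\<in>M. A \<notin> r}" unfolding \<U>_def by blast
    from finite_subset_image[OF F(1) F2]
    obtain K where K: "K \<subseteq> {A \<in> \<B>. \<forall>r\<in>M. A \<notin> r}" "finite K" "\<F> = (\<lambda>A. {r \<in> types G \<B>. A \<in> r}) ` K"
      by (elim exE conjE)
    have KB: "K \<subseteq> \<B>" using K by blast
    then have UB: "\<Union>K \<in> \<B>" using K(2) by (rule finite_Union[rotated])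
    have "\<Union>K \<in> r" if "r \<in> M'" for r
    proof -
      have "r \<in> \<Union>\<F>" using F(3) that by blast
      then obtain A where "A \<in> K" "A \<in> r" "r \<in> types G \<B>" unfolding K(3) by blast
      then show ?thesis using types_mono[of r A "\<Union>K"] UB by blast
    qed
    moreover have "\<Union>K \<notin> r" if r: "r \<in> M" for r
    proof
      assume "\<Union>K \<in> r"
      have rt: "r \<in> types G \<B>" using r MT by blast
      have H: "finite (insert (\<Union>K) K)" "insert (\<Union>K) K \<subseteq> \<B>" using KB K(2) UB by auto
      from types_realize[OF rt H] obtain g where g: "\<forall>A\<in>insert (\<Union>K) K. g \<in> A \<longleftrightarrow> A \<in> r"
        by (elim bexE)
      have "g \<in> \<Union>K" using bspec[OF g insertI1] \<open>\<Union>K \<in> r\<close> by (rule iffD2)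
      then obtain A where "A \<in> K" "g \<in> A" by (elim UnionE)
      then show False using g K(1) r by auto
    qed
    ultimately show ?thesis using UB by blast
  qed
  then obtain A where A: "A \<in> \<B>" "\<And>r. r \<in> M \<Longrightarrow> A \<notin> r" "\<And>r. r \<in> M' \<Longrightarrow> A \<in> r" by blast
  have As: "wstable G A" "A \<subseteq> carrier G" using stable A(1) in_carrier by auto
  obtain U where U: "U \<in> types G ?P" "finite ((\<lambda>g. g <# type_e G U A) ` carrier G)"
    using almost_periodic_type As(1) by blast
  let ?D = "type_e G U A"
  have ArP: "A #> g \<in> ?P" if "g \<in> carrier G" for g using As that r_coset_subset_G by simp
  have DB: "?D \<in> \<B>"
    by (rule P.type_e_in[OF U(1) As(1) ArP algebra_axioms]) (use A(1) l_coset_in in auto)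
  \<comment> \<open>All translates of \<open>r\<close> miss \<open>A\<close>, so
    \<open>type_d G r A\<close> is empty and by exchange \<open>?D\<close> is not in
    \<open>r\<close>. For types in \<open>M'\<close> the trace is the whole group and
    \<open>?D\<close> belongs to them.\<close>
  have Dp: "?D \<notin> r" if r: "r \<in> M" for r
  proof -
    have rt: "r \<in> types G \<B>" using r MT by blast
    have "A \<notin> type_action G \<B> g r" if "g \<in> carrier G" for g using minimal_subflowD(3)[OF M that r] A(2) by blast
    then have "inv g <# A \<notin> r" if "g \<in> carrier G" for g using that A(1) rt by (auto simp: mem_type_action)
    then have "type_d G r A = {}" by (auto simp: type_d_def)
    then have "type_d G r A \<notin> U" using P.types_not_empty[OF U(1)] by simp
    then show ?thesis
      using exchange[OF invariant_algebra_axioms P.invariant_algebra_axioms As(1) A(1) ArP U(1) rt] by simp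
  qed
  have Dq: "?D \<in> r" if r: "r \<in> M'" for r
  proof -
    have rt: "r \<in> types G \<B>" using r MT by blast
    have "A \<in> type_action G \<B> g r" if "g \<in> carrier G" for g using minimal_subflowD(3)[OF M' that r] A(3) by blast
    then have "inv g <# A \<in> r" if "g \<in> carrier G" for g using that A(1) rt by (auto simp: mem_type_action)
    then have "type_d G r A = carrier G" by (auto simp: type_d_def)
    then have "type_d G r A \<in> U" using P.types_carrier[OF U(1)] by simp
    then show ?thesis
      using exchange[OF invariant_algebra_axioms P.invariant_algebra_axioms As(1) A(1) ArP U(1) rt] by simp
  qed
  let ?T = "(\<lambda>g. g <# ?D) ` carrier G"
  have TB: "?T \<subseteq> \<B>" using DB l_coset_in by auto
  have Tp: "E \<notin> p" if E: "E \<in> ?T" for E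
  proof -
    obtain g where g: "g \<in> carrier G" "E = g <# ?D" using E by blast
    have "?D \<notin> type_action G \<B> (inv g) p" using Dp minimal_subflowD(3)[OF M _ p] g by simp
    then show ?thesis using g DB pq by (simp add: mem_type_action)
  qed
  have Tq: "E \<in> q" if E: "E \<in> ?T" for E
  proof -
    obtain g where g: "g \<in> carrier G" "E = g <# ?D" using E by blast
    have "?D \<in> type_action G \<B> (inv g) q" using Dq minimal_subflowD(3)[OF M' _ q] g by simp
    then show ?thesis using g DB pq by (simp add: mem_type_action)
  qed
  \<comment> \<open>The orbit of \<open>?D\<close> is finite, so on all of it \<open>p\<close> and
    \<open>q\<close> are realised by elements \<open>a\<close> and \<open>b\<close>:
    \<open>a\<close> lies in no translate and \<open>b\<close> in every one. But \<open>b\<close> in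
    \<open>?D\<close> puts \<open>a\<close> in the translate by
    \<open>a \<otimes> inv b\<close>.\<close>
  from types_realize[OF pq(1) U(2) TB] obtain a where a: "a \<in> carrier G" "\<forall>E\<in>?T. a \<in> E \<longleftrightarrow> E \<in> p"
    by (elim bexE)
  from types_realize[OF pq(2) U(2) TB] obtain b where b: "b \<in> carrier G" "\<forall>E\<in>?T. b \<in> E \<longleftrightarrow> E \<in> q"
    by (elim bexE)
  have ab: "a \<otimes> inv b \<in> carrier G" using a b by simp
  have "\<one> <# ?D \<in> ?T" by (rule imageI) simp
  then have "b \<in> \<one> <# ?D" using b(2) Tq by blast
  then have "b \<in> ?D" using P.type_e_subset[of U A] by (simp add: lcos_mult_one)
  then have "a \<in> (a \<otimes> inv b) <# ?D"
    using a(1) b(1) P.type_e_subset[of U A] by (simp add: mem_l_coset_iff inv_mult_group m_assoc)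
  moreover have "(a \<otimes> inv b) <# ?D \<in> ?T" using ab by (rule imageI)
  ultimately show False using a(2) Tp by blast
qed

lemma minimal_subflow_subset_subflow:
  assumes M: "minimal_subflow G (type_space G \<B>) (type_action G \<B>) M"
    and Y: "subflow G (type_space G \<B>) (type_action G \<B>) Y"
  shows "M \<subseteq> Y"
  using minimal_subflow_exists[OF compact_types Y] minimal_subflow_unique[OF M] by blast

text \<open>If a member \<open>A\<close> of a type in \<open>M\<close> were not generic, no finitely
  many translates of it would cover the group, and the types avoiding all translates would form a
  subflow, which must contain \<open>M\<close>. Conversely a generic set has a translate in every
  type, so no generic type is separated from \<open>M\<close> by a set that the types of
  \<open>M\<close> avoid.\<close>

lemma generic_types_eq_minimal:
  assumes M: "minimal_subflow G (type_space G \<B>) (type_action G \<B>) M"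
  shows "M = generic_types G \<B>"
proof
  have MT: "M \<subseteq> types G \<B>" using M minimal_subflow_subset by auto
  show "M \<subseteq> generic_types G \<B>"
  proof
    fix p assume p: "p \<in> M"
    then have pt: "p \<in> types G \<B>" using MT by blast
    have "generic_in G A" if A: "A \<in> p" for A
    proof (rule ccontr)
      assume ng: "\<not> generic_in G A"
      have AB: "A \<in> \<B>" using types_subset[OF pt A] .
      have Ac: "A \<subseteq> carrier G" using AB by (rule in_carrier)
      define \<F> where "\<F> = (\<lambda>g. carrier G - (g <# A)) ` carrier G"
      have "\<exists>q\<in>types G \<B>. \<F> \<subseteq> q"
      proof (rule types_extend)
        show "\<F> \<subseteq> \<B>" using AB l_coset_in by (auto simp: \<F>_def)
        fix F assume F: "finite F" "F \<subseteq> \<F>"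
        from finite_subset_image[OF F[unfolded \<F>_def]]
        obtain K where K: "K \<subseteq> carrier G" "finite K" "F = (\<lambda>g. carrier G - (g <# A)) ` K"
          by (elim exE conjE)
        have "K <#> A \<subseteq> carrier G" using K(1) Ac by (rule set_mult_closed)
        then have "\<exists>x\<in>carrier G. x \<notin> K <#> A" using ng K Ac unfolding generic_in_def by blast
        then show "\<exists>x\<in>carrier G. \<forall>E\<in>F. x \<in> E" unfolding K(3) by (auto simp: set_mult_def l_coset_def)
      qed
      then obtain q where q: "q \<in> types G \<B>" "\<F> \<subseteq> q" by blast
      define Z where "Z = {r \<in> types G \<B>. \<F> \<subseteq> r}"
      have "Z = (\<Inter>E\<in>\<F>. {r \<in> types G \<B>. E \<in> r})"
        using one_closed by (auto simp: Z_def \<F>_def)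
      moreover have "\<F> \<noteq> {}" using one_closed by (auto simp: \<F>_def)
      moreover have "closedin (type_space G \<B>) {r \<in> types G \<B>. E \<in> r}" if "E \<in> \<F>" for E
        using that AB l_coset_in by (intro closedin_basic) (auto simp: \<F>_def)
      ultimately have "closedin (type_space G \<B>) Z" by (auto intro: closedin_INT)
      moreover have "type_action G \<B> g r \<in> Z" if g: "g \<in> carrier G" and r: "r \<in> Z" for g r
      proof -
        have rt: "r \<in> types G \<B>" using r by (simp add: Z_def)
        have "E \<in> type_action G \<B> g r" if E: "E \<in> \<F>" for E
        proof -
          obtain h where h: "h \<in> carrier G" "E = carrier G - (h <# A)" using E by (auto simp: \<F>_def)
          have "inv g <# E = carrier G - ((inv g \<otimes> h) <# A)"
            using g h Ac by (simp add: l_coset_compl lcos_m_assoc l_coset_subset_G)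
          then have "inv g <# E \<in> \<F>" using g h by (simp add: \<F>_def)
          then have "inv g <# E \<in> r" using r by (auto simp: Z_def)
          moreover have "E \<in> \<B>" using h AB l_coset_in by auto
          ultimately show ?thesis using rt g by (simp add: mem_type_action)
        qed
        then show ?thesis using type_action_closed[OF rt g] by (auto simp: Z_def)
      qed
      moreover have "q \<in> Z" using q by (simp add: Z_def)
      ultimately have "subflow G (type_space G \<B>) (type_action G \<B>) Z" by (auto simp: subflow_types_iff)
      then have "p \<in> Z" using minimal_subflow_subset_subflow[OF M] p by blast
      then have "carrier G - (\<one> <# A) \<in> p" by (auto simp: Z_def \<F>_def)
      then show False using A AB Ac types_compl[OF pt] by (simp add: lcos_mult_one)
    qed
    then show "p \<in> generic_types G \<B>" using pt by (simp add: generic_types_def)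
  qed
  show "generic_types G \<B> \<subseteq> M"
  proof
    fix p assume "p \<in> generic_types G \<B>"
    then have p: "p \<in> types G \<B>" "\<And>A. A \<in> p \<Longrightarrow> generic_in G A" by (auto simp: generic_types_def)
    show "p \<in> M"
    proof (rule ccontr)
      assume "p \<notin> M"
      then obtain A where A: "A \<in> p" "A \<in> \<B>" "\<And>q. q \<in> M \<Longrightarrow> A \<notin> q"
        using closedin_types_separate[OF minimal_subflowD(2)[OF M] p(1)] by metis
      have "generic_in G A" using A(1) by (rule p(2))
      then obtain F where F: "finite F" "F \<subseteq> carrier G" "carrier G = F <#> A"
        unfolding generic_in_def by (elim exE conjE)
      obtain q where q: "q \<in> M" using minimal_subflowD(1)[OF M] by blast
      have qt: "q \<in> types G \<B>" using q MT by blast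
      have H: "finite ((\<lambda>f. f <# A) ` F)" "(\<lambda>f. f <# A) ` F \<subseteq> \<B>" using F A l_coset_in by auto
      from types_realize[OF qt H]
      obtain x where x: "x \<in> carrier G" "\<forall>E\<in>(\<lambda>f. f <# A) ` F. x \<in> E \<longleftrightarrow> E \<in> q" by (elim bexE)
      have "x \<in> F <#> A" using x(1) F(3) by simp
      then obtain f where f: "f \<in> F" "x \<in> f <# A" by (auto simp: set_mult_def l_coset_def)
      then have "f <# A \<in> q" using x(2) by blast
      moreover have fc: "f \<in> carrier G" using f(1) F(2) by blast
      ultimately have "A \<in> type_action G \<B> (inv f) q" using A(2) qt by (simp add: mem_type_action)
      moreover have "type_action G \<B> (inv f) q \<in> M" using minimal_subflowD(3)[OF M _ q] fc by auto
      ultimately show False using A(3) by blast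
    qed
  qed
qed

lemma generic_types_minimal:
  "minimal_subflow G (type_space G \<B>) (type_action G \<B>) (generic_types G \<B>)"
proof -
  have "subflow G (type_space G \<B>) (type_action G \<B>) (types G \<B>)"
    using types_point[OF one_closed] closedin_topspace[of "type_space G \<B>"] type_action_closed
    by (auto simp: subflow_types_iff)
  from minimal_subflow_exists[OF compact_types this] generic_types_eq_minimal show ?thesis by metis
qed

lemma minimal_subflow_iff_generic:
  "minimal_subflow G (type_space G \<B>) (type_action G \<B>) M \<longleftrightarrow> M = generic_types G \<B>"
  using generic_types_minimal generic_types_eq_minimal by metis

end

section \<open>The Ellis semigroup\<close>

locale stable_bialgebra = stable_algebra +
  assumes r_coset_in: "g \<in> carrier G \<Longrightarrow> A \<in> \<B> \<Longrightarrow> A #> g \<in> \<B>"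

text \<open>Types over \<C> act on types over \<B>, since \<open>type_d\<close> of a set of \<B>
  lies in \<C>. With equal algebras this is the multiplication of types; with
  \<open>sharp G \<B>\<close> for \<C> it is the action behind the Ellis semigroup.\<close>

locale stable_extension = group G + B: stable_algebra G \<B> + C: stable_bialgebra G \<C>
  for G (structure) and \<B> \<C> +
  assumes subset: "\<B> \<subseteq> \<C>"
begin

lemma type_d_in_C:
  assumes "q \<in> types G \<B>" "A \<in> \<B>" shows "type_d G q A \<in> \<C>"
proof (rule B.type_d_in[OF assms B.stable[OF assms(2)] C.algebra_axioms])
  show "A #> g \<in> \<C>" if "g \<in> carrier G" for g using C.r_coset_in[OF that] assms(2) subset by blast
qed

lemma type_e_in_B:
  assumes "r \<in> types G \<C>" "A \<in> \<B>" shows "type_e G r A \<in> \<B>"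
proof (rule C.type_e_in[OF assms(1) B.stable[OF assms(2)] _ B.algebra_axioms])
  show "A #> g \<in> \<C>" if "g \<in> carrier G" for g using C.r_coset_in[OF that] assms(2) subset by blast
  show "g <# A \<in> \<B>" if "g \<in> carrier G" for g using B.l_coset_in[OF that assms(2)] .
qed

lemma exchange_ext:
  assumes "r \<in> types G \<C>" "q \<in> types G \<B>" "A \<in> \<B>"
  shows "type_d G q A \<in> r \<longleftrightarrow> type_e G r A \<in> q"
  by (rule exchange[OF B.invariant_algebra_axioms C.invariant_algebra_axioms])
    (use assms B.stable C.r_coset_in subset in auto)

lemma mem_type_mult: "A \<in> type_mult G \<B> r q \<longleftrightarrow> A \<in> \<B> \<and> type_d G q A \<in> r"
  by (simp add: type_mult_def)

lemma type_mult_closed: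
  assumes r: "r \<in> types G \<C>" and q: "q \<in> types G \<B>"
  shows "type_mult G \<B> r q \<in> types G \<B>"
proof (rule B.typesI)
  show "carrier G - A \<in> type_mult G \<B> r q \<longleftrightarrow> A \<notin> type_mult G \<B> r q" if A: "A \<in> \<B>" for A
    using A B.compl_sets[OF A] type_d_in_C[OF q A] C.types_compl[OF r]
    by (simp add: mem_type_mult B.type_d_compl[OF q A])
  show "carrier G \<in> type_mult G \<B> r q"
    using B.carrier_in C.types_carrier[OF r] by (simp add: mem_type_mult B.type_d_carrier[OF q])
  show "A \<inter> A' \<in> type_mult G \<B> r q" if A: "A \<in> type_mult G \<B> r q" "A' \<in> type_mult G \<B> r q" for A A'
  proof -
    have AB: "A \<in> \<B>" "A' \<in> \<B>" using A by (auto simp: mem_type_mult)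
    show ?thesis using A B.Int[OF AB] C.types_Int[OF r type_d_in_C[OF q AB(1)] type_d_in_C[OF q AB(2)]]
      by (simp add: mem_type_mult B.type_d_Int[OF q AB])
  qed
qed (auto simp: mem_type_mult)

text \<open>Multiplication of types is composition of the operators \<open>type_d\<close>, from
  which associativity is immediate.\<close>

lemma type_d_mult:
  assumes q: "q \<in> types G \<B>" and A: "A \<in> \<B>"
  shows "type_d G (type_mult G \<B> r q) A = type_d G r (type_d G q A)"
proof -
  have "inv x <# A \<in> type_mult G \<B> r q \<longleftrightarrow> inv x <# type_d G q A \<in> r" if "x \<in> carrier G" for x
    using that B.l_coset_in[OF _ A, of "inv x"] B.type_d_l_coset[OF q A, of "inv x"] by (simp add: mem_type_mult)
  then show ?thesis unfolding type_d_def[of G "type_mult G \<B> r q"] type_d_def[of G r] by blast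
qed

lemma type_mult_action:
  assumes g: "g \<in> carrier G" and r: "r \<in> types G \<C>" and q: "q \<in> types G \<B>"
  shows "type_action G \<B> g (type_mult G \<B> r q) = type_mult G \<B> (type_action G \<C> g r) q"
proof -
  have "A \<in> type_action G \<B> g (type_mult G \<B> r q) \<longleftrightarrow> A \<in> type_mult G \<B> (type_action G \<C> g r) q" for A
  proof (cases "A \<in> \<B>")
    case True
    have "inv g <# A \<in> \<B>" using B.l_coset_in True g by simp
    then show ?thesis
      using True g B.type_d_l_coset[OF q True, of "inv g"] type_d_in_C[OF q True]
      by (simp add: B.mem_type_action[OF type_mult_closed[OF r q] g] mem_type_mult C.mem_type_action[OF r g])
  next
    case False
    then show ?thesis by (simp add: B.mem_type_action[OF type_mult_closed[OF r q] g] mem_type_mult)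
  qed
  then show ?thesis by blast
qed

lemma type_mult_point:
  assumes g: "g \<in> carrier G" and q: "q \<in> types G \<B>"
  shows "type_mult G \<B> {A \<in> \<C>. g \<in> A} q = type_action G \<B> g q"
proof -
  have "A \<in> type_mult G \<B> {A \<in> \<C>. g \<in> A} q \<longleftrightarrow> A \<in> type_action G \<B> g q" for A
    using g type_d_in_C[OF q] by (auto simp: mem_type_mult B.mem_type_action[OF q g] type_d_def)
  then show ?thesis by blast
qed

lemma continuous_type_mult_left:
  assumes q: "q \<in> types G \<B>"
  shows "continuous_map (type_space G \<C>) (type_space G \<B>) (\<lambda>r. type_mult G \<B> r q)"
proof (rule B.continuous_map_types)
  fix A assume A: "A \<in> \<B>"
  have "{r \<in> topspace (type_space G \<C>). A \<in> type_mult G \<B> r q} = {r \<in> types G \<C>. type_d G q A \<in> r}"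
    using A by (auto simp: mem_type_mult)
  then show "openin (type_space G \<C>) {r \<in> topspace (type_space G \<C>). A \<in> type_mult G \<B> r q}"
    using C.openin_basic[OF type_d_in_C[OF q A]] by simp
qed (use q type_mult_closed in auto)

text \<open>In the definition of the product the set \<open>type_d G q A\<close> varies with
  \<open>q\<close>; exchange replaces the condition by membership of the fixed set
  \<open>type_e G r A\<close> in \<open>q\<close>.\<close>

lemma continuous_type_mult_right:
  assumes r: "r \<in> types G \<C>"
  shows "continuous_map (type_space G \<B>) (type_space G \<B>) (\<lambda>q. type_mult G \<B> r q)"
proof (rule B.continuous_map_types)
  fix A assume A: "A \<in> \<B>"
  have "{q \<in> topspace (type_space G \<B>). A \<in> type_mult G \<B> r q} = {q \<in> types G \<B>. type_e G r A \<in> q}"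
    using A exchange_ext[OF r _ A] by (auto simp: mem_type_mult)
  then show "openin (type_space G \<B>) {q \<in> topspace (type_space G \<B>). A \<in> type_mult G \<B> r q}"
    using B.openin_basic[OF type_e_in_B[OF r A]] by simp
qed (use r type_mult_closed in auto)

end

lemma (in stable_bialgebra) stable_extension_self: "stable_extension G \<B> \<B>"
  by unfold_locales simp

lemma (in stable_extension) type_mult_assoc:
  assumes r: "r \<in> types G \<C>" and s: "s \<in> types G \<C>" and q: "q \<in> types G \<B>"
  shows "type_mult G \<B> (type_mult G \<C> r s) q = type_mult G \<B> r (type_mult G \<B> s q)"
proof -
  have "A \<in> type_mult G \<B> (type_mult G \<C> r s) q \<longleftrightarrow> A \<in> type_mult G \<B> r (type_mult G \<B> s q)" for A
  proof (cases "A \<in> \<B>")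
    case True
    have "type_d G q A \<in> \<C>" using type_d_in_C[OF q True] .
    then show ?thesis using True type_d_mult[OF q True] by (simp add: type_mult_def)
  qed (simp add: mem_type_mult)
  then show ?thesis by blast
qed

lemma (in invariant_algebra) points_dense:
  assumes Z: "closedin (type_space G \<B>) Z" and pts: "\<And>g. g \<in> carrier G \<Longrightarrow> {A \<in> \<B>. g \<in> A} \<in> Z"
  shows "types G \<B> \<subseteq> Z"
proof
  fix p assume p: "p \<in> types G \<B>"
  show "p \<in> Z"
  proof (rule ccontr)
    assume "p \<notin> Z"
    from closedin_types_separate[OF Z p this]
    obtain A where A: "A \<in> p" "A \<in> \<B>" "\<And>q. q \<in> Z \<Longrightarrow> A \<notin> q" by metis
    have "A \<noteq> {}" "A \<subseteq> carrier G" using A types_not_empty[OF p] in_carrier by auto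
    then obtain g where "g \<in> A" "g \<in> carrier G" by blast
    then show False using A(2) A(3)[OF pts[of g]] by simp
  qed
qed

lemma (in stable_bialgebra) type_G_semigroup:
  "G_semigroup G (type_space G \<B>) (type_action G \<B>) (type_mult G \<B>)"
proof -
  interpret E: stable_extension G \<B> \<B> by (rule stable_extension_self)
  show ?thesis
    unfolding G_semigroup_def topspace_types
    by (intro conjI ballI type_flow E.type_mult_closed E.type_mult_assoc E.type_mult_action)
qed

text \<open>This gives the Ellis space its flow and semigroup structure from that of the type space.
  The hypothesis \<open>ext\<close> appears because \<open>BijGroup\<close> consists of functions
  that are extensional on the space.\<close>

lemma G_semigroup_transport:
  assumes G: "group G" and X: "G_semigroup G X \<phi> m" and h: "homeomorphic_map X Y h"
    and act: "\<And>g p. g \<in> carrier G \<Longrightarrow> p \<in> topspace X \<Longrightarrow> h (\<phi> g p) = \<psi> g (h p)"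
    and mult: "\<And>p q. p \<in> topspace X \<Longrightarrow> q \<in> topspace X \<Longrightarrow> h (m p q) = n (h p) (h q)"
    and ext: "\<And>g. g \<in> carrier G \<Longrightarrow> \<psi> g \<in> extensional (topspace Y)"
  shows "G_semigroup G Y \<psi> n"
proof -
  interpret group G by (rule G)
  have flow: "G_flow G X \<phi>" using X by (simp add: G_semigroup_def)
  interpret act: group_action G "topspace X" \<phi> using flow by (simp add: G_flow_def)
  have im: "h ` topspace X = topspace Y" using h by (rule homeomorphic_imp_surjective_map)
  have inj: "inj_on h (topspace X)" using h by (rule homeomorphic_imp_injective_map)
  have cpt: "X homeomorphic_space Y" using h homeomorphic_map_imp_homeomorphic_space by blast
  have \<phi>X: "\<phi> g p \<in> topspace X" if "g \<in> carrier G" "p \<in> topspace X" for g p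
    using act.element_image[OF that] by blast
  have Y: "\<exists>p\<in>topspace X. y = h p" if "y \<in> topspace Y" for y using im that by blast
  have hY: "h p \<in> topspace Y" if "p \<in> topspace X" for p using im that by blast
  have \<psi>Y: "\<psi> g y \<in> topspace Y" if g: "g \<in> carrier G" and y: "y \<in> topspace Y" for g y
  proof -
    obtain p where p: "p \<in> topspace X" "y = h p" using Y[OF y] by blast
    then show ?thesis using act[OF g p(1)] hY[OF \<phi>X[OF g p(1)]] by simp
  qed
  have \<psi>mult: "\<psi> (a \<otimes>\<^bsub>G\<^esub> b) y = \<psi> a (\<psi> b y)" if ab: "a \<in> carrier G" "b \<in> carrier G" and y: "y \<in> topspace Y" for a b y
  proof -
    obtain p where p: "p \<in> topspace X" "y = h p" using Y[OF y] by blast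
    have "\<psi> a (\<psi> b y) = h (\<phi> a (\<phi> b p))" using act ab p \<phi>X by simp
    then show ?thesis using act[of "a \<otimes>\<^bsub>G\<^esub> b" p] act.composition_rule[OF p(1) ab] ab p by simp
  qed
  have \<psi>one: "\<psi> \<one>\<^bsub>G\<^esub> y = y" if y: "y \<in> topspace Y" for y
  proof -
    obtain p where p: "p \<in> topspace X" "y = h p" using Y[OF y] by blast
    have "\<phi> \<one>\<^bsub>G\<^esub> p = p" using act.id_eq_one p(1) by (metis restrict_apply')
    then show ?thesis using act[of "\<one>\<^bsub>G\<^esub>" p] p by simp
  qed
  have bij: "bij_betw (\<psi> g) (topspace Y) (topspace Y)" if g: "g \<in> carrier G" for g
    by (rule bij_betwI[where g = "\<psi> (inv\<^bsub>G\<^esub> g)"])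
      (use g \<psi>Y \<psi>one \<psi>mult[of g "inv\<^bsub>G\<^esub> g", symmetric] \<psi>mult[of "inv\<^bsub>G\<^esub> g" g, symmetric] in auto)
  have "group_action G (topspace Y) \<psi>"
  proof (intro group_action.intro group_hom.intro group_hom_axioms.intro)
    show "group (BijGroup (topspace Y))" by (rule group_BijGroup)
    show "\<psi> \<in> hom G (BijGroup (topspace Y))"
    proof (rule homI)
      fix a assume a: "a \<in> carrier G"
      show "\<psi> a \<in> carrier (BijGroup (topspace Y))" using ext[OF a] bij[OF a] by (simp add: BijGroup_def Bij_def)
      fix b assume b: "b \<in> carrier G"
      have "\<psi> (a \<otimes>\<^bsub>G\<^esub> b) = compose (topspace Y) (\<psi> a) (\<psi> b)"
      proof (rule extensionalityI[of _ "topspace Y"])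
        show "\<psi> (a \<otimes>\<^bsub>G\<^esub> b) \<in> extensional (topspace Y)" using ext a b by simp
        show "compose (topspace Y) (\<psi> a) (\<psi> b) \<in> extensional (topspace Y)" by simp
        show "\<psi> (a \<otimes>\<^bsub>G\<^esub> b) y = compose (topspace Y) (\<psi> a) (\<psi> b) y" if "y \<in> topspace Y" for y
          using \<psi>mult[OF a b that] that by (simp add: compose_def)
      qed
      then show "\<psi> (a \<otimes>\<^bsub>G\<^esub> b) = \<psi> a \<otimes>\<^bsub>BijGroup (topspace Y)\<^esub> \<psi> b"
        using ext[OF a] ext[OF b] bij[OF a] bij[OF b] by (simp add: BijGroup_def Bij_def)
    qed
  qed (rule is_group)
  moreover have "homeomorphic_map Y Y (\<psi> g)" if g: "g \<in> carrier G" for g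
  proof -
    obtain k where k: "homeomorphic_maps X Y h k" using h homeomorphic_map_maps by blast
    have "homeomorphic_map Y X k" using k homeomorphic_maps_map by blast
    moreover have "homeomorphic_map X X (\<phi> g)" using flow g by (simp add: G_flow_def)
    ultimately have "homeomorphic_map Y X (\<phi> g \<circ> k)" by (rule homeomorphic_map_compose)
    then have "homeomorphic_map Y Y (h \<circ> (\<phi> g \<circ> k))" using h by (rule homeomorphic_map_compose)
    moreover have "(h \<circ> (\<phi> g \<circ> k)) y = \<psi> g y" if y: "y \<in> topspace Y" for y
    proof -
      have "k y \<in> topspace X" "h (k y) = y"
        using k y unfolding homeomorphic_maps_def by (auto simp: continuous_map_def)
      then show ?thesis using act[OF g, of "k y"] by simp
    qed
    ultimately show ?thesis by (rule homeomorphic_map_eq)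
  qed
  moreover have "topspace Y \<noteq> {}" "compact_space Y" "Hausdorff_space Y"
    using flow im homeomorphic_compact_space[OF cpt] homeomorphic_Hausdorff_space[OF cpt] by (auto simp: G_flow_def)
  ultimately have "G_flow G Y \<psi>" by (simp add: G_flow_def)
  moreover have "n y z \<in> topspace Y" if yz: "y \<in> topspace Y" "z \<in> topspace Y" for y z
  proof -
    obtain p q where p: "p \<in> topspace X" "y = h p" "q \<in> topspace X" "z = h q" using Y[OF yz(1)] Y[OF yz(2)] by blast
    then show ?thesis using mult[of p q] hY[of "m p q"] X by (simp add: G_semigroup_def)
  qed
  moreover have "n (n y z) w = n y (n z w)" if yz: "y \<in> topspace Y" "z \<in> topspace Y" "w \<in> topspace Y" for y z w
  proof -
    obtain p q r where p: "p \<in> topspace X" "y = h p" "q \<in> topspace X" "z = h q" "r \<in> topspace X" "w = h r"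
      using Y[OF yz(1)] Y[OF yz(2)] Y[OF yz(3)] by blast
    have "m p q \<in> topspace X" "m q r \<in> topspace X" "m (m p q) r = m p (m q r)"
      using X p by (auto simp: G_semigroup_def)
    then show ?thesis using mult p by metis
  qed
  moreover have "\<psi> g (n y z) = n (\<psi> g y) z" if g: "g \<in> carrier G" and yz: "y \<in> topspace Y" "z \<in> topspace Y" for g y z
  proof -
    obtain p q where p: "p \<in> topspace X" "y = h p" "q \<in> topspace X" "z = h q" using Y[OF yz(1)] Y[OF yz(2)] by blast
    have "m p q \<in> topspace X" "\<phi> g (m p q) = m (\<phi> g p) q"
      using X p g by (auto simp: G_semigroup_def)
    then show ?thesis using mult act g p \<phi>X by metis
  qed
  ultimately show ?thesis by (simp add: G_semigroup_def)
qed

section \<open>Identification with the Ellis semigroup\<close>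

context stable_extension
begin

definition ellis_iso :: "'a set set \<Rightarrow> 'a set set \<Rightarrow> 'a set set" where
  "ellis_iso r = (\<lambda>q\<in>types G \<B>. type_mult G \<B> r q)"

lemma ellis_iso_continuous:
  "continuous_map (type_space G \<C>) (product_topology (\<lambda>_. type_space G \<B>) (types G \<B>)) ellis_iso"
  unfolding continuous_map_componentwise
proof (intro conjI ballI)
  show "ellis_iso ` topspace (type_space G \<C>) \<subseteq> extensional (types G \<B>)" by (auto simp: ellis_iso_def)
  show "continuous_map (type_space G \<C>) (type_space G \<B>) (\<lambda>r. ellis_iso r q)" if "q \<in> types G \<B>" for q
    using continuous_type_mult_left[OF that] that by (simp add: ellis_iso_def)
qed

text \<open>Principal types map to the maps \<open>type_action G \<B> g\<close> and are dense. The
  image is compact, hence closed, and so contains the closure of these maps; by continuity it is not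
  larger.\<close>

lemma ellis_iso_image:
  "ellis_iso ` types G \<C> = ellis_set G (type_space G \<B>) (type_action G \<B>)"
proof
  let ?P = "product_topology (\<lambda>_. type_space G \<B>) (types G \<B>)"
  have pt: "ellis_iso {A \<in> \<C>. g \<in> A} = type_action G \<B> g" if "g \<in> carrier G" for g
    using type_mult_point[OF that] by (auto simp: ellis_iso_def type_action_def fun_eq_iff)
  have sub: "type_action G \<B> ` carrier G \<subseteq> ellis_iso ` types G \<C>"
  proof (rule image_subsetI)
    fix g assume g: "g \<in> carrier G"
    show "type_action G \<B> g \<in> ellis_iso ` types G \<C>"
      using imageI[OF C.types_point[OF g], of ellis_iso] pt[OF g] by simp
  qed
  have "compactin ?P (ellis_iso ` types G \<C>)"
    using image_compactin[OF _ ellis_iso_continuous, of "types G \<C>"] C.compact_types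
    by (simp add: compact_space_def)
  moreover have "Hausdorff_space ?P" by (simp add: Hausdorff_space_product_topology B.Hausdorff_types)
  ultimately have "closedin ?P (ellis_iso ` types G \<C>)" by (rule compactin_imp_closedin[rotated])
  then show "ellis_set G (type_space G \<B>) (type_action G \<B>) \<subseteq> ellis_iso ` types G \<C>"
    unfolding ellis_set_def B.topspace_types using sub by (intro closure_of_minimal)
  define Z where "Z = {r \<in> topspace (type_space G \<C>). ellis_iso r \<in> ellis_set G (type_space G \<B>) (type_action G \<B>)}"
  have "closedin (type_space G \<C>) Z"
    unfolding Z_def by (rule closedin_continuous_map_preimage[OF ellis_iso_continuous])
      (simp add: ellis_set_def)
  moreover have "{A \<in> \<C>. g \<in> A} \<in> Z" if g: "g \<in> carrier G" for g
  proof -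
    have "type_action G \<B> g \<in> topspace ?P"
      using B.type_action_closed g by (auto simp: PiE_iff type_action_def[of G \<B>])
    moreover have "topspace ?P \<inter> type_action G \<B> ` carrier G \<subseteq> ?P closure_of (type_action G \<B> ` carrier G)"
      by (rule closure_of_subset_Int)
    ultimately have "type_action G \<B> g \<in> ellis_set G (type_space G \<B>) (type_action G \<B>)"
      unfolding ellis_set_def B.topspace_types using g by blast
    then show ?thesis using pt[OF g] C.types_point[OF g] by (simp add: Z_def)
  qed
  ultimately have "types G \<C> \<subseteq> Z" by (rule C.points_dense)
  then show "ellis_iso ` types G \<C> \<subseteq> ellis_set G (type_space G \<B>) (type_action G \<B>)" by (auto simp: Z_def)
qed

lemma topspace_ellis [simp]:
  "topspace (ellis_space G (type_space G \<B>) (type_action G \<B>)) = ellis_set G (type_space G \<B>) (type_action G \<B>)"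
  unfolding ellis_space_def ellis_set_def topspace_subtopology
  by (rule Int_absorb1) (rule closure_of_subset_topspace)

text \<open>Multiplying by the principal type at \<open>inv g\<close> tests membership of
  \<open>A #> g\<close>. Types with the same image therefore agree on all right translates of sets
  in \<B>, and \<open>gen\<close> says that these decide a type.\<close>

lemma ellis_iso_homeomorphic:
  assumes gen: "\<And>p q. p \<in> types G \<C> \<Longrightarrow> q \<in> types G \<C> \<Longrightarrow>
      (\<And>A g. A \<in> \<B> \<Longrightarrow> g \<in> carrier G \<Longrightarrow> A #> g \<in> p \<longleftrightarrow> A #> g \<in> q) \<Longrightarrow> p = q"
  shows "homeomorphic_map (type_space G \<C>) (ellis_space G (type_space G \<B>) (type_action G \<B>)) ellis_iso"
proof (rule continuous_imp_homeomorphic_map)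
  show "continuous_map (type_space G \<C>) (ellis_space G (type_space G \<B>) (type_action G \<B>)) ellis_iso"
    unfolding ellis_space_def B.topspace_types continuous_map_in_subtopology
    using ellis_iso_continuous ellis_iso_image by auto
  show "Hausdorff_space (ellis_space G (type_space G \<B>) (type_action G \<B>))"
    unfolding ellis_space_def
    by (intro Hausdorff_space_subtopology) (simp add: Hausdorff_space_product_topology B.Hausdorff_types)
  show "ellis_iso ` topspace (type_space G \<C>) = topspace (ellis_space G (type_space G \<B>) (type_action G \<B>))"
    using ellis_iso_image by simp
  show "inj_on ellis_iso (topspace (type_space G \<C>))"
  proof (rule inj_onI)
    fix p q assume pq: "p \<in> topspace (type_space G \<C>)" "q \<in> topspace (type_space G \<C>)" "ellis_iso p = ellis_iso q"
    show "p = q"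
    proof (rule gen)
      fix A g assume A: "A \<in> \<B>" and g: "g \<in> carrier G"
      let ?t = "{A \<in> \<B>. inv g \<in> A}"
      have t: "?t \<in> types G \<B>" using g by (intro B.types_point) simp
      have "type_d G ?t A = A #> g"
      proof -
        have "x \<in> type_d G ?t A \<longleftrightarrow> x \<in> A #> g" for x
          using A g B.in_carrier[OF A] B.l_coset_in[OF _ A]
          by (auto simp: type_d_def mem_l_coset_iff mem_r_coset_iff)
        then show ?thesis by blast
      qed
      moreover have "type_mult G \<B> p ?t = type_mult G \<B> q ?t"
        using fun_cong[OF pq(3), of ?t] t by (simp add: ellis_iso_def)
      then have "A \<in> type_mult G \<B> p ?t \<longleftrightarrow> A \<in> type_mult G \<B> q ?t" by simp
      ultimately show "A #> g \<in> p \<longleftrightarrow> A #> g \<in> q" using A by (simp add: mem_type_mult)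
    qed (use pq in auto)
  qed
qed (rule C.compact_types)

lemma ellis_isomorphic:
  assumes gen: "\<And>p q. p \<in> types G \<C> \<Longrightarrow> q \<in> types G \<C> \<Longrightarrow>
      (\<And>A g. A \<in> \<B> \<Longrightarrow> g \<in> carrier G \<Longrightarrow> A #> g \<in> p \<longleftrightarrow> A #> g \<in> q) \<Longrightarrow> p = q"
  shows "G_semigroup_isomorphic G (type_space G \<C>) (type_action G \<C>) (type_mult G \<C>)
       (ellis_space G (type_space G \<B>) (type_action G \<B>))
       (ellis_action G (type_space G \<B>) (type_action G \<B>))
       (compose (topspace (type_space G \<B>)))"
proof -
  interpret CC: stable_extension G \<C> \<C> by (rule C.stable_extension_self)
  have hom: "homeomorphic_map (type_space G \<C>) (ellis_space G (type_space G \<B>) (type_action G \<B>)) ellis_iso"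
    using gen by (rule ellis_iso_homeomorphic)
  have act: "ellis_iso (type_action G \<C> g p) = ellis_action G (type_space G \<B>) (type_action G \<B>) g (ellis_iso p)"
    if "g \<in> carrier G" "p \<in> topspace (type_space G \<C>)" for g p
  proof -
    have p: "p \<in> types G \<C>" using that by simp
    have "ellis_iso p \<in> ellis_set G (type_space G \<B>) (type_action G \<B>)" using ellis_iso_image p by blast
    then have "ellis_action G (type_space G \<B>) (type_action G \<B>) g (ellis_iso p) = compose (types G \<B>) (type_action G \<B> g) (ellis_iso p)"
      by (simp add: ellis_action_def)
    also have "\<dots> = ellis_iso (type_action G \<C> g p)"
      using type_mult_action[OF that(1) p] by (auto simp: ellis_iso_def compose_def fun_eq_iff)
    finally show ?thesis by simp
  qed
  have mult: "ellis_iso (type_mult G \<C> p q) = compose (topspace (type_space G \<B>)) (ellis_iso p) (ellis_iso q)"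
    if "p \<in> topspace (type_space G \<C>)" "q \<in> topspace (type_space G \<C>)" for p q
  proof -
    have pq: "p \<in> types G \<C>" "q \<in> types G \<C>" using that by auto
    show ?thesis using type_mult_assoc[OF pq] type_mult_closed[OF pq(2)]
      by (auto simp: ellis_iso_def compose_def fun_eq_iff)
  qed
  have "G_semigroup G (ellis_space G (type_space G \<B>) (type_action G \<B>))
       (ellis_action G (type_space G \<B>) (type_action G \<B>)) (compose (topspace (type_space G \<B>)))"
    by (rule G_semigroup_transport[OF is_group C.type_G_semigroup hom], rule act, assumption+, rule mult, assumption+)
      (auto simp: ellis_action_def extensional_def)
  then show ?thesis
    unfolding G_semigroup_isomorphic_def using C.type_G_semigroup hom act mult by blast
qed

end

section \<open>The generated bi-invariant algebra\<close>

context group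
begin

text \<open>The \<open>wstable\<close> sets form a bi-invariant algebra containing \<B>, so every
  set of \<open>sharp G \<B>\<close> is one of them.\<close>

lemma sharp_bialgebra:
  assumes B: "stable_algebra G \<B>"
  shows "stable_extension G \<B> (sharp G \<B>)"
proof -
  interpret B: stable_algebra G \<B> by (rule B)
  let ?\<S> = "{\<C>. Sigma_Algebra.algebra (carrier G) \<C> \<and> bi_invariant G \<C> \<and> \<B> \<subseteq> \<C>}"
  let ?W = "{A. wstable G A}"
  have emp: "wstable G {}" using wstable_compl[OF wstable_carrier] by simp
  have "?W \<subseteq> Pow (carrier G)" using wstable_subset by blast
  then have W: "?W \<in> ?\<S>"
    using emp wstable_compl wstable_inter wstable_l_coset wstable_r_coset B.stable
    by (simp add: algebra_iff_Int bi_invariant_def left_invariant_def subset_iff)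
  have S: "sharp G \<B> = \<Inter>?\<S>" by (simp add: sharp_def)
  have alg: "Sigma_Algebra.algebra (carrier G) (sharp G \<B>)"
    unfolding algebra_iff_Int
  proof (intro conjI ballI)
    show "sharp G \<B> \<subseteq> Pow (carrier G)" unfolding S using W wstable_subset by blast
    show "{} \<in> sharp G \<B>" unfolding S by (auto simp: algebra_iff_Int)
    show "carrier G - A \<in> sharp G \<B>" if "A \<in> sharp G \<B>" for A using that unfolding S by (auto simp: algebra_iff_Int)
    show "A \<inter> A' \<in> sharp G \<B>" if "A \<in> sharp G \<B>" "A' \<in> sharp G \<B>" for A A'
      using that unfolding S by (auto simp: algebra_iff_Int)
  qed
  have l: "g <# A \<in> sharp G \<B>" and r: "A #> g \<in> sharp G \<B>" if "g \<in> carrier G" "A \<in> sharp G \<B>" for g A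
    using that unfolding S by (auto simp: bi_invariant_def left_invariant_def)
  have w: "wstable G A" if "A \<in> sharp G \<B>" for A using W that unfolding S by blast
  have sub: "\<B> \<subseteq> sharp G \<B>" unfolding S by blast
  interpret C: Sigma_Algebra.algebra "carrier G" "sharp G \<B>" by (rule alg)
  show ?thesis by unfold_locales (use l r w sub in \<open>auto simp: left_invariant_def\<close>)
qed

lemma sharp_types_eqI:
  assumes B: "stable_algebra G \<B>"
    and p: "p \<in> types G (sharp G \<B>)" and q: "q \<in> types G (sharp G \<B>)"
    and eq: "\<And>A g. A \<in> \<B> \<Longrightarrow> g \<in> carrier G \<Longrightarrow> A #> g \<in> p \<longleftrightarrow> A #> g \<in> q"
  shows "p = q"
proof -
  interpret E: stable_extension G \<B> "sharp G \<B>" by (rule sharp_bialgebra[OF B])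
  let ?C = "sharp G \<B>"
  \<comment> \<open>Quantifying over two-sided translates makes \<D> bi-invariant. It contains \<B>
    because a left translate of a set of \<B> is again in \<B>, and \<open>eq\<close> covers the
    right translates of that.\<close>
  define \<D> where "\<D> = {A \<in> ?C. \<forall>g\<in>carrier G. \<forall>h\<in>carrier G. (g <# A) #> h \<in> p \<longleftrightarrow> (g <# A) #> h \<in> q}"
  have tr: "(g <# A) #> h \<in> ?C" if "g \<in> carrier G" "h \<in> carrier G" "A \<in> ?C" for g h A
    using that E.C.l_coset_in E.C.r_coset_in by blast
  have "Sigma_Algebra.algebra (carrier G) \<D>"
    unfolding algebra_iff_Int
  proof (intro conjI ballI)
    show "\<D> \<subseteq> Pow (carrier G)" using E.C.in_carrier by (auto simp: \<D>_def)
    show "{} \<in> \<D>"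
      using E.C.types_not_empty[OF p] E.C.types_not_empty[OF q] E.C.empty_sets by (auto simp: \<D>_def l_coset_def r_coset_def)
    fix A assume A: "A \<in> \<D>"
    then have AC: "A \<in> ?C" "A \<subseteq> carrier G" using E.C.in_carrier by (auto simp: \<D>_def)
    have "(g <# (carrier G - A)) #> h = carrier G - ((g <# A) #> h)" if "g \<in> carrier G" "h \<in> carrier G" for g h
      using that AC by (simp add: l_coset_compl r_coset_compl l_coset_subset_G)
    then show "carrier G - A \<in> \<D>"
      using A AC tr E.C.types_compl[OF p] E.C.types_compl[OF q] E.C.compl_sets by (auto simp: \<D>_def)
    fix A' assume A': "A' \<in> \<D>"
    then have AC': "A' \<in> ?C" "A' \<subseteq> carrier G" using E.C.in_carrier by (auto simp: \<D>_def)
    have "(g <# (A \<inter> A')) #> h = ((g <# A) #> h) \<inter> ((g <# A') #> h)" if "g \<in> carrier G" "h \<in> carrier G" for g h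
      using that AC AC' by (simp add: l_coset_Int r_coset_Int l_coset_subset_G)
    then show "A \<inter> A' \<in> \<D>"
      using A A' AC AC' tr E.C.types_Int[OF p] E.C.types_Int[OF q] E.C.Int by (auto simp: \<D>_def)
  qed
  moreover have "bi_invariant G \<D>"
    unfolding bi_invariant_def left_invariant_def
  proof (intro conjI ballI)
    fix g A assume g: "g \<in> carrier G" and A: "A \<in> \<D>"
    then have AC: "A \<in> ?C" "A \<subseteq> carrier G" using E.C.in_carrier by (auto simp: \<D>_def)
    have "(h <# (g <# A)) #> k = ((h \<otimes> g) <# A) #> k" if "h \<in> carrier G" for h k
      using that g AC by (simp add: lcos_m_assoc)
    then show "g <# A \<in> \<D>" using g A AC E.C.l_coset_in by (auto simp: \<D>_def)
    have "(h <# (A #> g)) #> k = (h <# A) #> (g \<otimes> k)" if "h \<in> carrier G" "k \<in> carrier G" for h k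
      using that g AC by (simp add: coset_assoc coset_mult_assoc l_coset_subset_G)
    then show "A #> g \<in> \<D>" using g A AC E.C.r_coset_in by (auto simp: \<D>_def)
  qed
  moreover have "\<B> \<subseteq> \<D>" using eq E.B.l_coset_in E.subset by (auto simp: \<D>_def)
  ultimately have "?C \<subseteq> \<D>" by (auto simp: sharp_def)
  have "A \<in> q" if A: "A \<in> p" for A
  proof -
    have AC: "A \<in> ?C" using E.C.types_subset[OF p A] .
    then have "(\<one> <# A) #> \<one> \<in> p \<longleftrightarrow> (\<one> <# A) #> \<one> \<in> q" using \<open>?C \<subseteq> \<D>\<close> by (auto simp: \<D>_def)
    then show ?thesis using A E.C.in_carrier[OF AC] by (simp add: lcos_mult_one)
  qed
  then show ?thesis by (rule E.C.types_eqI[OF p q])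
qed

end

section \<open>The group of generic types\<close>

context stable_bialgebra
begin

abbreviation tmult :: "'a set set \<Rightarrow> 'a set set \<Rightarrow> 'a set set" where
  "tmult \<equiv> type_mult G \<B>"

abbreviation gtypes :: "'a set set set" where
  "gtypes \<equiv> generic_types G \<B>"

lemmas gtypes_minimal = minimal_subflowD[OF generic_types_minimal]

lemma gtypes_types: "p \<in> gtypes \<Longrightarrow> p \<in> types G \<B>"
  by (simp add: generic_types_def)

text \<open>For principal \<open>p\<close> the product is a translate of \<open>q\<close>; the
  condition is closed in \<open>p\<close>, and principal types are dense.\<close>

lemma tmult_generic:
  assumes p: "p \<in> types G \<B>" and q: "q \<in> gtypes" shows "tmult p q \<in> gtypes"
proof -
  interpret E: stable_extension G \<B> \<B> by (rule stable_extension_self)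
  have qt: "q \<in> types G \<B>" using q by (rule gtypes_types)
  have "types G \<B> \<subseteq> {r \<in> topspace (type_space G \<B>). tmult r q \<in> gtypes}"
  proof (rule points_dense)
    show "closedin (type_space G \<B>) {r \<in> topspace (type_space G \<B>). tmult r q \<in> gtypes}"
      by (rule closedin_continuous_map_preimage[OF E.continuous_type_mult_left[OF qt] gtypes_minimal(2)])
    show "{A \<in> \<B>. g \<in> A} \<in> {r \<in> topspace (type_space G \<B>). tmult r q \<in> gtypes}" if "g \<in> carrier G" for g
      using E.type_mult_point[OF that qt] gtypes_minimal(3)[OF that q] types_point[OF that] by simp
  qed
  then show ?thesis using p by blast
qed

text \<open>Right multiplication by \<open>q\<close> commutes with the action of the group, so it
  maps the generic types onto a subflow inside a minimal one. With the unit for \<open>r\<close>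
  this supplies left inverses.\<close>

lemma tmult_solvable:
  assumes q: "q \<in> gtypes" and r: "r \<in> gtypes" shows "\<exists>p\<in>gtypes. tmult p q = r"
proof -
  interpret E: stable_extension G \<B> \<B> by (rule stable_extension_self)
  have qt: "q \<in> types G \<B>" using q by (rule gtypes_types)
  let ?Z = "(\<lambda>p. tmult p q) ` gtypes"
  have "compactin (type_space G \<B>) gtypes"
    using compact_types gtypes_minimal(2) by (rule closedin_compact_space)
  then have "compactin (type_space G \<B>) ?Z"
    using E.continuous_type_mult_left[OF qt] by (rule image_compactin)
  then have "closedin (type_space G \<B>) ?Z" by (rule compactin_imp_closedin[OF Hausdorff_types])
  moreover have "type_action G \<B> g (tmult p q) \<in> ?Z" if g: "g \<in> carrier G" and p: "p \<in> gtypes" for g p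
    using E.type_mult_action[OF g gtypes_types[OF p] qt] gtypes_minimal(3)[OF g p] by simp
  ultimately have "subflow G (type_space G \<B>) (type_action G \<B>) ?Z"
    using q by (auto simp: subflow_types_iff)
  moreover have "?Z \<subseteq> gtypes" using tmult_generic[OF gtypes_types q] by blast
  ultimately have eq: "?Z = gtypes" by (rule gtypes_minimal(4))
  have "r \<in> ?Z" by (simp only: eq r)
  then obtain p where "p \<in> gtypes" "r = tmult p q" by (elim imageE)
  then show ?thesis by (intro bexI[of _ p]) simp_all
qed

lemma closedin_type_d:
  assumes A: "A \<in> \<B>"
  shows "closedin (type_space G \<B>) {q \<in> types G \<B>. type_d G q A = E}"
proof (cases "E \<subseteq> carrier G")
  case True
  let ?C = "\<lambda>x. {q \<in> types G \<B>. (if x \<in> E then inv x <# A else carrier G - (inv x <# A)) \<in> q}"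
  have "closedin (type_space G \<B>) (\<Inter>x\<in>carrier G. ?C x)"
  proof (rule closedin_INT)
    show "closedin (type_space G \<B>) (?C x)" if "x \<in> carrier G" for x
      using closedin_basic l_coset_in[OF _ A, of "inv x"] that by auto
  qed (use one_closed in auto)
  moreover have "(\<Inter>x\<in>carrier G. ?C x) = {q \<in> types G \<B>. type_d G q A = E}"
  proof -
    have "q \<in> (\<Inter>x\<in>carrier G. ?C x) \<longleftrightarrow> q \<in> types G \<B> \<and> type_d G q A = E" for q
    proof (cases "q \<in> types G \<B>")
      case q: True
      have "q \<in> ?C x \<longleftrightarrow> (x \<in> type_d G q A \<longleftrightarrow> x \<in> E)" if "x \<in> carrier G" for x
        using q that types_compl[OF q l_coset_in[OF _ A, of "inv x"]] by (simp add: type_d_def)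
      then have "q \<in> (\<Inter>x\<in>carrier G. ?C x) \<longleftrightarrow> (\<forall>x\<in>carrier G. x \<in> type_d G q A \<longleftrightarrow> x \<in> E)" by blast
      also have "\<dots> \<longleftrightarrow> type_d G q A = E" using True type_d_subset[of q A] by blast
      finally show ?thesis using q by simp
    qed (use one_closed in auto)
    then show ?thesis by blast
  qed
  ultimately show ?thesis by simp
next
  case False
  then have "{q \<in> types G \<B>. type_d G q A = E} = {}" using type_d_subset by blast
  then show ?thesis by (simp only: closedin_empty)
qed

text \<open>
  Finitely many sets with finite left orbits generate a finite algebra of translates, on which a
  type acts like a group element; correcting a generic type by the inverse of that element makes
  it act trivially, and a limit of such types is the identity.
\<close>
lemma generic_types_left_unit:
  "\<exists>e\<in>gtypes. \<forall>q\<in>gtypes. tmult e q = q"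
proof -
  interpret E: stable_extension G \<B> \<B> by (rule stable_extension_self)
  let ?X = "type_space G \<B>"
  \<comment> \<open>\<open>tmult e q = q\<close> holds once \<open>type_d G e\<close> fixes every
    trace \<open>type_d G q A\<close>. \<open>C A\<close> collects the generic types that do so for
    \<open>A\<close>, and compactness reduces the search to finitely many \<open>A\<close>.\<close>
  define C where "C A = gtypes \<inter> (\<Inter>q\<in>gtypes. {p \<in> types G \<B>. type_d G p (type_d G q A) = type_d G q A})" for A
  have ne: "gtypes \<noteq> {}" by (rule gtypes_minimal(1))
  have dB: "type_d G q A \<in> \<B>" if "q \<in> gtypes" "A \<in> \<B>" for q A
    using E.type_d_in_C[OF gtypes_types[OF that(1)] that(2)] .
  have "closedin ?X (C A)" if A: "A \<in> \<B>" for A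
    unfolding C_def
  proof (rule closedin_Int[OF gtypes_minimal(2)], rule closedin_INT[OF ne])
    show "closedin ?X {p \<in> types G \<B>. type_d G p (type_d G q A) = type_d G q A}" if "q \<in> gtypes" for q
      by (rule closedin_type_d[OF dB[OF that A]])
  qed
  moreover have "\<Inter>\<F> \<noteq> {}" if \<F>: "finite \<F>" "\<F> \<subseteq> C ` \<B>" for \<F>
  proof -
    from finite_subset_image[OF \<F>] obtain F where F: "F \<subseteq> \<B>" "finite F" "\<F> = C ` F" by (elim exE conjE)
    define T where "T = (\<Union>A\<in>F. (\<lambda>q. type_d G q A) ` gtypes)"
    define H where "H = (\<Union>E\<in>T. (\<lambda>g. g <# E) ` carrier G)"
    have TB: "T \<subseteq> \<B>" using F(1) dB by (auto simp: T_def)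
    have "finite T" unfolding T_def
      using F finite_type_d[OF generic_types_minimal] stable by (intro finite_UN_I) auto
    moreover have "finite ((\<lambda>g. g <# E) ` carrier G)" if "E \<in> T" for E
    proof -
      obtain A q where "A \<in> F" "q \<in> gtypes" "E = type_d G q A" using \<open>E \<in> T\<close> by (auto simp: T_def)
      then show ?thesis
        using finite_type_d_r_cosets[OF generic_types_minimal, of q A] stable[of A] F(1)
        by (intro finite_r_cosets_imp_l_cosets) (auto simp: type_d_subset)
    qed
    ultimately have finH: "finite H" unfolding H_def by (rule finite_UN_I)
    have HB: "H \<subseteq> \<B>" using TB l_coset_in by (auto simp: H_def)
    obtain p where p: "p \<in> gtypes" using ne by blast
    have pt: "p \<in> types G \<B>" using p by (rule gtypes_types)
    from types_realize[OF pt finH HB] obtain g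
      where g: "g \<in> carrier G" "\<forall>E\<in>H. g \<in> E \<longleftrightarrow> E \<in> p" by (elim bexE)
    have gi: "inv g \<in> carrier G" using g(1) by simp
    let ?p = "type_action G \<B> (inv g) p"
    have p': "?p \<in> gtypes" using gi p by (rule gtypes_minimal(3))
    have fixE: "type_d G ?p E = E" if E: "E \<in> T" for E
    proof -
      have EB: "E \<in> \<B>" "E \<subseteq> carrier G" using E TB in_carrier by auto
      have "x \<in> type_d G p E \<longleftrightarrow> x \<otimes> g \<in> E" if x: "x \<in> carrier G" for x
      proof -
        have "inv x <# E \<in> H" using E x by (auto simp: H_def)
        then have "x \<in> type_d G p E \<longleftrightarrow> g \<in> inv x <# E" using g(2) x by (simp add: type_d_def)
        then show ?thesis using x g(1) EB by (simp add: mem_l_coset_iff)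
      qed
      then have "x \<in> type_d G p E #> g \<longleftrightarrow> x \<in> E" for x
        using g(1) EB(2) type_d_subset[of p E] by (auto simp: mem_r_coset_iff m_assoc subset_iff)
      then have "type_d G p E #> g = E" by blast
      then show ?thesis using type_d_type_action[OF pt EB(1) gi] g(1) by simp
    qed
    have "?p \<in> C A" if "A \<in> F" for A
      using p' gtypes_types[OF p'] fixE that by (auto simp: C_def T_def)
    then show ?thesis unfolding F(3) by blast
  qed
  ultimately have "\<Inter>(C ` \<B>) \<noteq> {}"
    using compact_types[unfolded compact_space_fip, rule_format, of "C ` \<B>"] by auto
  then obtain e where e: "\<And>A. A \<in> \<B> \<Longrightarrow> e \<in> C A" by auto
  have eg: "e \<in> gtypes" using e[OF carrier_in] by (simp add: C_def)
  have "tmult e q = q" if q: "q \<in> gtypes" for q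
  proof -
    have qt: "q \<in> types G \<B>" using q by (rule gtypes_types)
    have "A \<in> tmult e q \<longleftrightarrow> A \<in> q" if A: "A \<in> \<B>" for A
    proof -
      have "type_d G e (type_d G q A) = type_d G q A" using e[OF A] q by (auto simp: C_def)
      then show ?thesis
        using mem_type_iff_type_d[OF gtypes_types[OF eg] dB[OF q A]] mem_type_iff_type_d[OF qt A] A
        by (simp add: E.mem_type_mult)
    qed
    then show ?thesis using E.mem_type_mult types_subset[OF qt] by blast
  qed
  then show ?thesis using eg by blast
qed

lemma generic_types_group:
  assumes e: "e \<in> gtypes" "\<And>q. q \<in> gtypes \<Longrightarrow> tmult e q = q"
  shows "group \<lparr>carrier = gtypes, mult = tmult, one = e\<rparr>"
proof (rule groupI)
  interpret E: stable_extension G \<B> \<B> by (rule stable_extension_self)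
  fix x y z assume "x \<in> carrier \<lparr>carrier = gtypes, mult = tmult, one = e\<rparr>"
    "y \<in> carrier \<lparr>carrier = gtypes, mult = tmult, one = e\<rparr>" "z \<in> carrier \<lparr>carrier = gtypes, mult = tmult, one = e\<rparr>"
  then show "x \<otimes>\<^bsub>\<lparr>carrier = gtypes, mult = tmult, one = e\<rparr>\<^esub> y \<otimes>\<^bsub>\<lparr>carrier = gtypes, mult = tmult, one = e\<rparr>\<^esub> z =
      x \<otimes>\<^bsub>\<lparr>carrier = gtypes, mult = tmult, one = e\<rparr>\<^esub> (y \<otimes>\<^bsub>\<lparr>carrier = gtypes, mult = tmult, one = e\<rparr>\<^esub> z)"
    by (simp add: E.type_mult_assoc gtypes_types)
qed (use e tmult_solvable[OF _ e(1)] tmult_generic gtypes_types in auto)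

text \<open>On generic types \<open>type_d G q A\<close> takes finitely many values and has closed
  fibres, which are therefore open as well. So the condition \<open>type_d G q A \<in> p\<close>
  describes a union of open rectangles, one for each value.\<close>

lemma continuous_tmult:
  "continuous_map (prod_topology (subtopology (type_space G \<B>) gtypes) (subtopology (type_space G \<B>) gtypes))
     (subtopology (type_space G \<B>) gtypes) (\<lambda>(x, y). tmult x y)"
proof -
  interpret E: stable_extension G \<B> \<B> by (rule stable_extension_self)
  let ?X = "type_space G \<B>"
  let ?K = "subtopology ?X gtypes"
  have KT: "topspace ?K = gtypes" using gtypes_types by auto
  have opn: "openin ?K {q \<in> gtypes. type_d G q A = D}" if A: "A \<in> \<B>" for A D
  proof -
    let ?T = "(\<lambda>q. type_d G q A) ` gtypes - {D}"
    have "finite ?T" using finite_type_d[OF generic_types_minimal A stable[OF A]] by simp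
    then have "closedin ?X (\<Union>E\<in>?T. {q \<in> types G \<B>. type_d G q A = E})"
      by (intro closedin_Union) (use closedin_type_d[OF A] in auto)
    then have "openin ?X (topspace ?X - (\<Union>E\<in>?T. {q \<in> types G \<B>. type_d G q A = E}))" by (rule openin_diff[OF openin_topspace])
    moreover have "{q \<in> gtypes. type_d G q A = D} = (topspace ?X - (\<Union>E\<in>?T. {q \<in> types G \<B>. type_d G q A = E})) \<inter> gtypes"
      using gtypes_types by auto
    ultimately show ?thesis unfolding openin_subtopology by blast
  qed
  have "continuous_map (prod_topology ?K ?K) ?X (\<lambda>(x, y). tmult x y)"
  proof (rule continuous_map_types)
    show "(\<lambda>(x, y). tmult x y) \<in> topspace (prod_topology ?K ?K) \<rightarrow> types G \<B>"
      using KT E.type_mult_closed gtypes_types by auto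
    fix A assume A: "A \<in> \<B>"
    have "openin (prod_topology ?K ?K) ({p \<in> gtypes. D \<in> p} \<times> {q \<in> gtypes. type_d G q A = D})" if D: "D \<in> \<B>" for D
    proof -
      have "{p \<in> gtypes. D \<in> p} = {p \<in> types G \<B>. D \<in> p} \<inter> gtypes" using gtypes_types by auto
      then have "openin ?K {p \<in> gtypes. D \<in> p}" unfolding openin_subtopology using openin_basic[OF D] by blast
      then show ?thesis using opn[OF A] by (simp add: openin_prod_Times_iff)
    qed
    then have "openin (prod_topology ?K ?K) (\<Union>D\<in>\<B>. {p \<in> gtypes. D \<in> p} \<times> {q \<in> gtypes. type_d G q A = D})"
      by (intro openin_Union) auto
    moreover have "{z \<in> topspace (prod_topology ?K ?K). A \<in> (case z of (x, y) \<Rightarrow> tmult x y)} =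
        (\<Union>D\<in>\<B>. {p \<in> gtypes. D \<in> p} \<times> {q \<in> gtypes. type_d G q A = D})"
      using KT A E.type_d_in_C[OF gtypes_types A] by (auto simp: E.mem_type_mult)
    ultimately show "openin (prod_topology ?K ?K) {z \<in> topspace (prod_topology ?K ?K). A \<in> (case z of (x, y) \<Rightarrow> tmult x y)}"
      by simp
  qed
  moreover have "(\<lambda>(x, y). tmult x y) \<in> topspace (prod_topology ?K ?K) \<rightarrow> gtypes"
    using KT tmult_generic gtypes_types by auto
  ultimately show ?thesis by (simp add: continuous_map_in_subtopology)
qed

lemma generic_types_profinite:
  "\<exists>e. profinite_group \<lparr>carrier = gtypes, mult = tmult, one = e\<rparr> (subtopology (type_space G \<B>) gtypes)"
proof -
  from generic_types_left_unit obtain e where e: "e \<in> gtypes" "\<forall>q\<in>gtypes. tmult e q = q" by (elim bexE)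
  define H where "H = \<lparr>carrier = gtypes, mult = tmult, one = e\<rparr>"
  interpret H: group H unfolding H_def by (rule generic_types_group) (use e in auto)
  have H: "carrier H = gtypes" "\<And>x y. x \<otimes>\<^bsub>H\<^esub> y = tmult x y" "\<one>\<^bsub>H\<^esub> = e" by (simp_all add: H_def)
  let ?X = "type_space G \<B>"
  let ?K = "subtopology ?X gtypes"
  have KT: "topspace ?K = gtypes" using gtypes_types by auto
  have cpt: "compact_space ?K"
    using closedin_compact_space[OF compact_types gtypes_minimal(2)] by (rule compact_space_subtopology)
  have haus: "Hausdorff_space ?K" by (rule Hausdorff_space_subtopology[OF Hausdorff_types])
  have clopen: "closedin ?K {q \<in> gtypes. A \<in> q}" "openin ?K {q \<in> gtypes. A \<in> q}" if A: "A \<in> \<B>" for A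
  proof -
    have eq: "{q \<in> gtypes. A \<in> q} = {q \<in> types G \<B>. A \<in> q} \<inter> gtypes" using gtypes_types by auto
    show "closedin ?K {q \<in> gtypes. A \<in> q}" unfolding closedin_subtopology using eq closedin_basic[OF A] by blast
    show "openin ?K {q \<in> gtypes. A \<in> q}" unfolding openin_subtopology using eq openin_basic[OF A] by blast
  qed
  have mult: "continuous_map (prod_topology ?K ?K) ?K (\<lambda>(x, y). x \<otimes>\<^bsub>H\<^esub> y)"
    using continuous_tmult by (simp add: H)
  \<comment> \<open>The pairs with product \<open>e\<close> form the graph of inversion, which is
    closed; projection along the compact second factor is a closed map.\<close>
  have inv_closed: "closedin ?K {p \<in> gtypes. A \<in> inv\<^bsub>H\<^esub> p}" if A: "A \<in> \<B>" for A
  proof -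
    have "closedin ?K {e}" using haus e(1) KT by (intro closedin_Hausdorff_singleton) auto
    then have "closedin (prod_topology ?K ?K) {z \<in> topspace (prod_topology ?K ?K). (case z of (x, y) \<Rightarrow> x \<otimes>\<^bsub>H\<^esub> y) \<in> {e}}"
      by (rule closedin_continuous_map_preimage[OF mult])
    moreover have "closedin (prod_topology ?K ?K) {z \<in> topspace (prod_topology ?K ?K). snd z \<in> {q \<in> gtypes. A \<in> q}}"
      by (rule closedin_continuous_map_preimage[OF continuous_map_snd clopen(1)[OF A]])
    ultimately have "closedin (prod_topology ?K ?K) ({z \<in> topspace (prod_topology ?K ?K). (case z of (x, y) \<Rightarrow> x \<otimes>\<^bsub>H\<^esub> y) \<in> {e}} \<inter>
        {z \<in> topspace (prod_topology ?K ?K). snd z \<in> {q \<in> gtypes. A \<in> q}})" (is "closedin _ ?S") by (rule closedin_Int)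
    then have cl: "closedin ?K (fst ` ?S)" using closed_map_fst[OF cpt, of ?K] by (simp add: closed_map_def)
    have "fst ` ?S = {p \<in> gtypes. A \<in> inv\<^bsub>H\<^esub> p}"
    proof
      show "fst ` ?S \<subseteq> {p \<in> gtypes. A \<in> inv\<^bsub>H\<^esub> p}"
      proof
        fix p assume "p \<in> fst ` ?S"
        then obtain z where z: "z \<in> ?S" "p = fst z" by (elim imageE)
        then have "(p, snd z) \<in> ?S" by simp
        then have pq: "p \<in> gtypes" "snd z \<in> gtypes" "p \<otimes>\<^bsub>H\<^esub> snd z = e" "A \<in> snd z"
          by simp_all
        then have "p \<in> carrier H" "snd z \<in> carrier H" "p \<otimes>\<^bsub>H\<^esub> snd z = \<one>\<^bsub>H\<^esub>" by (simp_all only: H)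
        then have "inv\<^bsub>H\<^esub> p = snd z" using H.inv_equality H.inv_comm by metis
        then show "p \<in> {p \<in> gtypes. A \<in> inv\<^bsub>H\<^esub> p}" using pq by simp
      qed
      show "{p \<in> gtypes. A \<in> inv\<^bsub>H\<^esub> p} \<subseteq> fst ` ?S"
      proof
        fix p assume p: "p \<in> {p \<in> gtypes. A \<in> inv\<^bsub>H\<^esub> p}"
        then have pH: "p \<in> carrier H" by (simp add: H)
        have ip: "inv\<^bsub>H\<^esub> p \<in> gtypes" "p \<otimes>\<^bsub>H\<^esub> inv\<^bsub>H\<^esub> p = e"
          using H.inv_closed[OF pH] H.r_inv[OF pH] by (simp_all only: H)
        then have "(p, inv\<^bsub>H\<^esub> p) \<in> ?S" using p gtypes_types[OF ip(1)] gtypes_types[of p] by simp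
        then show "p \<in> fst ` ?S" by (rule image_eqI[rotated]) simp
      qed
    qed
    then show ?thesis using cl by simp
  qed
  have "continuous_map ?K ?X (\<lambda>p. inv\<^bsub>H\<^esub> p)"
  proof (rule continuous_map_types)
    show "(\<lambda>p. inv\<^bsub>H\<^esub> p) \<in> topspace ?K \<rightarrow> types G \<B>" using KT H.inv_closed H gtypes_types by auto
    fix A assume A: "A \<in> \<B>"
    \<comment> \<open>Preimages of basic sets are closed; applied to the complement of
      \<open>A\<close> this makes them open.\<close>
    have "A \<in> inv\<^bsub>H\<^esub> p \<longleftrightarrow> carrier G - A \<notin> inv\<^bsub>H\<^esub> p" if "p \<in> gtypes" for p
      using H.inv_closed[of p] H that gtypes_types types_compl[OF _ A] by auto
    then have "{p \<in> topspace ?K. A \<in> inv\<^bsub>H\<^esub> p} = topspace ?K - {p \<in> gtypes. carrier G - A \<in> inv\<^bsub>H\<^esub> p}" using KT by auto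
    then show "openin ?K {p \<in> topspace ?K. A \<in> inv\<^bsub>H\<^esub> p}"
      using openin_diff[OF openin_topspace inv_closed[OF compl_sets[OF A]]] by (simp only:)
  qed
  then have "continuous_map ?K ?K (\<lambda>p. inv\<^bsub>H\<^esub> p)"
    using KT H.inv_closed H by (auto simp: continuous_map_in_subtopology)
  then have "topological_group H ?K"
    using mult KT H H.is_group by (simp add: topological_group_def)
  moreover have "totally_disconnected_space ?K"
    unfolding totally_disconnected_space_def
  proof (intro allI impI)
    fix S assume S: "connectedin ?K S"
    have SK: "S \<subseteq> gtypes" using connectedin_subset_topspace[OF S] KT by simp
    have "p = q" if "p \<in> S" "q \<in> S" for p q
    proof (rule types_eqI)
      show pt: "p \<in> types G \<B>" and "q \<in> types G \<B>" using that SK gtypes_types by auto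
      fix A assume A: "A \<in> p"
      have AB: "A \<in> \<B>" using types_subset[OF pt A] .
      have "S \<subseteq> {q \<in> gtypes. A \<in> q} \<or> disjnt S {q \<in> gtypes. A \<in> q}"
        by (rule connectedin_clopen_cases[OF S clopen[OF AB]])
      then show "A \<in> q" using that A SK by (auto simp: disjnt_iff)
    qed
    then show "\<exists>x. S \<subseteq> {x}" by blast
  qed
  ultimately have "profinite_group H ?K" using cpt haus by (simp add: profinite_group_def)
  then show ?thesis unfolding H_def by blast
qed

end

section \<open>Finitely additive measures\<close>

text \<open>The total mass is arbitrary, so as to cover the variation of a functional along with
  probability measures.\<close>

locale finitely_additive = Sigma_Algebra.algebra \<Omega> M for \<Omega> :: "'a set" and M +
  fixes \<mu> :: "'a set \<Rightarrow> real"
  assumes nonneg: "E \<in> M \<Longrightarrow> 0 \<le> \<mu> E"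
    and add: "E \<in> M \<Longrightarrow> F \<in> M \<Longrightarrow> E \<inter> F = {} \<Longrightarrow> \<mu> (E \<union> F) = \<mu> E + \<mu> F"
begin

lemma measure_empty: "\<mu> {} = 0"
  using add[of "{}" "{}"] by simp

lemma measure_split: "E \<in> M \<Longrightarrow> F \<in> M \<Longrightarrow> \<mu> E = \<mu> (E \<inter> F) + \<mu> (E - F)"
  using add[of "E \<inter> F" "E - F"] by (auto simp: Int_Diff_Un Int Diff Int_Diff)

lemma measure_mono: "E \<in> M \<Longrightarrow> F \<in> M \<Longrightarrow> E \<subseteq> F \<Longrightarrow> \<mu> E \<le> \<mu> F"
  using measure_split[of F E] nonneg[of "F - E"] by (simp add: Int_absorb1 Diff)

lemma measure_Un_le:
  assumes "E \<in> M" "F \<in> M" shows "\<mu> (E \<union> F) \<le> \<mu> E + \<mu> F"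
proof -
  have "\<mu> (E \<union> F) = \<mu> E + \<mu> (F - E)" using add[of E "F - E"] assms by (auto simp: Diff)
  then show ?thesis using measure_mono[of "F - E" F] assms by (auto simp: Diff)
qed

lemma measure_UN_le:
  "finite I \<Longrightarrow> (\<And>i. i \<in> I \<Longrightarrow> E i \<in> M) \<Longrightarrow> \<mu> (\<Union>i\<in>I. E i) \<le> (\<Sum>i\<in>I. \<mu> (E i))"
proof (induction I rule: finite_induct)
  case empty then show ?case by (simp add: measure_empty)
next
  case (insert i I)
  have "E i \<in> M" "(\<Union>i\<in>I. E i) \<in> M" using insert by (auto intro: finite_UN)
  then have "\<mu> (E i \<union> (\<Union>i\<in>I. E i)) \<le> \<mu> (E i) + \<mu> (\<Union>i\<in>I. E i)" by (rule measure_Un_le)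
  also have "\<dots> \<le> \<mu> (E i) + (\<Sum>i\<in>I. \<mu> (E i))" using insert by simp
  finally show ?case using insert by simp
qed

text \<open>Each set loses at most \<open>N * b\<close> to the earlier ones, so it adds at least
  \<open>a - N * b\<close> to the union.\<close>

lemma measure_almost_disjoint:
  assumes T: "\<And>n. n < N \<Longrightarrow> T n \<in> M" "\<And>n. n < N \<Longrightarrow> a \<le> \<mu> (T n)"
    and ov: "\<And>i j. i < j \<Longrightarrow> j < N \<Longrightarrow> \<mu> (T i \<inter> T j) \<le> b" and b: "0 \<le> b"
  shows "real N * (a - real N * b) \<le> \<mu> \<Omega>"
proof -
  have "real n * (a - real N * b) \<le> \<mu> (\<Union>i\<in>{..<n}. T i)" if "n \<le> N" for n
    using that
  proof (induction n)
    case 0 then show ?case by (simp add: measure_empty)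
  next
    case (Suc n)
    let ?U = "\<Union>i\<in>{..<n}. T i"
    have U: "?U \<in> M" "T n \<in> M" using T(1) Suc.prems by (auto intro: finite_UN)
    have "\<mu> (T n \<inter> ?U) = \<mu> (\<Union>i\<in>{..<n}. T i \<inter> T n)" by (rule arg_cong[of _ _ \<mu>]) blast
    also have "\<dots> \<le> (\<Sum>i<n. \<mu> (T i \<inter> T n))" by (rule measure_UN_le) (use T(1) Suc.prems in auto)
    also have "\<dots> \<le> (\<Sum>i<n. b)" by (rule sum_mono) (use ov Suc.prems in auto)
    also have "\<dots> \<le> real N * b" using Suc.prems b by (simp add: mult_right_mono)
    finally have "a - real N * b \<le> \<mu> (T n - ?U)" using measure_split[OF U(2,1)] T(2)[of n] Suc.prems by simp
    moreover have "\<mu> (?U \<union> (T n - ?U)) = \<mu> ?U + \<mu> (T n - ?U)" using add[of ?U "T n - ?U"] U by (auto simp: Diff)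
    moreover have "?U \<union> (T n - ?U) = (\<Union>i\<in>{..<Suc n}. T i)" by (auto simp: lessThan_Suc)
    ultimately show ?case using Suc by (simp add: algebra_simps)
  qed
  from this[of N] have "real N * (a - real N * b) \<le> \<mu> (\<Union>i\<in>{..<N}. T i)" by simp
  also have "\<dots> \<le> \<mu> \<Omega>"
  proof (rule measure_mono)
    show "(\<Union>i\<in>{..<N}. T i) \<in> M" using T(1) by (intro finite_UN) auto
    show "(\<Union>i\<in>{..<N}. T i) \<subseteq> \<Omega>" using T(1) sets_into_space by fastforce
  qed (rule top)
  finally show ?thesis .
qed

text \<open>The integral over \<open>Z\<close> of a counting function that is constant there. The
  induction splits \<open>Z\<close> by the set taken out of the family; on the part inside it the
  constant for the remaining sets drops by one, which is why \<open>Z\<close> and \<open>c\<close>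
  are arbitrary.\<close>

lemma measure_constant_cover:
  assumes "finite I" "\<And>i. i \<in> I \<Longrightarrow> E i \<in> M" "Z \<in> M"
    and "\<And>z. z \<in> Z \<Longrightarrow> (\<Sum>i\<in>I. of_bool (z \<in> E i)) = (c :: real)"
  shows "(\<Sum>i\<in>I. \<mu> (E i \<inter> Z)) = c * \<mu> Z"
  using assms
proof (induction I arbitrary: Z c rule: finite_induct)
  case empty
  then show ?case by (cases "Z = {}") (auto simp: measure_empty)
next
  case (insert i I)
  let ?A = "Z \<inter> E i" and ?B = "Z - E i"
  have M: "?A \<in> M" "?B \<in> M" "E i \<in> M" "Z \<in> M" "\<And>j. j \<in> I \<Longrightarrow> E j \<in> M" using insert.prems by auto
  have c: "of_bool (z \<in> E i) + (\<Sum>i\<in>I. of_bool (z \<in> E i)) = c" if "z \<in> Z" for z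
    using insert.prems(3)[OF that] insert.hyps by (simp del: sum_of_bool_eq)
  have A: "(\<Sum>j\<in>I. \<mu> (E j \<inter> ?A)) = (c - 1) * \<mu> ?A"
    by (rule insert.IH[OF M(5) M(1)]) (use c in \<open>force simp del: sum_of_bool_eq\<close>)+
  have B: "(\<Sum>j\<in>I. \<mu> (E j \<inter> ?B)) = c * \<mu> ?B"
    by (rule insert.IH[OF M(5) M(2)]) (use c in \<open>force simp del: sum_of_bool_eq\<close>)+
  have "\<mu> (E j \<inter> Z) = \<mu> (E j \<inter> ?A) + \<mu> (E j \<inter> ?B)" if j: "j \<in> I" for j
  proof -
    have "(E j \<inter> Z) \<inter> E i = E j \<inter> ?A" "(E j \<inter> Z) - E i = E j \<inter> ?B" by auto
    then show ?thesis using measure_split[of "E j \<inter> Z" "E i"] M j by (simp add: Int)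
  qed
  then have "(\<Sum>j\<in>I. \<mu> (E j \<inter> Z)) = (c - 1) * \<mu> ?A + c * \<mu> ?B" using A B by (simp add: sum.distrib)
  moreover have "\<mu> Z = \<mu> ?A + \<mu> ?B" using measure_split[OF M(4,3)] .
  ultimately show ?case using insert.hyps by (simp add: Int_commute algebra_simps)
qed

end

section \<open>Measures of translates along an ultrafilter\<close>

context group
begin

text \<open>
  Otherwise the sets of points where \<open>x\<^sup>-\<^sup>1A\<close> and the limit \<open>D\<close> disagree have measure bounded
  below for many \<open>x\<close>. Infinitely many of these sets then have the finite intersection property, and
  points in the intersections produce a ladder.
\<close>
lemma measure_translate_limit:
  assumes B: "invariant_algebra G \<B>" and \<mu>: "finitely_additive (carrier G) \<B> \<mu>"
    and A: "A \<in> \<B>" "wstable G A" and U: "U \<in> types G (Pow (carrier G))" and \<epsilon>: "0 < \<epsilon>"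
    and Z: "\<And>x. Z x = ((inv x <# A) - type_e G U A) \<union> (type_e G U A - (inv x <# A))"
  shows "{x \<in> carrier G. \<mu> (Z x) < \<epsilon>} \<in> U"
proof (rule ccontr)
  assume neg: "\<not> ?thesis"
  interpret B: invariant_algebra G \<B> by (rule B)
  interpret P: invariant_algebra G "Pow (carrier G)" by (rule invariant_algebra_Pow)
  interpret \<mu>: finitely_additive "carrier G" \<B> \<mu> by (rule \<mu>)
  let ?D = "type_e G U A"
  have Ac: "A \<subseteq> carrier G" using A(1) by (rule B.in_carrier)
  have UP: "{x \<in> carrier G. Q x} \<in> Pow (carrier G)" for Q by blast
  have Uneg: "{x \<in> carrier G. \<not> Q x} \<in> U" if "{x \<in> carrier G. Q x} \<notin> U" for Q
  proof -
    have "carrier G - {x \<in> carrier G. Q x} = {x \<in> carrier G. \<not> Q x}" by blast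
    then show ?thesis using that P.types_compl[OF U UP, of Q] by simp
  qed
  have Uand: "{x \<in> carrier G. Q x \<and> R x} \<in> U" if "{x \<in> carrier G. Q x} \<in> U" "{x \<in> carrier G. R x} \<in> U" for Q R
  proof -
    have "{x \<in> carrier G. Q x} \<inter> {x \<in> carrier G. R x} = {x \<in> carrier G. Q x \<and> R x}" by blast
    then show ?thesis using that P.types_Int[OF U UP UP, of Q R] by simp
  qed
  have Uall: "{x \<in> carrier G. \<forall>i\<in>I. Q i x} \<in> U" if "finite I" "\<And>i. i \<in> I \<Longrightarrow> {x \<in> carrier G. Q i x} \<in> U" for I :: "('a \<times> 'a) set" and Q
    using that
  proof (induction I rule: finite_induct)
    case empty then show ?case using P.types_carrier[OF U] by simp
  next
    case (insert i I)
    then show ?case using Uand[of "Q i" "\<lambda>x. \<forall>i\<in>I. Q i x"] by simp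
  qed
  have Uex: "\<exists>x\<in>carrier G. Q x" if "{x \<in> carrier G. Q x} \<in> U" for Q
    using that P.types_not_empty[OF U] by (metis (no_types, lifting) empty_Collect_eq)
  have Umono: "{x \<in> carrier G. R x} \<in> U" if "{x \<in> carrier G. Q x} \<in> U" "\<And>x. x \<in> carrier G \<Longrightarrow> Q x \<Longrightarrow> R x" for Q R
    using P.types_mono[OF U that(1) UP] that(2) by blast
  have DB: "?D \<in> \<B>"
    by (rule P.type_e_in[OF U A(2) _ B.algebra_axioms]) (use A(1) B.l_coset_in Ac r_coset_subset_G in auto)
  have ZB: "Z x \<in> \<B>" if "x \<in> carrier G" for x
    unfolding Z using B.l_coset_in[OF _ A(1), of "inv x"] DB that by (intro B.Un B.Diff) auto
  have memZ: "y \<in> Z x \<longleftrightarrow> (x \<otimes> y \<in> A) \<noteq> (y \<in> ?D)" if "x \<in> carrier G" "y \<in> carrier G" for x y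
    using that Ac by (auto simp: Z mem_l_coset_iff)
  \<comment> \<open>\<open>type_e G U A\<close> is the pointwise limit of the sets
    \<open>inv x <# A\<close> along \<open>U\<close>, so each fixed \<open>y\<close> leaves
    \<open>Z x\<close> for \<open>U\<close>-almost all \<open>x\<close>.\<close>
  have avoid: "{x \<in> carrier G. y \<notin> Z x} \<in> U" if y: "y \<in> carrier G" for y
  proof -
    have eq: "A #> inv y = {x \<in> carrier G. x \<otimes> y \<in> A}" using y Ac by (auto simp: mem_r_coset_iff)
    show ?thesis
    proof (cases "y \<in> ?D")
      case True
      then have "{x \<in> carrier G. x \<otimes> y \<in> A} \<in> U" using eq by (simp add: type_e_def)
      then show ?thesis by (rule Umono) (use True memZ y in auto)
    next
      case False
      then have "{x \<in> carrier G. x \<otimes> y \<in> A} \<notin> U" using eq y by (simp add: type_e_def)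
      then have "{x \<in> carrier G. x \<otimes> y \<notin> A} \<in> U" by (rule Uneg)
      then show ?thesis by (rule Umono) (use False memZ y in auto)
    qed
  qed
  \<comment> \<open>The property that lets the construction continue: positive measure of a finite
    intersection would not ensure that it meets further sets \<open>Z x\<close>, whereas by
    \<open>good1\<close> a good set stays good after intersection with almost any of them.\<close>
  define good where "good E \<longleftrightarrow> E \<in> \<B> \<and> (\<exists>\<delta>>0. {x \<in> carrier G. \<delta> \<le> \<mu> (E \<inter> Z x)} \<in> U)" for E
  have good0: "good (carrier G)"
  proof -
    have "{x \<in> carrier G. \<not> \<mu> (Z x) < \<epsilon>} \<in> U" using neg by (rule Uneg)
    then have "{x \<in> carrier G. \<epsilon> \<le> \<mu> (carrier G \<inter> Z x)} \<in> U"
      by (rule Umono) (use ZB B.in_carrier in \<open>auto simp: Int_absorb1\<close>)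
    then show ?thesis using \<epsilon> B.carrier_in by (auto simp: good_def)
  qed
  have good1: "{x \<in> carrier G. good (E \<inter> Z x)} \<in> U" if E: "good E" for E
  proof (rule ccontr)
    assume "{x \<in> carrier G. good (E \<inter> Z x)} \<notin> U"
    then have bad: "{x \<in> carrier G. \<not> good (E \<inter> Z x)} \<in> U" by (rule Uneg)
    have EB: "E \<in> \<B>" using E by (simp add: good_def)
    obtain a where a: "a > 0" "{x \<in> carrier G. a \<le> \<mu> (E \<inter> Z x)} \<in> U" using E by (auto simp: good_def)
    \<comment> \<open>\<open>N\<close> and \<open>b = a / (2 * N)\<close> are chosen so that
      \<open>N\<close> sets of measure at least \<open>a\<close> with overlaps below
      \<open>b\<close> would need total mass at least \<open>N * a / 2\<close>, more than there
      is.\<close>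
    obtain N :: nat where N: "2 * \<mu> (carrier G) / a < real N" using reals_Archimedean2 by blast
    have N0: "0 < real N" using N \<mu>.nonneg[OF B.carrier_in] a(1) by (smt (verit) divide_nonneg_pos)
    define b where "b = a / (2 * real N)"
    have b: "0 < b" using a(1) N0 by (simp add: b_def)
    have small: "{x' \<in> carrier G. \<mu> (E \<inter> Z x \<inter> Z x') < b} \<in> U" if x: "x \<in> carrier G" "\<not> good (E \<inter> Z x)" for x
    proof (rule ccontr)
      assume "{x' \<in> carrier G. \<mu> (E \<inter> Z x \<inter> Z x') < b} \<notin> U"
      then have "{x' \<in> carrier G. \<not> \<mu> (E \<inter> Z x \<inter> Z x') < b} \<in> U" by (rule Uneg)
      then have "{x' \<in> carrier G. b \<le> \<mu> (E \<inter> Z x \<inter> Z x')} \<in> U" by (rule Umono) simp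
      then have "good (E \<inter> Z x)" using b EB ZB[OF x(1)] by (auto simp: good_def)
      then show False using x(2) by simp
    qed
    let ?ok = "\<lambda>x. x \<in> carrier G \<and> \<not> good (E \<inter> Z x)"
    have "\<exists>f :: nat \<Rightarrow> 'a. \<forall>n. (?ok (f n) \<and> a \<le> \<mu> (E \<inter> Z (f n))) \<and> (\<forall>u\<in>f ` {..<n}. \<mu> (E \<inter> Z u \<inter> Z (f n)) < b)"
    proof (rule sequence_choice[where Inv = "\<lambda>F. \<forall>x\<in>F. ?ok x"])
      fix F assume F: "finite F" "\<forall>x\<in>F. ?ok x"
      \<comment> \<open>\<open>Uall\<close> ranges over pairs, as the ladder constructed later
        requires; the diagonal embeds the single points used here.\<close>
      have "{x' \<in> carrier G. \<forall>u\<in>(\<lambda>x. (x, x)) ` F. \<mu> (E \<inter> Z (fst u) \<inter> Z x') < b} \<in> U"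
        by (rule Uall) (use F small in auto)
      then have "{x' \<in> carrier G. (\<not> good (E \<inter> Z x') \<and> a \<le> \<mu> (E \<inter> Z x')) \<and>
          (\<forall>u\<in>(\<lambda>x. (x, x)) ` F. \<mu> (E \<inter> Z (fst u) \<inter> Z x') < b)} \<in> U"
        using bad a(2) by (intro Uand)
      from Uex[OF this] obtain x' where "x' \<in> carrier G" "\<not> good (E \<inter> Z x')" "a \<le> \<mu> (E \<inter> Z x')"
        "\<forall>u\<in>(\<lambda>x. (x, x)) ` F. \<mu> (E \<inter> Z (fst u) \<inter> Z x') < b" by (elim bexE conjE)
      then show "\<exists>x'. ((?ok x' \<and> a \<le> \<mu> (E \<inter> Z x')) \<and> (\<forall>u\<in>F. \<mu> (E \<inter> Z u \<inter> Z x') < b)) \<and> (\<forall>x\<in>insert x' F. ?ok x)"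
        using F by (intro exI[of _ x']) auto
    qed simp
    then obtain f :: "nat \<Rightarrow> 'a" where f: "\<forall>n. (?ok (f n) \<and> a \<le> \<mu> (E \<inter> Z (f n))) \<and> (\<forall>u\<in>f ` {..<n}. \<mu> (E \<inter> Z u \<inter> Z (f n)) < b)" ..
    have "real N * (a - real N * b) \<le> \<mu> (carrier G)"
    proof (rule \<mu>.measure_almost_disjoint[where T = "\<lambda>n. E \<inter> Z (f n)"])
      show "E \<inter> Z (f n) \<in> \<B>" for n using f EB ZB by auto
      show "a \<le> \<mu> (E \<inter> Z (f n))" for n using f by blast
      fix i j :: nat assume "i < j"
      then have "\<mu> (E \<inter> Z (f i) \<inter> Z (f j)) < b" using f by auto
      moreover have "E \<inter> Z (f i) \<inter> (E \<inter> Z (f j)) = E \<inter> Z (f i) \<inter> Z (f j)" by blast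
      ultimately show "\<mu> (E \<inter> Z (f i) \<inter> (E \<inter> Z (f j))) \<le> b" by simp
    qed (use b in simp)
    moreover have "real N * b = a / 2" using N0 by (simp add: b_def)
    ultimately have "real N * (a / 2) \<le> \<mu> (carrier G)" by simp
    then show False using N a(1) by (simp add: field_simps)
  qed
  define cap where "cap F = carrier G \<inter> (\<Inter>u\<in>F. Z (fst u))" for F :: "('a \<times> 'a) set"
  have "\<exists>f :: nat \<Rightarrow> 'a \<times> 'a. \<forall>n. f n \<in> carrier G \<times> carrier G \<and>
      (\<forall>u\<in>f ` {..<n}. snd (f n) \<in> Z (fst u) \<and> snd u \<notin> Z (fst (f n)))"
  proof (rule sequence_choice[where Inv = "\<lambda>F. good (cap F) \<and> F \<subseteq> carrier G \<times> carrier G"])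
    show "good (cap {}) \<and> {} \<subseteq> carrier G \<times> carrier G" using good0 by (simp add: cap_def)
    fix F assume F: "finite F" "good (cap F) \<and> F \<subseteq> carrier G \<times> carrier G"
    have "{x \<in> carrier G. \<forall>u\<in>F. snd u \<notin> Z x} \<in> U" by (rule Uall) (use F avoid in auto)
    then have "{x \<in> carrier G. good (cap F \<inter> Z x) \<and> (\<forall>u\<in>F. snd u \<notin> Z x)} \<in> U"
      using good1[of "cap F"] F by (intro Uand) auto
    from Uex[OF this] obtain x where x: "x \<in> carrier G" "good (cap F \<inter> Z x)" "\<forall>u\<in>F. snd u \<notin> Z x"
      by (elim bexE conjE)
    have "cap F \<inter> Z x \<noteq> {}"
    proof
      assume "cap F \<inter> Z x = {}"
      then obtain \<delta> where "\<delta> > 0" "{x' \<in> carrier G. \<delta> \<le> \<mu> ({} \<inter> Z x')} \<in> U" using x(2) by (auto simp: good_def)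
      then show False using Uex[of "\<lambda>x'. \<delta> \<le> \<mu> ({} \<inter> Z x')"] by (simp add: \<mu>.measure_empty)
    qed
    then obtain y where y: "y \<in> cap F" "y \<in> Z x" by blast
    have "cap (insert (x, y) F) = cap F \<inter> Z x" by (auto simp: cap_def)
    then show "\<exists>v. (v \<in> carrier G \<times> carrier G \<and> (\<forall>u\<in>F. snd v \<in> Z (fst u) \<and> snd u \<notin> Z (fst v))) \<and>
        good (cap (insert v F)) \<and> insert v F \<subseteq> carrier G \<times> carrier G"
      using x y F by (intro exI[of _ "(x, y)"]) (auto simp: cap_def)
  qed
  then obtain f :: "nat \<Rightarrow> 'a \<times> 'a" where f: "\<forall>n. f n \<in> carrier G \<times> carrier G \<and>
      (\<forall>u\<in>f ` {..<n}. snd (f n) \<in> Z (fst u) \<and> snd u \<notin> Z (fst (f n)))" ..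
  have fc: "fst (f n) \<in> carrier G" "snd (f n) \<in> carrier G" for n using f by (auto simp: mem_Times_iff)
  have less: "(fst (f i) \<otimes> snd (f j) \<in> A) \<noteq> (snd (f j) \<in> ?D)" "(fst (f j) \<otimes> snd (f i) \<in> A) = (snd (f i) \<in> ?D)"
    if "i < j" for i j
  proof -
    have "snd (f j) \<in> Z (fst (f i))" "snd (f i) \<notin> Z (fst (f j))" using f that by auto
    then show "(fst (f i) \<otimes> snd (f j) \<in> A) \<noteq> (snd (f j) \<in> ?D)" "(fst (f j) \<otimes> snd (f i) \<in> A) = (snd (f i) \<in> ?D)"
      using memZ fc by blast+
  qed
  \<comment> \<open>On a subsequence membership of the points in \<open>?D\<close> is constant, so
    \<open>y \<in> Z x\<close> becomes \<open>x \<otimes> y \<in> A\<close> up to a fixed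
    negation.\<close>
  from infinite_bool_sequence[of "\<lambda>n. snd (f n) \<in> ?D"] obtain g :: "nat \<Rightarrow> nat" and c
    where g: "strict_mono g" "\<forall>i. (snd (f (g i)) \<in> ?D) = c" by (elim exE conjE)
  have gm: "g i < g j" if "i < j" for i j using g(1) that by (simp add: strict_mono_less)
  have "ladder (\<lambda>x y. (x \<otimes> y \<in> A) \<noteq> c) (carrier G) (carrier G)"
    by (rule ladderI[of "\<lambda>i. fst (f (g i))" _ "\<lambda>i. snd (f (g i))"]) (use fc less[OF gm] g(2) in auto)
  then show False using A(2) by (cases c) (auto simp: wstable_def ladder_free_def)
qed

end

section \<open>The invariant measure\<close>

text \<open>The density of a set with finitely many left translates: the translates by
  \<open>I\<close> cover every point equally often, so an invariant probability measure can only
  give the set the value \<open>r\<close>.\<close>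

definition left_mean :: "('a, 'm) monoid_scheme \<Rightarrow> 'a set \<Rightarrow> real \<Rightarrow> bool" where
  "left_mean G D r \<longleftrightarrow> (\<exists>I. finite I \<and> I \<noteq> {} \<and> I \<subseteq> carrier G \<and>
     (\<forall>x\<in>carrier G. (\<Sum>g\<in>I. of_bool (x \<in> g <#\<^bsub>G\<^esub> D)) = r * real (card I)))"

text \<open>The index set \<open>J\<close> is explicit because additivity needs two sets averaged
  over the same \<open>J\<close>.\<close>

definition right_mean_on :: "('a, 'm) monoid_scheme \<Rightarrow> 'a set \<Rightarrow> 'a set \<Rightarrow> real \<Rightarrow> bool" where
  "right_mean_on G J D r \<longleftrightarrow> finite J \<and> J \<noteq> {} \<and> J \<subseteq> carrier G \<and>
     (\<forall>x\<in>carrier G. (\<Sum>g\<in>J. of_bool (x \<in> D #>\<^bsub>G\<^esub> g)) = r * real (card J))"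

lemma finite_transversal:
  assumes "finite (\<phi> ` K)"
  shows "\<exists>I\<subseteq>K. finite I \<and> bij_betw \<phi> I (\<phi> ` K)"
proof -
  obtain I where I: "I \<subseteq> K" "inj_on \<phi> I" "\<phi> ` K = \<phi> ` I" using subset_image_inj[of "\<phi> ` K" \<phi> K] by auto
  then show ?thesis using assms finite_imageD[of \<phi> I] by (auto simp: bij_betw_def)
qed

text \<open>A permutation of the distinct translates does not change a sum over representatives. It
  is applied with translation by \<open>x\<close> as \<open>\<sigma>\<close>, to compare the count
  at \<open>x\<close> with the count at the unit.\<close>

lemma transversal_sum:
  fixes F F' :: "'b \<Rightarrow> real"
  assumes I: "bij_betw \<phi> I T" and \<sigma>: "bij_betw \<sigma> T T" and eq: "\<And>t. t \<in> T \<Longrightarrow> F (\<sigma> t) = F' t"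
  shows "(\<Sum>g\<in>I. F (\<phi> g)) = (\<Sum>g\<in>I. F' (\<phi> g))"
proof -
  have "(\<Sum>g\<in>I. F (\<phi> g)) = (\<Sum>t\<in>T. F t)" by (rule sum.reindex_bij_betw[OF I])
  also have "\<dots> = (\<Sum>t\<in>T. F (\<sigma> t))" by (rule sum.reindex_bij_betw[OF \<sigma>, symmetric])
  also have "\<dots> = (\<Sum>t\<in>T. F' t)" using eq by (rule sum.cong[OF refl])
  also have "\<dots> = (\<Sum>g\<in>I. F' (\<phi> g))" by (rule sum.reindex_bij_betw[OF I, symmetric])
  finally show ?thesis .
qed

section \<open>Densities of sets with finite orbits\<close>

context group
begin

lemma left_mean_exists:
  assumes D: "D \<subseteq> carrier G" and fin: "finite ((\<lambda>g. g <# D) ` carrier G)"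
  shows "\<exists>r. left_mean G D r"
proof -
  let ?\<phi> = "\<lambda>g. g <# D"
  from finite_transversal[OF fin] obtain I where I: "I \<subseteq> carrier G" "finite I" "bij_betw ?\<phi> I (?\<phi> ` carrier G)"
    by (elim exE conjE)
  have ne: "I \<noteq> {}" using I(3) one_closed by (auto simp: bij_betw_def)
  have const: "(\<Sum>g\<in>I. of_bool (x \<in> ?\<phi> g)) = (\<Sum>g\<in>I. of_bool (\<one> \<in> ?\<phi> g) :: real)" if x: "x \<in> carrier G" for x
  proof (rule transversal_sum[OF I(3), of "\<lambda>E. x <# E"])
    show "bij_betw (\<lambda>E. x <# E) (?\<phi> ` carrier G) (?\<phi> ` carrier G)"
      by (rule bij_betwI[where g = "\<lambda>E. inv x <# E"])
        (use x D in \<open>auto simp: lcos_m_assoc l_coset_subset_G lcos_mult_one m_assoc[symmetric]\<close>)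
    show "of_bool (x \<in> x <# t) = of_bool (\<one> \<in> t)" if "t \<in> ?\<phi> ` carrier G" for t
    proof -
      have "t \<subseteq> carrier G" using that D l_coset_subset_G by blast
      then show ?thesis using x by (simp add: mem_l_coset_iff)
    qed
  qed
  define r where "r = (\<Sum>g\<in>I. of_bool (\<one> \<in> ?\<phi> g) :: real) / real (card I)"
  have "r * real (card I) = (\<Sum>g\<in>I. of_bool (\<one> \<in> ?\<phi> g) :: real)"
    using ne I(2) by (simp add: r_def del: sum_of_bool_eq)
  then show ?thesis unfolding left_mean_def using I ne const by metis
qed

text \<open>Representatives for the orbit of the pair serve both sets at once. A translate of one
  set may then be counted several times, but the count is still the same at every point.\<close>

lemma right_mean_exists_pair:
  assumes D: "D \<subseteq> carrier G" "D' \<subseteq> carrier G"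
    and fin: "finite ((\<lambda>g. D #> g) ` carrier G)" "finite ((\<lambda>g. D' #> g) ` carrier G)"
  shows "\<exists>J r r'. right_mean_on G J D r \<and> right_mean_on G J D' r'"
proof -
  let ?\<phi> = "\<lambda>g. (D #> g, D' #> g)"
  have "?\<phi> ` carrier G \<subseteq> (\<lambda>g. D #> g) ` carrier G \<times> (\<lambda>g. D' #> g) ` carrier G" by auto
  then have "finite (?\<phi> ` carrier G)" using finite_cartesian_product[OF fin] by (rule finite_subset)
  from finite_transversal[OF this] obtain J where J: "J \<subseteq> carrier G" "finite J" "bij_betw ?\<phi> J (?\<phi> ` carrier G)"
    by (elim exE conjE)
  have ne: "J \<noteq> {}" using J(3) one_closed by (auto simp: bij_betw_def)
  have bij: "bij_betw (\<lambda>t. (fst t #> x, snd t #> x)) (?\<phi> ` carrier G) (?\<phi> ` carrier G)" if x: "x \<in> carrier G" for x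
    by (rule bij_betwI[where g = "\<lambda>t. (fst t #> inv x, snd t #> inv x)"])
      (use x D in \<open>auto simp: coset_mult_assoc r_coset_subset_G m_assoc\<close>)
  have sub: "fst t \<subseteq> carrier G" "snd t \<subseteq> carrier G" if "t \<in> ?\<phi> ` carrier G" for t
    using that D by (auto simp: r_coset_subset_G elim!: imageE dest: subsetD[OF r_coset_subset_G])
  have const: "(\<Sum>g\<in>J. of_bool (x \<in> fst (?\<phi> g))) = (\<Sum>g\<in>J. of_bool (\<one> \<in> fst (?\<phi> g)) :: real)"
    if x: "x \<in> carrier G" for x
    by (rule transversal_sum[OF J(3) bij[OF x]]) (use x sub(1) in \<open>simp add: mem_r_coset_iff\<close>)
  have const': "(\<Sum>g\<in>J. of_bool (x \<in> snd (?\<phi> g))) = (\<Sum>g\<in>J. of_bool (\<one> \<in> snd (?\<phi> g)) :: real)"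
    if x: "x \<in> carrier G" for x
    by (rule transversal_sum[OF J(3) bij[OF x]]) (use x sub(2) in \<open>simp add: mem_r_coset_iff\<close>)
  have card: "real (card J) \<noteq> 0" using ne J(2) by simp
  define r where "r = (\<Sum>g\<in>J. of_bool (\<one> \<in> D #> g)) / real (card J)"
  define r' where "r' = (\<Sum>g\<in>J. of_bool (\<one> \<in> D' #> g)) / real (card J)"
  have r: "(\<Sum>g\<in>J. of_bool (\<one> \<in> D #> g)) = r * real (card J)"
    "(\<Sum>g\<in>J. of_bool (\<one> \<in> D' #> g)) = r' * real (card J)"
    using card by (simp_all add: r_def r'_def del: sum_of_bool_eq)
  have "right_mean_on G J D r"
    unfolding right_mean_on_def
  proof (intro conjI ballI)
    fix x assume "x \<in> carrier G"
    from const[OF this] r(1) show "(\<Sum>g\<in>J. of_bool (x \<in> D #> g)) = r * real (card J)"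
      by (simp only: fst_conv)
  qed (use J ne in auto)
  moreover have "right_mean_on G J D' r'"
    unfolding right_mean_on_def
  proof (intro conjI ballI)
    fix x assume "x \<in> carrier G"
    from const'[OF this] r(2) show "(\<Sum>g\<in>J. of_bool (x \<in> D' #> g)) = r' * real (card J)"
      by (simp only: snd_conv)
  qed (use J ne in auto)
  ultimately show ?thesis by (intro exI conjI)
qed

text \<open>Count the pairs \<open>(g, h)\<close> with \<open>inv g \<otimes> inv h\<close> in
  \<open>D\<close> in two orders. Hence the density depends on neither index set.\<close>

lemma left_mean_eq_right_mean:
  assumes D: "D \<subseteq> carrier G" and l: "left_mean G D r" and s: "right_mean_on G J D s"
  shows "r = s"
proof -
  obtain I where I: "finite I" "I \<noteq> {}" "I \<subseteq> carrier G"
    "\<And>x. x \<in> carrier G \<Longrightarrow> (\<Sum>g\<in>I. of_bool (x \<in> g <# D)) = r * real (card I)"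
    using l unfolding left_mean_def by blast
  have J: "finite J" "J \<noteq> {}" "J \<subseteq> carrier G"
    "\<And>x. x \<in> carrier G \<Longrightarrow> (\<Sum>g\<in>J. of_bool (x \<in> D #> g)) = s * real (card J)"
    using s unfolding right_mean_on_def by auto
  have gI: "inv g \<in> carrier G" "g \<in> carrier G" if "g \<in> I" for g using I(3) that by auto
  have hJ: "inv h \<in> carrier G" "h \<in> carrier G" if "h \<in> J" for h using J(3) that by auto
  have "real (card J) * (r * real (card I)) = (\<Sum>h\<in>J. \<Sum>g\<in>I. of_bool (inv h \<in> g <# D))"
    using I(4) hJ by (simp del: sum_of_bool_eq)
  also have "\<dots> = (\<Sum>h\<in>J. \<Sum>g\<in>I. of_bool (inv g \<in> D #> h))"
    by (intro sum.cong refl) (use D gI hJ in \<open>simp add: mem_l_coset_iff mem_r_coset_iff\<close>)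
  also have "\<dots> = (\<Sum>g\<in>I. \<Sum>h\<in>J. of_bool (inv g \<in> D #> h))" by (rule sum.swap)
  also have "\<dots> = real (card I) * (s * real (card J))"
    using J(4) gI by (simp del: sum_of_bool_eq)
  finally show ?thesis using I J by simp
qed

text \<open>Left and right translations commute, so \<open>g\<close> only moves the point at which
  the right translates are counted.\<close>

lemma right_mean_l_coset:
  assumes D: "D \<subseteq> carrier G" and s: "right_mean_on G J D s" and g: "g \<in> carrier G"
  shows "right_mean_on G J (g <# D) s"
  unfolding right_mean_on_def
proof (intro conjI ballI)
  have J: "finite J" "J \<noteq> {}" "J \<subseteq> carrier G"
    "\<And>x. x \<in> carrier G \<Longrightarrow> (\<Sum>g\<in>J. of_bool (x \<in> D #> g)) = s * real (card J)"
    using s unfolding right_mean_on_def by auto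
  show "finite J" "J \<noteq> {}" "J \<subseteq> carrier G" using J by auto
  fix x assume x: "x \<in> carrier G"
  have "(\<Sum>h\<in>J. of_bool (x \<in> (g <# D) #> h)) = (\<Sum>h\<in>J. of_bool (inv g \<otimes> x \<in> D #> h) :: real)"
  proof (rule sum.cong[OF refl])
    fix h assume "h \<in> J"
    then have h: "h \<in> carrier G" using J(3) by auto
    have "x \<in> (g <# D) #> h \<longleftrightarrow> inv g \<otimes> x \<in> D #> h"
      using x g h D by (simp add: mem_l_coset_iff mem_r_coset_iff l_coset_subset_G m_assoc)
    then show "of_bool (x \<in> (g <# D) #> h) = (of_bool (inv g \<otimes> x \<in> D #> h) :: real)" by simp
  qed
  also have "\<dots> = s * real (card J)" using J(4)[of "inv g \<otimes> x"] x g by simp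
  finally show "(\<Sum>h\<in>J. of_bool (x \<in> (g <# D) #> h)) = s * real (card J)" .
qed

end

section \<open>Existence and uniqueness of the invariant measure\<close>

context stable_algebra
begin

text \<open>The measure of \<open>A\<close> is the density of the trace \<open>type_d G p A\<close>
  for a generic \<open>p\<close>: the trace has finite orbits, and forming it commutes with Boolean
  operations and left translation.\<close>

lemma invariant_measure_exists:
  "\<exists>\<mu>. probability_measure_on G \<B> \<mu> \<and> left_invariant_measure G \<B> \<mu>"
proof -
  obtain p where p: "p \<in> generic_types G \<B>" using minimal_subflowD(1)[OF generic_types_minimal] by blast
  have pt: "p \<in> types G \<B>" using p by (simp add: generic_types_def)
  let ?d = "type_d G p"
  have fin: "finite ((\<lambda>g. ?d A #> g) ` carrier G)" if "A \<in> \<B>" for A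
    by (rule finite_type_d_r_cosets[OF generic_types_minimal p that stable[OF that]])
  have finl: "finite ((\<lambda>g. g <# ?d A) ` carrier G)" if "A \<in> \<B>" for A
    by (rule finite_r_cosets_imp_l_cosets[OF type_d_subset fin[OF that]])
  define m where "m A = (SOME r. left_mean G (?d A) r)" for A
  have m: "left_mean G (?d A) (m A)" if "A \<in> \<B>" for A
    unfolding m_def using left_mean_exists[OF type_d_subset finl[OF that]] by (rule someI_ex)
  have mr: "m A = s" if "A \<in> \<B>" "right_mean_on G J (?d A) s" for A J s
    by (rule left_mean_eq_right_mean[OF type_d_subset m[OF that(1)] that(2)])
  have range: "0 \<le> m A \<and> m A \<le> 1" if A: "A \<in> \<B>" for A
  proof -
    obtain I where I: "finite I" "I \<noteq> {}" "I \<subseteq> carrier G"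
      "\<forall>x\<in>carrier G. (\<Sum>g\<in>I. of_bool (x \<in> g <# ?d A)) = m A * real (card I)"
      using m[OF A] unfolding left_mean_def by blast
    have card: "0 < real (card I)" using I by (simp add: card_gt_0_iff)
    have eq: "(\<Sum>g\<in>I. of_bool (\<one> \<in> g <# ?d A)) = m A * real (card I)" using I(4) one_closed by blast
    have "0 \<le> (\<Sum>g\<in>I. of_bool (\<one> \<in> g <# ?d A) :: real)" by (rule sum_nonneg) simp
    moreover have "(\<Sum>g\<in>I. of_bool (\<one> \<in> g <# ?d A) :: real) \<le> (\<Sum>g\<in>I. 1)" by (rule sum_mono) simp
    ultimately have "0 \<le> m A * real (card I)" "m A * real (card I) \<le> 1 * real (card I)"
      using eq by (simp_all del: sum_of_bool_eq)
    then show ?thesis using card by (simp add: zero_le_mult_iff)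
  qed
  have one: "m (carrier G) = 1"
  proof (rule mr[OF carrier_in])
    show "right_mean_on G {\<one>} (?d (carrier G)) 1"
      by (simp add: right_mean_on_def type_d_carrier[OF pt])
  qed
  have add: "m (A \<union> A') = m A + m A'" if A: "A \<in> \<B>" "A' \<in> \<B>" "A \<inter> A' = {}" for A A'
  proof -
    obtain J r r' where J: "right_mean_on G J (?d A) r" "right_mean_on G J (?d A') r'"
      using right_mean_exists_pair[OF type_d_subset type_d_subset fin[OF A(1)] fin[OF A(2)]] by blast
    have d: "?d A \<inter> ?d A' = {}"
      using type_d_Int[OF pt A(1,2)] A(3) types_not_empty[OF pt] by (auto simp: type_d_def l_coset_def)
    have cs: "carrier G - A \<in> \<B>" "carrier G - A' \<in> \<B>" using A by auto
    have "A \<union> A' = carrier G - ((carrier G - A) \<inter> (carrier G - A'))" using A in_carrier by blast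
    then have "?d (A \<union> A') = carrier G - ((carrier G - ?d A) \<inter> (carrier G - ?d A'))"
      using type_d_compl[OF pt Int[OF cs]] type_d_Int[OF pt cs] type_d_compl[OF pt A(1)] type_d_compl[OF pt A(2)] by simp
    then have dU: "?d (A \<union> A') = ?d A \<union> ?d A'" using type_d_subset[of p A] type_d_subset[of p A'] by blast
    have "right_mean_on G J (?d (A \<union> A')) (r + r')"
      unfolding right_mean_on_def
    proof (intro conjI ballI)
      have Jc: "finite J" "J \<noteq> {}" "J \<subseteq> carrier G" using J(1) by (auto simp: right_mean_on_def)
      then show "finite J" "J \<noteq> {}" "J \<subseteq> carrier G" by auto
      fix x assume x: "x \<in> carrier G"
      have "(\<Sum>g\<in>J. of_bool (x \<in> ?d (A \<union> A') #> g)) = (\<Sum>g\<in>J. of_bool (x \<in> ?d A #> g) + of_bool (x \<in> ?d A' #> g) :: real)"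
      proof (rule sum.cong[OF refl])
        fix g assume "g \<in> J"
        then have g: "g \<in> carrier G" using Jc by auto
        show "of_bool (x \<in> ?d (A \<union> A') #> g) = (of_bool (x \<in> ?d A #> g) + of_bool (x \<in> ?d A' #> g) :: real)"
          unfolding dU using x g d type_d_subset[of p A] type_d_subset[of p A'] by (auto simp: mem_r_coset_iff)
      qed
      also have "\<dots> = r * real (card J) + r' * real (card J)"
        using J x by (simp add: right_mean_on_def sum.distrib del: sum_of_bool_eq)
      finally show "(\<Sum>g\<in>J. of_bool (x \<in> ?d (A \<union> A') #> g)) = (r + r') * real (card J)" by (simp add: algebra_simps)
    qed
    then show ?thesis using mr J A Un by metis
  qed
  have inv: "m (g <# A) = m A" if g: "g \<in> carrier G" and A: "A \<in> \<B>" for g A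
  proof -
    obtain J r where J: "right_mean_on G J (?d A) r"
      using right_mean_exists_pair[OF type_d_subset type_d_subset fin[OF A] fin[OF A]] by blast
    have "right_mean_on G J (?d (g <# A)) r"
      using right_mean_l_coset[OF type_d_subset J g] type_d_l_coset[OF pt A g] by simp
    then show ?thesis using mr[OF A J] mr[OF l_coset_in[OF g A]] by simp
  qed
  have "probability_measure_on G \<B> (restrict m \<B>)"
    using range one add carrier_in Un
    by (auto simp: probability_measure_on_def additive_def)
  moreover have "left_invariant_measure G \<B> (restrict m \<B>)"
    using inv l_coset_in by (auto simp: left_invariant_measure_def)
  ultimately show ?thesis by blast
qed

text \<open>Invariance gives all sets \<open>inv x <# A\<close> the measure of \<open>A\<close>, and
  along \<open>U\<close> they converge in measure to \<open>type_e G U A\<close>. That set has a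
  finite left orbit, so its measure is forced to be its density.\<close>

lemma invariant_measure_unique:
  assumes \<mu>: "probability_measure_on G \<B> \<mu>" "left_invariant_measure G \<B> \<mu>"
    and \<nu>: "probability_measure_on G \<B> \<nu>" "left_invariant_measure G \<B> \<nu>"
  shows "\<mu> = \<nu>"
proof -
  let ?P = "Pow (carrier G)"
  interpret P: invariant_algebra G ?P by (rule invariant_algebra_Pow)
  from almost_periodic_type obtain U where U: "U \<in> types G ?P"
    "\<forall>A. wstable G A \<longrightarrow> finite ((\<lambda>g. g <# type_e G U A) ` carrier G)" by (elim bexE)
  have val: "\<rho> A = r"
    if \<rho>: "probability_measure_on G \<B> \<rho>" "left_invariant_measure G \<B> \<rho>" and A: "A \<in> \<B>"
      and r: "left_mean G (type_e G U A) r" for \<rho> A r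
  proof -
    interpret \<rho>: finitely_additive "carrier G" \<B> \<rho>
    proof
      show "0 \<le> \<rho> E" if "E \<in> \<B>" for E using \<rho>(1) that by (auto simp: probability_measure_on_def)
      show "\<rho> (E \<union> F) = \<rho> E + \<rho> F" if "E \<in> \<B>" "F \<in> \<B>" "E \<inter> F = {}" for E F
        using \<rho>(1) that by (auto simp: probability_measure_on_def additive_def)
    qed
    let ?D = "type_e G U A"
    have Ac: "A \<subseteq> carrier G" using A by (rule in_carrier)
    have DB: "?D \<in> \<B>"
      by (rule P.type_e_in[OF U(1) stable[OF A] _ algebra_axioms]) (use A l_coset_in Ac r_coset_subset_G in auto)
    have "\<bar>\<rho> A - \<rho> ?D\<bar> < \<epsilon>" if \<epsilon>: "0 < \<epsilon>" for \<epsilon>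
    proof -
      let ?Z = "\<lambda>x. ((inv x <# A) - ?D) \<union> (?D - (inv x <# A))"
      have "{x \<in> carrier G. \<rho> (?Z x) < \<epsilon>} \<in> U"
        by (rule measure_translate_limit[OF invariant_algebra_axioms \<rho>.finitely_additive_axioms A stable[OF A] U(1) \<epsilon> refl])
      then have "{x \<in> carrier G. \<rho> (?Z x) < \<epsilon>} \<noteq> {}" using P.types_not_empty[OF U(1)] by metis
      then obtain x where x: "x \<in> carrier G" "\<rho> (?Z x) < \<epsilon>" by blast
      let ?E = "inv x <# A"
      have EB: "?E \<in> \<B>" using x A l_coset_in by simp
      have "\<rho> ?E = \<rho> A" using \<rho>(2) x A by (simp add: left_invariant_measure_def)
      moreover have "\<rho> ?E = \<rho> (?E \<inter> ?D) + \<rho> (?E - ?D)" "\<rho> ?D = \<rho> (?E \<inter> ?D) + \<rho> (?D - ?E)"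
        using \<rho>.measure_split[OF EB DB] \<rho>.measure_split[OF DB EB] by (simp_all add: Int_commute)
      moreover have "\<rho> (?Z x) = \<rho> (?E - ?D) + \<rho> (?D - ?E)"
        using EB DB by (intro \<rho>.add) auto
      moreover have "0 \<le> \<rho> (?E - ?D)" "0 \<le> \<rho> (?D - ?E)" using EB DB by (auto intro: \<rho>.nonneg)
      ultimately show ?thesis using x(2) by linarith
    qed
    \<comment> \<open>Taking the difference itself for \<open>\<epsilon>\<close> shows that it
      cannot be positive.\<close>
    from this[of "\<bar>\<rho> A - \<rho> ?D\<bar>"] have eq: "\<rho> A = \<rho> ?D" by auto
    obtain I where I: "finite I" "I \<noteq> {}" "I \<subseteq> carrier G"
      "\<And>x. x \<in> carrier G \<Longrightarrow> (\<Sum>g\<in>I. of_bool (x \<in> g <# ?D)) = r * real (card I)"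
      using r unfolding left_mean_def by blast
    have gB: "g <# ?D \<in> \<B>" if "g \<in> I" for g using that I(3) DB l_coset_in by blast
    have "(\<Sum>g\<in>I. \<rho> ((g <# ?D) \<inter> carrier G)) = r * real (card I) * \<rho> (carrier G)"
      by (rule \<rho>.measure_constant_cover[OF I(1) gB carrier_in I(4)])
    moreover have "\<rho> ((g <# ?D) \<inter> carrier G) = \<rho> ?D" if "g \<in> I" for g
    proof -
      have "(g <# ?D) \<inter> carrier G = g <# ?D" using in_carrier[OF gB[OF that]] by blast
      then show ?thesis using \<rho>(2) I(3) that DB by (auto simp: left_invariant_measure_def)
    qed
    ultimately have "real (card I) * \<rho> ?D = r * real (card I)"
      using \<rho>(1) by (simp add: probability_measure_on_def)
    then show ?thesis using eq I by simp
  qed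
  show ?thesis
  proof (rule extensionalityI[of _ \<B>])
    show "\<mu> \<in> extensional \<B>" "\<nu> \<in> extensional \<B>"
      using \<mu>(1) \<nu>(1) by (auto simp: probability_measure_on_def PiE_iff)
    fix A assume A: "A \<in> \<B>"
    have "finite ((\<lambda>g. g <# type_e G U A) ` carrier G)" using U(2) stable[OF A] by blast
    then obtain r where "left_mean G (type_e G U A) r" using left_mean_exists[OF P.type_e_subset] by blast
    then show "\<mu> A = \<nu> A" using val[OF \<mu> A] val[OF \<nu> A] by simp
  qed
qed

lemma invariant_measure_ex1:
  "\<exists>!\<mu>. probability_measure_on G \<B> \<mu> \<and> left_invariant_measure G \<B> \<mu>"
  using invariant_measure_exists invariant_measure_unique by blast

end

section \<open>Weak almost periodicity\<close>

context invariant_algebra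
begin

abbreviation cfun :: "('a set set \<Rightarrow> complex) set" where
  "cfun \<equiv> cont_fun (type_space G \<B>)"

lemma cfunI:
  "f \<in> extensional (types G \<B>) \<Longrightarrow> continuous_map (type_space G \<B>) euclidean f \<Longrightarrow> f \<in> cfun"
  by (simp add: cont_fun_def)

lemma cfun_ext: "f \<in> cfun \<Longrightarrow> f \<in> extensional (types G \<B>)"
  and cfun_cont: "f \<in> cfun \<Longrightarrow> continuous_map (type_space G \<B>) euclidean f"
  by (simp_all add: cont_fun_def)

lemma cfun_restrict:
  assumes "continuous_map (type_space G \<B>) euclidean f" shows "restrict f (types G \<B>) \<in> cfun"
  by (rule cfunI) (use continuous_map_eq[OF assms, of "restrict f (types G \<B>)"] in auto)

lemma cfun_add: "f \<in> cfun \<Longrightarrow> h \<in> cfun \<Longrightarrow> (\<lambda>x\<in>types G \<B>. f x + h x) \<in> cfun"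
  by (intro cfun_restrict continuous_map_add cfun_cont)

lemma cfun_mult: "f \<in> cfun \<Longrightarrow> (\<lambda>x\<in>types G \<B>. c * f x) \<in> cfun"
  using continuous_map_compose[OF cfun_cont, of f euclidean "\<lambda>z. c * z"]
  by (intro cfun_restrict) (simp add: comp_def continuous_on_mult_left)

definition cut :: "'a set \<Rightarrow> ('a set set \<Rightarrow> complex) \<Rightarrow> 'a set set \<Rightarrow> complex" where
  "cut A f = (\<lambda>q\<in>types G \<B>. if A \<in> q then f q else 0)"

lemma cfun_cut:
  assumes A: "A \<in> \<B>" and f: "f \<in> cfun" shows "cut A f \<in> cfun"
  unfolding cut_def
proof (rule cfun_restrict, unfold continuous_map_def, intro conjI allI impI)
  fix V :: "complex set" assume V: "openin euclidean V"
  have "{q \<in> topspace (type_space G \<B>). (if A \<in> q then f q else 0) \<in> V} =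
      ({q \<in> types G \<B>. A \<in> q} \<inter> {q \<in> topspace (type_space G \<B>). f q \<in> V}) \<union>
      (if 0 \<in> V then {q \<in> types G \<B>. carrier G - A \<in> q} else {})"
    using types_compl A by auto
  moreover have "openin (type_space G \<B>) {q \<in> topspace (type_space G \<B>). f q \<in> V}"
    using cfun_cont[OF f] V by (rule openin_continuous_map_preimage)
  ultimately show "openin (type_space G \<B>) {q \<in> topspace (type_space G \<B>). (if A \<in> q then f q else 0) \<in> V}"
    using openin_basic[OF A] openin_basic[OF compl_sets[OF A]] by (auto intro: openin_Int)
qed simp

definition ind :: "'a set \<Rightarrow> 'a set set \<Rightarrow> complex" where
  "ind A = cut A (\<lambda>q\<in>types G \<B>. 1)"

lemma ind_apply: "q \<in> types G \<B> \<Longrightarrow> ind A q = of_bool (A \<in> q)"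
  by (simp add: ind_def cut_def)

lemma cfun_const: "(\<lambda>q\<in>types G \<B>. c) \<in> cfun"
  by (rule cfun_restrict) simp

lemma cfun_ind: "A \<in> \<B> \<Longrightarrow> ind A \<in> cfun"
  unfolding ind_def by (rule cfun_cut[OF _ cfun_const])

lemma cfun_sup_norm:
  assumes f: "f \<in> cfun" and q: "q \<in> types G \<B>" shows "cmod (f q) \<le> sup_norm (type_space G \<B>) f"
  unfolding sup_norm_def topspace_types
proof (rule cSUP_upper[OF q])
  have "compactin euclidean (f ` types G \<B>)"
    using image_compactin[OF _ cfun_cont[OF f], of "types G \<B>"] compact_types by (simp add: compact_space_def)
  then have "bounded (f ` types G \<B>)" by (simp add: compact_imp_bounded)
  then show "bdd_above ((\<lambda>x. cmod (f x)) ` types G \<B>)" unfolding bounded_iff bdd_above_def by auto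
qed

lemma sup_norm_le:
  assumes "\<And>q. q \<in> types G \<B> \<Longrightarrow> cmod (f q) \<le> c" shows "sup_norm (type_space G \<B>) f \<le> c"
  unfolding sup_norm_def topspace_types
  using types_point[OF one_closed] assms by (intro cSUP_least) auto

lemma mem_sym_diff_type:
  assumes q: "q \<in> types G \<B>" and EF: "E \<in> \<B>" "F \<in> \<B>"
  shows "(E - F) \<union> (F - E) \<in> q \<longleftrightarrow> (E \<in> q) \<noteq> (F \<in> q)"
proof -
  have H: "finite {E, F, (E - F) \<union> (F - E)}" "{E, F, (E - F) \<union> (F - E)} \<subseteq> \<B>" using EF by auto
  from types_realize[OF q H] obtain g where "\<forall>A\<in>{E, F, (E - F) \<union> (F - E)}. g \<in> A \<longleftrightarrow> A \<in> q" by (elim bexE)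
  then show ?thesis by auto
qed

lemma mem_Un_type:
  assumes q: "q \<in> types G \<B>" and EF: "E \<in> \<B>" "F \<in> \<B>"
  shows "E \<union> F \<in> q \<longleftrightarrow> E \<in> q \<or> F \<in> q"
proof -
  have H: "finite {E, F, E \<union> F}" "{E, F, E \<union> F} \<subseteq> \<B>" using EF by auto
  from types_realize[OF q H] obtain g where "\<forall>A\<in>{E, F, E \<union> F}. g \<in> A \<longleftrightarrow> A \<in> q" by (elim bexE)
  then show ?thesis by auto
qed

lemma types_disjoint: "q \<in> types G \<B> \<Longrightarrow> E \<in> \<B> \<Longrightarrow> F \<in> \<B> \<Longrightarrow> E \<inter> F = {} \<Longrightarrow> \<not> (E \<in> q \<and> F \<in> q)"
  using types_Int[of q E F] types_not_empty[of q] by auto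

end

section \<open>The variation of a functional\<close>

locale weak_functional = invariant_algebra +
  fixes L
  assumes L: "L \<in> dual_cont_fun (type_space G \<B>)"
begin

lemma L_add: "f \<in> cfun \<Longrightarrow> h \<in> cfun \<Longrightarrow> L (\<lambda>x\<in>types G \<B>. f x + h x) = L f + L h"
  and L_mult: "f \<in> cfun \<Longrightarrow> L (\<lambda>x\<in>types G \<B>. c * f x) = c * L f"
  using L by (simp_all add: dual_cont_fun_def)

lemma L_diff:
  assumes f: "f \<in> cfun" and h: "h \<in> cfun"
  shows "L (\<lambda>x\<in>types G \<B>. f x - h x) = L f - L h"
proof -
  have "(\<lambda>x\<in>types G \<B>. f x - h x) = (\<lambda>x\<in>types G \<B>. f x + (\<lambda>x\<in>types G \<B>. (-1) * h x) x)" by auto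
  then show ?thesis using L_add[OF f cfun_mult[OF h, of "-1"]] L_mult[OF h, of "-1"] by simp
qed

lemma cfun_diff: "f \<in> cfun \<Longrightarrow> h \<in> cfun \<Longrightarrow> (\<lambda>x\<in>types G \<B>. f x - h x) \<in> cfun"
  by (intro cfun_restrict continuous_map_diff cfun_cont)

definition bnd :: real where
  "bnd = (SOME K. \<forall>f\<in>cfun. cmod (L f) \<le> K * sup_norm (type_space G \<B>) f)"

lemma L_bound:
  assumes f: "f \<in> cfun" and c: "\<And>q. q \<in> types G \<B> \<Longrightarrow> cmod (f q) \<le> c"
  shows "cmod (L f) \<le> \<bar>bnd\<bar> * c"
proof -
  have "\<exists>K. \<forall>f\<in>cfun. cmod (L f) \<le> K * sup_norm (type_space G \<B>) f" using L by (simp add: dual_cont_fun_def)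
  then have "\<forall>f\<in>cfun. cmod (L f) \<le> bnd * sup_norm (type_space G \<B>) f" unfolding bnd_def by (rule someI_ex)
  then have "cmod (L f) \<le> bnd * sup_norm (type_space G \<B>) f" using f by blast
  \<comment> \<open>The chosen bound \<open>bnd\<close> comes without a sign, while the norm is
    nonnegative.\<close>
  also have "\<dots> \<le> \<bar>bnd\<bar> * sup_norm (type_space G \<B>) f"
    using order_trans[OF norm_ge_zero cfun_sup_norm[OF f types_point[OF one_closed]]] by (intro mult_right_mono) auto
  also have "\<dots> \<le> \<bar>bnd\<bar> * c" using sup_norm_le[OF c] by (intro mult_left_mono) auto
  finally show ?thesis .
qed

definition adm :: "'a set \<Rightarrow> ('a set set \<Rightarrow> complex) set" where
  "adm Z = {g \<in> cfun. \<forall>q\<in>types G \<B>. cmod (g q) \<le> of_bool (Z \<in> q)}"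

text \<open>The total variation, on the clopen set given by \<open>Z\<close>, of the measure
  representing \<open>L\<close>, expressed through \<open>L\<close> alone by test functions
  dominated by the indicator.\<close>

definition variation :: "'a set \<Rightarrow> real" where
  "variation Z = (SUP g\<in>adm Z. cmod (L g))"

lemma variation_upper:
  assumes "g \<in> adm Z" shows "cmod (L g) \<le> variation Z"
  unfolding variation_def
proof (rule cSUP_upper[OF assms])
  have "cmod (L g) \<le> \<bar>bnd\<bar> * 1" if "g \<in> adm Z" for g
  proof (rule L_bound)
    fix q assume "q \<in> types G \<B>"
    then have "cmod (g q) \<le> of_bool (Z \<in> q)" using that by (simp add: adm_def)
    also have "\<dots> \<le> 1" by simp
    finally show "cmod (g q) \<le> 1" .
  qed (use that in \<open>simp add: adm_def\<close>)
  then show "bdd_above ((\<lambda>g. cmod (L g)) ` adm Z)" by (rule bdd_aboveI2)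
qed

lemma adm_nonempty: "adm Z \<noteq> {}"
proof -
  have "(\<lambda>q\<in>types G \<B>. 0) \<in> adm Z" using cfun_const[of 0] by (simp add: adm_def)
  then show ?thesis by blast
qed

lemma variation_least: "(\<And>g. g \<in> adm Z \<Longrightarrow> cmod (L g) \<le> c) \<Longrightarrow> variation Z \<le> c"
  unfolding variation_def using adm_nonempty by (rule cSUP_least)

lemma variation_additive: "finitely_additive (carrier G) \<B> variation"
proof
  show "0 \<le> variation E" for E
  proof -
    obtain g where "g \<in> adm E" using adm_nonempty by blast
    from order_trans[OF norm_ge_zero variation_upper[OF this]] show ?thesis .
  qed
  fix E F assume E: "E \<in> \<B>" and F: "F \<in> \<B>" and disj: "E \<inter> F = {}"
  have sup: "cmod (L g) + cmod (L h) \<le> variation (E \<union> F)" if g: "g \<in> adm E" and h: "h \<in> adm F" for g h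
  proof -
    \<comment> \<open>The phase that turns \<open>L g\<close> into its modulus; at zero, division by
      zero makes it zero, hence only \<open>cmod (ph z) \<le> 1\<close>. Two rotated test functions
      with disjoint supports add up to one on which \<open>L\<close> takes the sum of the
      moduli.\<close>
    define ph where "ph z = cnj z / complex_of_real (cmod z)" for z
    have ph: "ph z * z = complex_of_real (cmod z)" "cmod (ph z) \<le> 1" for z
      by (simp_all add: ph_def complex_norm_square[symmetric] mult.commute[of "cnj z"] power2_eq_square norm_divide)
    let ?g = "\<lambda>q\<in>types G \<B>. ph (L g) * g q" and ?h = "\<lambda>q\<in>types G \<B>. ph (L h) * h q"
    let ?s = "\<lambda>q\<in>types G \<B>. ?g q + ?h q"
    have gh: "g \<in> cfun" "h \<in> cfun" using g h by (simp_all add: adm_def)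
    have c: "?g \<in> cfun" "?h \<in> cfun" using gh by (simp_all only: cfun_mult)
    have "cmod (?s q) \<le> of_bool (E \<union> F \<in> q)" if q: "q \<in> types G \<B>" for q
    proof -
      have gq: "cmod (g q) \<le> of_bool (E \<in> q)" "cmod (h q) \<le> of_bool (F \<in> q)"
        using g h q by (auto simp: adm_def)
      have "cmod (?s q) \<le> cmod (ph (L g)) * cmod (g q) + cmod (ph (L h)) * cmod (h q)"
        using q norm_triangle_ineq[of "ph (L g) * g q" "ph (L h) * h q"] by (simp add: norm_mult)
      also have "\<dots> \<le> 1 * cmod (g q) + 1 * cmod (h q)"
        by (intro add_mono mult_right_mono ph(2)) auto
      also have "\<dots> \<le> of_bool (E \<in> q) + of_bool (F \<in> q)" using gq by simp
      also have "\<dots> = of_bool (E \<union> F \<in> q)"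
        using mem_Un_type[OF q E F] types_disjoint[OF q E F disj] by auto
      finally show ?thesis .
    qed
    then have "?s \<in> adm (E \<union> F)" using cfun_add[OF c] by (simp add: adm_def)
    then have "cmod (L ?s) \<le> variation (E \<union> F)" by (rule variation_upper)
    moreover have "L ?s = L ?g + L ?h" by (rule L_add[OF c])
    moreover have "L ?g = complex_of_real (cmod (L g))" "L ?h = complex_of_real (cmod (L h))"
      using L_mult[OF gh(1)] L_mult[OF gh(2)] ph(1) by simp_all
    moreover have "cmod (complex_of_real (cmod (L g)) + complex_of_real (cmod (L h))) = cmod (L g) + cmod (L h)"
      unfolding of_real_add[symmetric] norm_of_real by simp
    ultimately show ?thesis by simp
  qed
  \<comment> \<open>The supremum is taken over \<open>g\<close> with \<open>h\<close> fixed, and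
    afterwards over \<open>h\<close>.\<close>
  have "variation E \<le> variation (E \<union> F) - cmod (L h)" if h: "h \<in> adm F" for h
    using sup[OF _ h] by (intro variation_least) (simp add: le_diff_eq)
  then have "variation F \<le> variation (E \<union> F) - variation E"
    by (intro variation_least) (simp add: le_diff_eq add.commute)
  moreover have "variation (E \<union> F) \<le> variation E + variation F"
  proof (rule variation_least)
    fix g assume g: "g \<in> adm (E \<union> F)"
    then have gc: "g \<in> cfun" and gq: "\<And>q. q \<in> types G \<B> \<Longrightarrow> cmod (g q) \<le> of_bool (E \<union> F \<in> q)"
      by (simp_all add: adm_def)
    have "g = (\<lambda>q\<in>types G \<B>. cut E g q + cut F g q)"
    proof (rule extensionalityI[OF cfun_ext[OF gc]])
      fix q assume q: "q \<in> types G \<B>"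
      show "g q = (\<lambda>q\<in>types G \<B>. cut E g q + cut F g q) q"
        using q gq[OF q] mem_Un_type[OF q E F] types_disjoint[OF q E F disj] by (auto simp: cut_def)
    qed simp
    then have "L g = L (cut E g) + L (cut F g)" using L_add[OF cfun_cut[OF E gc] cfun_cut[OF F gc]] by simp
    moreover have "cut E g \<in> adm E"
      using cfun_cut[OF E gc] order_trans[OF gq] by (auto simp: adm_def cut_def)
    moreover have "cut F g \<in> adm F"
      using cfun_cut[OF F gc] order_trans[OF gq] by (auto simp: adm_def cut_def)
    ultimately show "cmod (L g) \<le> variation E + variation F"
      using variation_upper norm_triangle_ineq[of "L (cut E g)" "L (cut F g)"] by (smt (verit))
  qed
  ultimately show "variation (E \<union> F) = variation E + variation F" by simp
qed

lemma ind_diff_variation: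
  assumes E: "E \<in> \<B>" and F: "F \<in> \<B>"
  shows "cmod (L (ind E) - L (ind F)) \<le> variation ((E - F) \<union> (F - E))"
proof -
  let ?g = "\<lambda>q\<in>types G \<B>. ind E q - ind F q"
  have "?g \<in> adm ((E - F) \<union> (F - E))"
    using cfun_diff[OF cfun_ind[OF E] cfun_ind[OF F]] mem_sym_diff_type[OF _ E F]
    by (auto simp: adm_def ind_apply)
  from variation_upper[OF this] show ?thesis using L_diff[OF cfun_ind[OF E] cfun_ind[OF F]] by simp
qed

end

section \<open>Weak continuity of translation\<close>

context stable_extension
begin

definition translate :: "('a set set \<Rightarrow> complex) \<Rightarrow> 'a set set \<Rightarrow> 'a set set \<Rightarrow> complex" where
  "translate f r = (\<lambda>q\<in>types G \<B>. f (type_mult G \<B> r q))"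

lemma cfun_translate:
  assumes f: "f \<in> B.cfun" and r: "r \<in> types G \<C>" shows "translate f r \<in> B.cfun"
  unfolding translate_def
  by (rule B.cfun_restrict)
    (rule continuous_map_compose[OF continuous_type_mult_right[OF r] B.cfun_cont[OF f], unfolded comp_def])

text \<open>Exchange again: a translated indicator is the indicator of a limit set, which lies in
  \<B>.\<close>

lemma translate_ind:
  assumes A: "A \<in> \<B>" and r: "r \<in> types G \<C>" shows "translate (B.ind A) r = B.ind (type_e G r A)"
proof (rule extensionalityI[of _ "types G \<B>"])
  show "translate (B.ind A) r \<in> extensional (types G \<B>)" by (simp add: translate_def)
  show "B.ind (type_e G r A) \<in> extensional (types G \<B>)" by (simp add: B.ind_def B.cut_def)
  fix q assume q: "q \<in> types G \<B>"
  show "translate (B.ind A) r q = B.ind (type_e G r A) q"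
    using q type_mult_closed[OF r q] exchange_ext[OF r q A] A
    by (simp add: translate_def B.ind_apply mem_type_mult)
qed

text \<open>Continuity in terms of basic neighbourhoods, so that sums, multiples and uniform limits
  are settled by estimates.\<close>

definition continuous_type_fun :: "('a set set \<Rightarrow> complex) \<Rightarrow> bool" where
  "continuous_type_fun F \<longleftrightarrow> (\<forall>r\<in>types G \<C>. \<forall>\<epsilon>>0. \<exists>N\<in>r. \<forall>s\<in>types G \<C>. N \<in> s \<longrightarrow> cmod (F s - F r) < \<epsilon>)"

lemma continuous_type_fun_add:
  assumes "continuous_type_fun F" "continuous_type_fun F'"
  shows "continuous_type_fun (\<lambda>r. F r + F' r)"
  unfolding continuous_type_fun_def
proof (intro ballI allI impI)
  fix r \<epsilon> assume r: "r \<in> types G \<C>" and \<epsilon>: "(0::real) < \<epsilon>"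
  then have e2: "\<epsilon> / 2 > 0" by simp
  obtain N N' where N: "N \<in> r" "\<forall>s\<in>types G \<C>. N \<in> s \<longrightarrow> cmod (F s - F r) < \<epsilon> / 2"
    "N' \<in> r" "\<forall>s\<in>types G \<C>. N' \<in> s \<longrightarrow> cmod (F' s - F' r) < \<epsilon> / 2"
    using assms r e2 unfolding continuous_type_fun_def by metis
  have NC: "N \<in> \<C>" "N' \<in> \<C>" using N C.types_subset[OF r] by auto
  show "\<exists>N\<in>r. \<forall>s\<in>types G \<C>. N \<in> s \<longrightarrow> cmod (F s + F' s - (F r + F' r)) < \<epsilon>"
  proof (intro bexI[of _ "N \<inter> N'"] ballI impI)
    show "N \<inter> N' \<in> r" using N C.types_Int[OF r NC] by simp
    fix s assume s: "s \<in> types G \<C>" "N \<inter> N' \<in> s"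
    then have "N \<in> s" "N' \<in> s" using C.types_Int[OF s(1) NC] by auto
    then have "cmod (F s - F r) < \<epsilon> / 2" "cmod (F' s - F' r) < \<epsilon> / 2" using N s(1) by auto
    moreover have "cmod (F s + F' s - (F r + F' r)) = cmod ((F s - F r) + (F' s - F' r))" by (simp add: algebra_simps)
    ultimately show "cmod (F s + F' s - (F r + F' r)) < \<epsilon>"
      using norm_triangle_ineq[of "F s - F r" "F' s - F' r"] by linarith
  qed
qed

lemma continuous_type_fun_mult:
  assumes "continuous_type_fun F" shows "continuous_type_fun (\<lambda>r. c * F r)"
  unfolding continuous_type_fun_def
proof (intro ballI allI impI)
  fix r \<epsilon> assume r: "r \<in> types G \<C>" and \<epsilon>: "(0::real) < \<epsilon>"
  have d: "0 < \<epsilon> / (cmod c + 1)" using \<epsilon> by (simp add: add_nonneg_pos)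
  then obtain N where N: "N \<in> r" "\<forall>s\<in>types G \<C>. N \<in> s \<longrightarrow> cmod (F s - F r) < \<epsilon> / (cmod c + 1)"
    using assms r unfolding continuous_type_fun_def by metis
  have "cmod (c * F s - c * F r) < \<epsilon>" if "s \<in> types G \<C>" "N \<in> s" for s
  proof -
    have "cmod (c * F s - c * F r) = cmod c * cmod (F s - F r)" by (simp add: norm_mult[symmetric] right_diff_distrib)
    also have "\<dots> \<le> cmod c * (\<epsilon> / (cmod c + 1))" using N that by (intro mult_left_mono) (auto intro: less_imp_le)
    also have "\<dots> < (cmod c + 1) * (\<epsilon> / (cmod c + 1))" using d by (intro mult_strict_right_mono) auto
    also have "\<dots> = \<epsilon>" using add_nonneg_pos[of "cmod c" 1] by simp
    finally show ?thesis .
  qed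
  then show "\<exists>N\<in>r. \<forall>s\<in>types G \<C>. N \<in> s \<longrightarrow> cmod (c * F s - c * F r) < \<epsilon>" using N(1) by blast
qed

lemma continuous_type_fun_limit:
  assumes "\<And>\<epsilon>. 0 < \<epsilon> \<Longrightarrow> \<exists>F'. continuous_type_fun F' \<and> (\<forall>r\<in>types G \<C>. cmod (F r - F' r) \<le> \<epsilon>)"
  shows "continuous_type_fun F"
  unfolding continuous_type_fun_def
proof (intro ballI allI impI)
  fix r \<epsilon> assume r: "r \<in> types G \<C>" and \<epsilon>: "(0::real) < \<epsilon>"
  then have e: "\<epsilon> / 3 > 0" by simp
  obtain F' where F': "continuous_type_fun F'" "\<forall>r\<in>types G \<C>. cmod (F r - F' r) \<le> \<epsilon> / 3"
    using assms[OF e] by blast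
  obtain N where N: "N \<in> r" "\<forall>s\<in>types G \<C>. N \<in> s \<longrightarrow> cmod (F' s - F' r) < \<epsilon> / 3"
    using F'(1) r e unfolding continuous_type_fun_def by metis
  have "cmod (F s - F r) < \<epsilon>" if s: "s \<in> types G \<C>" "N \<in> s" for s
  proof -
    have "F s - F r = (F s - F' s) + (F' s - F' r) + (F' r - F r)" by simp
    then have "cmod (F s - F r) \<le> cmod (F s - F' s) + cmod (F' s - F' r) + cmod (F' r - F r)"
      by (metis norm_triangle_mono norm_triangle_ineq order_refl)
    moreover have "cmod (F s - F' s) \<le> \<epsilon> / 3" "cmod (F' r - F r) \<le> \<epsilon> / 3" "cmod (F' s - F' r) < \<epsilon> / 3"
      using F'(2) s r N(2) by (auto simp: norm_minus_commute)
    ultimately show ?thesis by simp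
  qed
  then show "\<exists>N\<in>r. \<forall>s\<in>types G \<C>. N \<in> s \<longrightarrow> cmod (F s - F r) < \<epsilon>" using N(1) by blast
qed

lemma continuous_map_type_fun:
  assumes "continuous_type_fun F" shows "continuous_map (type_space G \<C>) euclidean F"
  unfolding continuous_map_def
proof (intro conjI allI impI)
  fix V :: "complex set" assume "openin euclidean V"
  then have V: "open V" by simp
  show "openin (type_space G \<C>) {r \<in> topspace (type_space G \<C>). F r \<in> V}"
    unfolding C.openin_types_iff
  proof (intro conjI ballI)
    fix r assume "r \<in> {r \<in> topspace (type_space G \<C>). F r \<in> V}"
    then have r: "r \<in> types G \<C>" "F r \<in> V" by auto
    obtain \<epsilon> where \<epsilon>: "\<epsilon> > 0" "\<And>z. dist z (F r) < \<epsilon> \<Longrightarrow> z \<in> V" using V r(2) unfolding open_dist by blast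
    obtain N where N: "N \<in> r" "\<forall>s\<in>types G \<C>. N \<in> s \<longrightarrow> cmod (F s - F r) < \<epsilon>"
      using assms r(1) \<epsilon>(1) unfolding continuous_type_fun_def by metis
    then show "\<exists>A\<in>r. {q \<in> types G \<C>. A \<in> q} \<subseteq> {r \<in> topspace (type_space G \<C>). F r \<in> V}"
      using \<epsilon>(2) by (intro bexI[of _ N]) (auto simp: dist_norm)
  qed auto
qed simp

text \<open>For all \<open>x\<close> in some member of \<open>r\<close>, the value at
  \<open>inv x <# A\<close> is close to the value at the limit set. Otherwise \<open>r\<close> and
  the set of bad \<open>x\<close> would extend to an ultrafilter, along which the variation of the
  symmetric differences becomes small.\<close>

lemma continuous_translate_ind:
  assumes L: "L \<in> dual_cont_fun (type_space G \<B>)" and A: "A \<in> \<B>"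
  shows "continuous_type_fun (\<lambda>r. L (translate (B.ind A) r))"
proof -
  interpret L: weak_functional G \<B> L by unfold_locales (rule L)
  interpret P: invariant_algebra G "Pow (carrier G)" by (rule invariant_algebra_Pow)
  have Ac: "A \<subseteq> carrier G" using A by (rule B.in_carrier)
  have AC: "A \<in> \<C>" using A subset by blast
  have tB: "inv x <# A \<in> \<B>" if "x \<in> carrier G" for x using that A B.l_coset_in by simp
  have near: "\<exists>N\<in>r. \<forall>x\<in>N. cmod (L (B.ind (inv x <# A)) - L (B.ind (type_e G r A))) < \<epsilon>"
    if r: "r \<in> types G \<C>" and \<epsilon>: "0 < \<epsilon>" for r \<epsilon>
  proof (rule ccontr)
    assume neg: "\<not> ?thesis"
    define W where "W = {x \<in> carrier G. \<not> cmod (L (B.ind (inv x <# A)) - L (B.ind (type_e G r A))) < \<epsilon>}"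
    have "\<exists>U\<in>types G (Pow (carrier G)). insert W r \<subseteq> U"
    proof (rule P.types_extend)
      show "insert W r \<subseteq> Pow (carrier G)" using C.types_subset[OF r] C.in_carrier by (auto simp: W_def)
      fix F assume F: "finite F" "F \<subseteq> insert W r"
      then have "finite (F - {W})" "F - {W} \<subseteq> r" by auto
      then have N: "carrier G \<inter> \<Inter>(F - {W}) \<in> r" using C.types_Inter[OF _ r] by blast
      have "\<exists>x\<in>carrier G \<inter> \<Inter>(F - {W}). \<not> cmod (L (B.ind (inv x <# A)) - L (B.ind (type_e G r A))) < \<epsilon>"
        using neg N by meson
      then obtain x where x: "x \<in> carrier G" "\<forall>E\<in>F - {W}. x \<in> E" "x \<in> W" by (auto simp: W_def)
      then show "\<exists>x\<in>carrier G. \<forall>E\<in>F. x \<in> E" by blast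
    qed
    then obtain U where U: "U \<in> types G (Pow (carrier G))" "W \<in> U" "r \<subseteq> U" by (elim bexE) simp
    \<comment> \<open>\<open>U\<close> decides the sets of \<C>, among them the right translates of
      \<open>A\<close>, as \<open>r\<close> does, so both have the same limit set.\<close>
    have iff: "E \<in> U \<longleftrightarrow> E \<in> r" if E: "E \<in> \<C>" for E
      using that U(3) C.types_compl[OF r E] P.types_compl[OF U(1), of E] C.in_carrier[OF E] by blast
    have e: "type_e G U A = type_e G r A" using iff C.r_coset_in[OF _ AC] by (auto simp: type_e_def)
    define Z where "Z x = ((inv x <# A) - type_e G U A) \<union> (type_e G U A - (inv x <# A))" for x
    have "{x \<in> carrier G. L.variation (Z x) < \<epsilon>} \<in> U"
      by (rule measure_translate_limit[OF B.invariant_algebra_axioms L.variation_additive A B.stable[OF A] U(1) \<epsilon> Z_def])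
    then have "{x \<in> carrier G. L.variation (Z x) < \<epsilon>} \<inter> W \<in> U"
      using U P.types_Int[OF U(1), of "{x \<in> carrier G. L.variation (Z x) < \<epsilon>}" W] by (auto simp: W_def)
    then have "{x \<in> carrier G. L.variation (Z x) < \<epsilon>} \<inter> W \<noteq> {}" using P.types_not_empty[OF U(1)] by metis
    then obtain x where x: "x \<in> carrier G" "L.variation (Z x) < \<epsilon>" "x \<in> W" by blast
    have "cmod (L (B.ind (inv x <# A)) - L (B.ind (type_e G r A))) \<le> L.variation (Z x)"
      unfolding Z_def e by (rule L.ind_diff_variation[OF tB[OF x(1)] type_e_in_B[OF r A]])
    then show False using x by (simp add: W_def)
  qed
  show ?thesis
    unfolding continuous_type_fun_def
  proof (intro ballI allI impI)
    fix r \<epsilon> assume r: "r \<in> types G \<C>" and \<epsilon>: "(0::real) < \<epsilon>"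
    then have e2: "\<epsilon> / 2 > 0" by simp
    let ?i = "\<lambda>x. L (B.ind (inv x <# A))" and ?e = "\<lambda>r. L (B.ind (type_e G r A))"
    from near[OF r e2] obtain N where N: "N \<in> r" "\<forall>x\<in>N. cmod (?i x - ?e r) < \<epsilon> / 2" by (elim bexE)
    have "cmod (?e s - ?e r) < \<epsilon>" if s: "s \<in> types G \<C>" "N \<in> s" for s
    proof -
      \<comment> \<open>The types \<open>r\<close> and \<open>s\<close> are compared through a group
        element common to members of both: the value at its translate is close to both
        limits.\<close>
      from near[OF s(1) e2] obtain N' where N': "N' \<in> s" "\<forall>x\<in>N'. cmod (?i x - ?e s) < \<epsilon> / 2" by (elim bexE)
      have "N \<inter> N' \<in> s" using s N'(1) C.types_Int[OF s(1)] C.types_subset[OF s(1)] by blast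
      then have "N \<inter> N' \<noteq> {}" using C.types_not_empty[OF s(1)] by metis
      then obtain x where "x \<in> N" "x \<in> N'" by blast
      then have "cmod (?i x - ?e r) < \<epsilon> / 2" "cmod (?i x - ?e s) < \<epsilon> / 2" using N N' by auto
      moreover have "?e s - ?e r = (?i x - ?e r) - (?i x - ?e s)" by simp
      ultimately show ?thesis using norm_triangle_ineq4[of "?i x - ?e r" "?i x - ?e s"] by simp
    qed
    then show "\<exists>N\<in>r. \<forall>s\<in>types G \<C>. N \<in> s \<longrightarrow> cmod (L (translate (B.ind A) s) - L (translate (B.ind A) r)) < \<epsilon>"
      using N(1) r translate_ind[OF A] by (intro bexI[of _ N]) simp_all
  qed
qed

text \<open>Functions with finitely many values are uniformly dense and are combinations of
  indicators; boundedness of \<open>L\<close> carries continuity over to uniform limits.\<close>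

lemma continuous_translate:
  assumes L: "L \<in> dual_cont_fun (type_space G \<B>)" and f: "f \<in> B.cfun"
  shows "continuous_type_fun (\<lambda>r. L (translate f r))"
proof -
  interpret L: weak_functional G \<B> L by unfold_locales (rule L)
  let ?K = "types G \<B>"
  define good where "good f \<longleftrightarrow> f \<in> B.cfun \<and> continuous_type_fun (\<lambda>r. L (translate f r))" for f
  \<comment> \<open>Every cut-off is required to be good as well, so that functions stay
    \<open>simple\<close> when the construction of step functions cuts them.\<close>
  define simple where "simple f \<longleftrightarrow> f \<in> B.cfun \<and> (\<forall>A\<in>\<B>. good (B.cut A f))" for f
  have good_add: "good (\<lambda>q\<in>?K. f q + h q)" if "good f" "good h" for f h
  proof -
    have fh: "f \<in> B.cfun" "h \<in> B.cfun" using that by (auto simp: good_def)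
    have "L (translate (\<lambda>q\<in>?K. f q + h q) r) = L (translate f r) + L (translate h r)" if r: "r \<in> types G \<C>" for r
    proof -
      have "translate (\<lambda>q\<in>?K. f q + h q) r = (\<lambda>q\<in>?K. translate f r q + translate h r q)"
        using type_mult_closed[OF r] by (auto simp: translate_def)
      then show ?thesis using L.L_add[OF cfun_translate[OF fh(1) r] cfun_translate[OF fh(2) r]] by simp
    qed
    moreover have "continuous_type_fun (\<lambda>r. L (translate f r) + L (translate h r))"
      using that by (intro continuous_type_fun_add) (auto simp: good_def)
    ultimately show ?thesis using B.cfun_add[OF fh] by (simp add: good_def continuous_type_fun_def)
  qed
  have good_mult: "good (\<lambda>q\<in>?K. c * f q)" if "good f" for c f
  proof -
    have f: "f \<in> B.cfun" using that by (auto simp: good_def)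
    have "L (translate (\<lambda>q\<in>?K. c * f q) r) = c * L (translate f r)" if r: "r \<in> types G \<C>" for r
    proof -
      have "translate (\<lambda>q\<in>?K. c * f q) r = (\<lambda>q\<in>?K. c * translate f r q)"
        using type_mult_closed[OF r] by (auto simp: translate_def)
      then show ?thesis using L.L_mult[OF cfun_translate[OF f r]] by simp
    qed
    moreover have "continuous_type_fun (\<lambda>r. c * L (translate f r))"
      using that by (intro continuous_type_fun_mult) (auto simp: good_def)
    ultimately show ?thesis using B.cfun_mult[OF f] by (simp add: good_def continuous_type_fun_def)
  qed
  have good_ind: "good (B.ind A)" if "A \<in> \<B>" for A
    using continuous_translate_ind[OF L that] B.cfun_ind[OF that] by (simp add: good_def)
  have simple_const: "simple (\<lambda>q\<in>?K. c)" for c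
    unfolding simple_def
  proof (intro conjI ballI)
    fix A assume "A \<in> \<B>"
    then have "good (\<lambda>q\<in>?K. c * B.ind A q)" by (intro good_mult good_ind)
    moreover have "B.cut A (\<lambda>q\<in>?K. c) = (\<lambda>q\<in>?K. c * B.ind A q)" by (auto simp: B.cut_def B.ind_apply)
    ultimately show "good (B.cut A (\<lambda>q\<in>?K. c))" by simp
  qed (rule B.cfun_const)
  have simple_cut: "simple (B.cut A f)" if A: "A \<in> \<B>" and f: "simple f" for A f
    unfolding simple_def
  proof (intro conjI ballI)
    show "B.cut A f \<in> B.cfun" using f by (intro B.cfun_cut[OF A]) (simp add: simple_def)
    fix E assume E: "E \<in> \<B>"
    have "B.cut E (B.cut A f) = B.cut (E \<inter> A) f" using B.types_Int[OF _ E A] by (auto simp: B.cut_def)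
    then show "good (B.cut E (B.cut A f))" using f B.Int[OF E A] by (simp add: simple_def)
  qed
  have simple_add: "simple (\<lambda>q\<in>?K. f q + h q)" if "simple f" "simple h" for f h
    unfolding simple_def
  proof (intro conjI ballI)
    show "(\<lambda>q\<in>?K. f q + h q) \<in> B.cfun" using that by (intro B.cfun_add) (auto simp: simple_def)
    fix E assume "E \<in> \<B>"
    then have "good (\<lambda>q\<in>?K. B.cut E f q + B.cut E h q)" using that by (intro good_add) (auto simp: simple_def)
    moreover have "B.cut E (\<lambda>q\<in>?K. f q + h q) = (\<lambda>q\<in>?K. B.cut E f q + B.cut E h q)" by (auto simp: B.cut_def)
    ultimately show "good (B.cut E (\<lambda>q\<in>?K. f q + h q))" by simp
  qed
  have simple_good: "good f" if "simple f" for f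
  proof -
    have "B.cut (carrier G) f = f"
    proof (rule extensionalityI[of _ ?K])
      show "f \<in> extensional ?K" using that B.cfun_ext by (simp add: simple_def)
    qed (auto simp: B.cut_def B.types_carrier)
    then show ?thesis using that B.carrier_in by (metis simple_def)
  qed
  \<comment> \<open>The sets of \<open>S\<close> may overlap: it is enough that the value at
    \<open>q\<close> is the constant of some member of \<open>q\<close>, since each constant
    approximates \<open>f\<close> on its own set.\<close>
  have approx: "\<exists>h. simple h \<and> (\<forall>q\<in>?K. \<forall>A\<in>S. A \<in> q \<longrightarrow> (\<exists>E\<in>S. E \<in> q \<and> h q = c E))"
    if "finite S" "S \<subseteq> \<B>" for S and c :: "'a set \<Rightarrow> complex"
    using that
  proof (induction S rule: finite_induct)
    case empty then show ?case using simple_const[of 0] by blast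
  next
    case (insert A S)
    have A: "A \<in> \<B>" "carrier G - A \<in> \<B>" using insert.prems by auto
    have "S \<subseteq> \<B>" using insert.prems by simp
    from insert.IH[OF this] obtain h where h: "simple h" "\<forall>q\<in>?K. \<forall>A\<in>S. A \<in> q \<longrightarrow> (\<exists>E\<in>S. E \<in> q \<and> h q = c E)"
      by (elim exE conjE)
    define h' where "h' = (\<lambda>q\<in>?K. B.cut A (\<lambda>q\<in>?K. c A) q + B.cut (carrier G - A) h q)"
    have "simple h'" unfolding h'_def by (intro simple_add simple_cut simple_const A h)
    moreover have val: "h' q = (if A \<in> q then c A else h q)" if "q \<in> ?K" for q
      using that B.types_compl[OF that A(1)] by (simp add: h'_def B.cut_def)
    have "\<exists>E\<in>insert A S. E \<in> q \<and> h' q = c E" if q: "q \<in> ?K" "E \<in> insert A S" "E \<in> q" for q E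
    proof (cases "A \<in> q")
      case True then show ?thesis using val[OF q(1)] by simp
    next
      case False
      then have "E \<in> S" using q by auto
      then obtain E' where "E' \<in> S" "E' \<in> q" "h q = c E'" using h(2) q by blast
      then show ?thesis using val[OF q(1)] False by auto
    qed
    ultimately show ?case by blast
  qed
  have dense: "\<exists>h. simple h \<and> (\<forall>q\<in>?K. cmod (f q - h q) \<le> \<epsilon>)" if \<epsilon>: "0 < \<epsilon>" for \<epsilon>
  proof -
    define ok where "ok A c \<longleftrightarrow> (\<forall>q\<in>?K. A \<in> q \<longrightarrow> cmod (f q - c) < \<epsilon>)" for A c
    define \<G> where "\<G> = {A \<in> \<B>. \<exists>c. ok A c}"
    have "?K \<subseteq> \<Union>((\<lambda>A. {q \<in> ?K. A \<in> q}) ` \<G>)"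
    proof
      fix p assume p: "p \<in> ?K"
      have "openin (type_space G \<B>) {q \<in> topspace (type_space G \<B>). f q \<in> ball (f p) \<epsilon>}"
        by (rule openin_continuous_map_preimage[OF B.cfun_cont[OF f]]) simp
      moreover have "p \<in> {q \<in> topspace (type_space G \<B>). f q \<in> ball (f p) \<epsilon>}" using p \<epsilon> by simp
      ultimately obtain A where A: "A \<in> p" "{q \<in> ?K. A \<in> q} \<subseteq> {q \<in> topspace (type_space G \<B>). f q \<in> ball (f p) \<epsilon>}"
        unfolding B.openin_types_iff by blast
      then have "ok A (f p)" by (auto simp: ok_def dist_norm norm_minus_commute)
      then have "A \<in> \<G>" using B.types_subset[OF p A(1)] by (auto simp: \<G>_def)
      then show "p \<in> \<Union>((\<lambda>A. {q \<in> ?K. A \<in> q}) ` \<G>)" using p A(1) by blast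
    qed
    moreover have "compactin (type_space G \<B>) ?K" using B.compact_types by (simp add: compact_space_def)
    moreover have "\<forall>V\<in>(\<lambda>A. {q \<in> ?K. A \<in> q}) ` \<G>. openin (type_space G \<B>) V"
      using B.openin_basic by (auto simp: \<G>_def)
    ultimately obtain \<F> where F: "finite \<F>" "\<F> \<subseteq> (\<lambda>A. {q \<in> ?K. A \<in> q}) ` \<G>" "?K \<subseteq> \<Union>\<F>"
      unfolding compactin_def by meson
    from finite_subset_image[OF F(1,2)] obtain S where S: "S \<subseteq> \<G>" "finite S" "\<F> = (\<lambda>A. {q \<in> ?K. A \<in> q}) ` S"
      by (elim exE conjE)
    define c where "c A = (SOME c. ok A c)" for A
    have ok: "ok A (c A)" if "A \<in> S" for A
      using S(1) that someI_ex[of "ok A"] by (auto simp: \<G>_def c_def)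
    have "S \<subseteq> \<B>" using S(1) by (auto simp: \<G>_def)
    from approx[OF S(2) this, of c]
    obtain h where h: "simple h" "\<forall>q\<in>?K. \<forall>A\<in>S. A \<in> q \<longrightarrow> (\<exists>E\<in>S. E \<in> q \<and> h q = c E)"
      by (elim exE conjE)
    have "cmod (f q - h q) \<le> \<epsilon>" if q: "q \<in> ?K" for q
    proof -
      have "q \<in> \<Union>\<F>" using q F(3) by blast
      then obtain A where "A \<in> S" "A \<in> q" unfolding S(3) by blast
      then obtain E where "E \<in> S" "E \<in> q" "h q = c E" using h(2) q by blast
      then show ?thesis using ok[of E] q by (auto simp: ok_def intro: less_imp_le)
    qed
    then show ?thesis using h(1) by blast
  qed
  show ?thesis
  proof (rule continuous_type_fun_limit)
    fix \<epsilon> :: real assume \<epsilon>: "0 < \<epsilon>"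
    \<comment> \<open>The summand one keeps the denominator positive when the bound is zero.\<close>
    define \<delta> where "\<delta> = \<epsilon> / (\<bar>L.bnd\<bar> + 1)"
    have \<delta>: "0 < \<delta>" using \<epsilon> by (simp add: \<delta>_def add_nonneg_pos)
    from dense[OF this] obtain h where h: "simple h" "\<forall>q\<in>?K. cmod (f q - h q) \<le> \<delta>" by (elim exE conjE)
    have hg: "good h" using h(1) by (rule simple_good)
    then have hc: "h \<in> B.cfun" by (simp add: good_def)
    have "cmod (L (translate f r) - L (translate h r)) \<le> \<epsilon>" if r: "r \<in> types G \<C>" for r
    proof -
      note t = cfun_translate[OF f r] cfun_translate[OF hc r]
      have "cmod (L (\<lambda>q\<in>?K. translate f r q - translate h r q)) \<le> \<bar>L.bnd\<bar> * \<delta>"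
      proof (rule L.L_bound[OF L.cfun_diff[OF t]])
        fix q assume q: "q \<in> ?K"
        then show "cmod ((\<lambda>q\<in>?K. translate f r q - translate h r q) q) \<le> \<delta>"
          using h(2) type_mult_closed[OF r q] by (simp add: translate_def)
      qed
      also have "\<dots> \<le> (\<bar>L.bnd\<bar> + 1) * \<delta>" using \<delta> by (intro mult_right_mono) auto
      also have "\<dots> = \<epsilon>" using add_nonneg_pos[of "\<bar>L.bnd\<bar>" 1] by (simp add: \<delta>_def)
      finally show ?thesis using L.L_diff[OF t] by simp
    qed
    then show "\<exists>F'. continuous_type_fun F' \<and> (\<forall>r\<in>types G \<C>. cmod (L (translate f r) - F' r) \<le> \<epsilon>)"
      using hg by (intro exI[of _ "\<lambda>r. L (translate h r)"]) (simp add: good_def)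
  qed
qed

lemma topspace_weak: "topspace (weak_topology (type_space G \<B>)) = B.cfun"
proof -
  \<comment> \<open>The zero functional with the whole plane exhibits the space itself as a
    generating open set.\<close>
  have "(\<lambda>f. 0) \<in> dual_cont_fun (type_space G \<B>)" by (auto simp: dual_cont_fun_def intro!: exI[of _ 0])
  moreover have "B.cfun = {f \<in> B.cfun. (\<lambda>f. 0) f \<in> (UNIV :: complex set)}" by simp
  ultimately have "B.cfun \<in> {{f \<in> B.cfun. L f \<in> U} | L U. L \<in> dual_cont_fun (type_space G \<B>) \<and> open U}"
    using open_UNIV by blast
  then show ?thesis unfolding weak_topology_def topology_generated_by_topspace by blast
qed

lemma openin_weak:
  assumes "L \<in> dual_cont_fun (type_space G \<B>)" "open U"
  shows "openin (weak_topology (type_space G \<B>)) {f \<in> B.cfun. L f \<in> U}"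
  unfolding weak_topology_def by (rule topology_generated_by_Basis) (use assms in blast)

text \<open>Evaluations at points are bounded functionals that separate functions. This makes the
  compact set of translates closed, so that it contains the closure of the orbit.\<close>

lemma Hausdorff_weak: "Hausdorff_space (weak_topology (type_space G \<B>))"
  unfolding Hausdorff_space_def topspace_weak
proof (intro allI impI)
  fix f h assume fh: "f \<in> B.cfun \<and> h \<in> B.cfun \<and> f \<noteq> h"
  then obtain q where q: "q \<in> types G \<B>" "f q \<noteq> h q" using extensionalityI[OF B.cfun_ext B.cfun_ext] by metis
  have dual: "(\<lambda>f. f q) \<in> dual_cont_fun (type_space G \<B>)"
    using q(1) B.cfun_sup_norm by (auto simp: dual_cont_fun_def intro!: exI[of _ 1])
  obtain U V where UV: "open U" "open V" "f q \<in> U" "h q \<in> V" "U \<inter> V = {}" using hausdorff[OF q(2)] by blast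
  show "\<exists>U V. openin (weak_topology (type_space G \<B>)) U \<and> openin (weak_topology (type_space G \<B>)) V \<and>
      f \<in> U \<and> h \<in> V \<and> disjnt U V"
    using openin_weak[OF dual UV(1)] openin_weak[OF dual UV(2)] fh UV(3,4,5)
    by (intro exI[of _ "{f \<in> B.cfun. f q \<in> U}"] exI[of _ "{f \<in> B.cfun. f q \<in> V}"]) (auto simp: disjnt_def)
qed

lemma type_flow_weakly_almost_periodic:
  "weakly_almost_periodic G (type_space G \<B>) (type_action G \<B>)"
  unfolding weakly_almost_periodic_def
proof (intro conjI ballI)
  let ?X = "type_space G \<B>" and ?W = "weak_topology (type_space G \<B>)"
  show "G_flow G ?X (type_action G \<B>)" by (rule B.type_flow)
  fix f assume f: "f \<in> cont_fun ?X"
  have "continuous_map (type_space G \<C>) ?W (translate f)"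
    unfolding weak_topology_def
  proof (rule continuous_on_generated_topo)
    fix V assume "V \<in> {{f \<in> cont_fun ?X. L f \<in> U} | L U. L \<in> dual_cont_fun ?X \<and> open U}"
    then obtain L U where V: "V = {f \<in> cont_fun ?X. L f \<in> U}" "L \<in> dual_cont_fun ?X" "open U"
      by (elim CollectE exE conjE)
    have "translate f -` V \<inter> topspace (type_space G \<C>) = {r \<in> topspace (type_space G \<C>). L (translate f r) \<in> U}"
      using cfun_translate[OF f] by (auto simp: V(1))
    moreover have "openin (type_space G \<C>) {r \<in> topspace (type_space G \<C>). L (translate f r) \<in> U}"
      by (rule openin_continuous_map_preimage[OF continuous_map_type_fun[OF continuous_translate[OF V(2) f]]])
        (use V(3) in simp)
    ultimately show "openin (type_space G \<C>) (translate f -` V \<inter> topspace (type_space G \<C>))" by simp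
  next
    have "translate f ` topspace (type_space G \<C>) \<subseteq> topspace ?W"
      using cfun_translate[OF f] unfolding topspace_weak by auto
    then show "translate f ` topspace (type_space G \<C>) \<subseteq> \<Union>{{f \<in> cont_fun ?X. L f \<in> U} | L U. L \<in> dual_cont_fun ?X \<and> open U}"
      unfolding weak_topology_def topology_generated_by_topspace .
  qed
  then have cpt: "compactin ?W (translate f ` types G \<C>)"
    using image_compactin[of "type_space G \<C>" "types G \<C>"] C.compact_types by (simp add: compact_space_def)
  have "{\<lambda>x\<in>topspace ?X. f (type_action G \<B> a x) | a. a \<in> carrier G} \<subseteq> translate f ` types G \<C>"
  proof
    fix h assume "h \<in> {\<lambda>x\<in>topspace ?X. f (type_action G \<B> a x) | a. a \<in> carrier G}"
    then obtain a where a: "a \<in> carrier G" "h = (\<lambda>x\<in>topspace ?X. f (type_action G \<B> a x))" by (elim CollectE exE conjE)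
    have "h = translate f {A \<in> \<C>. a \<in> A}" using type_mult_point[OF a(1)] by (auto simp: a(2) translate_def)
    then show "h \<in> translate f ` types G \<C>" using C.types_point[OF a(1)] by (rule image_eqI)
  qed
  then have "?W closure_of {\<lambda>x\<in>topspace ?X. f (type_action G \<B> a x) | a. a \<in> carrier G} \<subseteq> translate f ` types G \<C>"
    using compactin_imp_closedin[OF Hausdorff_weak cpt] by (rule closure_of_minimal)
  then show "compactin ?W (?W closure_of {\<lambda>x\<in>topspace ?X. f (type_action G \<B> a x) | a. a \<in> carrier G})"
    by (rule closed_compactin[OF cpt _ closedin_closure_of])
qed

end

theorem theorem4p4:
  fixes G :: "('a, 'm) monoid_scheme" and \<B> :: "'a set set"
  assumes "group G"
    and "Sigma_Algebra.algebra (carrier G) \<B>"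
    and "left_invariant G \<B>"
    and "\<B> \<subseteq> stable_sets G"
  shows
    "(G_semigroup G (type_space G (sharp G \<B>)) (type_action G (sharp G \<B>)) (type_mult G (sharp G \<B>)) \<and>
     G_semigroup_isomorphic G
       (type_space G (sharp G \<B>)) (type_action G (sharp G \<B>)) (type_mult G (sharp G \<B>))
       (ellis_space G (type_space G \<B>) (type_action G \<B>))
       (ellis_action G (type_space G \<B>) (type_action G \<B>))
       (compose (topspace (type_space G \<B>)))) \<and>
     weakly_almost_periodic G (type_space G \<B>) (type_action G \<B>) \<and>
     (\<forall>M. minimal_subflow G (type_space G \<B>) (type_action G \<B>) M \<longleftrightarrow> M = generic_types G \<B>) \<and>
     (\<exists>e. profinite_group
       \<lparr>carrier = generic_types G (sharp G \<B>), mult = type_mult G (sharp G \<B>), one = e\<rparr>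
       (subtopology (type_space G (sharp G \<B>)) (generic_types G (sharp G \<B>)))) \<and>
     (\<exists>!\<mu>. probability_measure_on G \<B> \<mu> \<and> left_invariant_measure G \<B> \<mu>)"
proof -
  interpret group G by fact
  interpret Sigma_Algebra.algebra "carrier G" \<B> by fact
  interpret B: stable_algebra G \<B>
    by unfold_locales (use assms(3,4) stable_in_imp_wstable in \<open>auto simp: stable_sets_def\<close>)
  interpret E: stable_extension G \<B> "sharp G \<B>"
    by (rule sharp_bialgebra) unfold_locales
  have "G_semigroup_isomorphic G
       (type_space G (sharp G \<B>)) (type_action G (sharp G \<B>)) (type_mult G (sharp G \<B>))
       (ellis_space G (type_space G \<B>) (type_action G \<B>))
       (ellis_action G (type_space G \<B>) (type_action G \<B>))
       (compose (topspace (type_space G \<B>)))"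
    \<comment> \<open>Injectivity into the Ellis semigroup uses that right translates of sets in
      \<B> decide a type over the generated algebra.\<close>
    by (rule E.ellis_isomorphic) (rule sharp_types_eqI[OF B.stable_algebra_axioms])
  then show ?thesis
    using E.C.type_G_semigroup E.type_flow_weakly_almost_periodic B.minimal_subflow_iff_generic
      E.C.generic_types_profinite B.invariant_measure_ex1
    by (intro conjI allI)
qed

end
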